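(* Let $K$ be a field, $n\ge 1$, $S=K[x_1,\ldots,x_n]$, and let $1\le s\le n$. Let $\alpha: a_1<a_2<\cdots<a_s$ and $\beta: b_1<b_2<\cdots<b_s$ be (nonempty) sequences of integers with $1\le a_1$, $b_s\le n$ and $a_i\le b_i$ for all $1\le i\le s$, and let $I_{\alpha,\beta}=(x_{a_1}x_{a_1+1}\cdots x_{b_1},\ldots,x_{a_s}x_{a_s+1}\cdots x_{b_s})\subset S$. Then $$\operatorname{sdepth}(I_{\alpha,\beta})\ge\operatorname{depth}(I_{\alpha,\beta})=\varphi(\alpha,\beta)+1.$$
   Context: Stanley depth: for a finitely generated $\mathbb Z^n$-graded $S$-module $M$, a Stanley decomposition of $M$ is a direct sum $\mathcal D: M=\bigoplus_{i=1}^r m_iK[Z_i]$ as $\mathbb Z^n$-graded $K$-vector spaces, where each $m_i\in M$ is homogeneous for the $\mathbb Z^n$-grading, $Z_i\subset\{x_1,\ldots,x_n\}$, and $m_iK[Z_i]=\{um_i: u\in K[Z_i]\}$ is a free $K[Z_i]$-submodule of $M$. Set $\operatorname{sdepth}(\mathcal D)=\min_i|Z_i|$ and $\operatorname{sdepth}(M)=\max\{\operatorname{sdepth}(\mathcal D):\mathcal D \text{ a Stanley decomposition of } M\}$. Depth is with respect to the graded maximal ideal $(x_1,\ldots,x_n)$. Derived sequences: for $s\ge 1$ let $j=j(\alpha,\beta)=\max\{i: a_i\le b_1\}$. Let $\alpha': a_{j+1}<a_{j+2}<\cdots<a_s$ and $\beta': b_{j+1}<b_{j+2}<\cdots<b_s$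 (both of length $s-j$, empty if $j=s$). If $s>1$ and $j>1$, define $\alpha'',\beta''$ as follows. If $j<s$ and $a_{j+1}>b_1+1$: $\alpha'': b_1+1<a_{j+1}<a_{j+2}<\cdots<a_s$ and $\beta'': b_2<b_{j+1}<b_{j+2}<\cdots<b_s$ (length $s-j+1$). If $j<s$ and $a_{j+1}=b_1+1$: $\alpha'': b_1+1<a_{j+2}<\cdots<a_s$ and $\beta'': b_2<b_{j+2}<\cdots<b_s$ (length $s-j$). If $j=s$: $\alpha''$ and $\beta''$ are the one-term sequences $b_1+1$ and $b_2$. The number $\varphi$ (for fixed $n$) is defined recursively: $\varphi(\alpha,\beta)=n$ if $s=0$ (empty sequences); $\varphi(\alpha,\beta)=\varphi(\alpha',\beta')-1$ if $s\ge1$ and $j=1$; $\varphi(\alpha,\beta)=\varphi(\alpha'',\beta'')-1$ if $s>1$ and $j>1$. *)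

theory Defs
  imports "HOL-Library.Poly_Mapping" "HOL-Algebra.Module" "HOL-Algebra.Ideal"
begin

section \<open>Polynomial rings\<close>

text \<open>
  Exponent vectors and polynomials are finitely supported functions; the variables are
  indexed by the natural numbers, and the polynomial ring on a finite set of variables is
  cut out by a carrier set.
\<close>

type_synonym 'k mpoly = "(nat \<Rightarrow>\<^sub>0 nat) \<Rightarrow>\<^sub>0 'k"

definition var :: "nat \<Rightarrow> 'k::field mpoly" where
  "var i = Poly_Mapping.single (Poly_Mapping.single i 1) 1"

definition polys_in :: "nat set \<Rightarrow> 'k::field mpoly set" where
  "polys_in Z = {p. \<forall>t\<in>Poly_Mapping.keys p. Poly_Mapping.keys t \<subseteq> Z}"

definition poly_ring :: "nat \<Rightarrow> 'k::field mpoly ring" where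
  "poly_ring n = \<lparr>carrier = polys_in {1..n}, mult = (*), one = 1, zero = 0, add = (+)\<rparr>"

definition max_ideal :: "nat \<Rightarrow> 'k::field mpoly set" where
  "max_ideal n = Idl\<^bsub>poly_ring n\<^esub> (var ` {1..n})"

definition ideal_module :: "('a, 'b) ring_scheme \<Rightarrow> 'a set \<Rightarrow> ('a, 'a) module" where
  "ideal_module R I = \<lparr>carrier = I, mult = mult R, one = one R, zero = zero R, add = add R,
                       smult = mult R\<rparr>"

lemma polys_in_add: "p \<in> polys_in Z \<Longrightarrow> q \<in> polys_in Z \<Longrightarrow> p + q \<in> polys_in Z"
  unfolding polys_in_def using keys_add[of p q] by blast

lemma polys_in_mult: "p \<in> polys_in Z \<Longrightarrow> q \<in> polys_in Z \<Longrightarrow> p * q \<in> polys_in Z"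
proof -
  assume a: "p \<in> polys_in Z" "q \<in> polys_in Z"
  { fix t assume "t \<in> Poly_Mapping.keys (p*q)"
    then obtain a b where ab: "a \<in> Poly_Mapping.keys p" "b \<in> Poly_Mapping.keys q" "t = a + b" using keys_mult[of p q] by blast
    have "Poly_Mapping.keys t \<subseteq> Poly_Mapping.keys a \<union> Poly_Mapping.keys b" using ab keys_add by metis
    then have "Poly_Mapping.keys t \<subseteq> Z" using a ab unfolding polys_in_def by blast }
  then show ?thesis unfolding polys_in_def by blast
qed

lemma cring_poly_ring: "cring (poly_ring n :: 'k::field mpoly ring)"
proof (rule cringI)
  show "abelian_group (poly_ring n :: 'k mpoly ring)"
  proof (rule abelian_groupI)
    fix x :: "'k mpoly" assume "x \<in> carrier (poly_ring n)"
    then have "-x \<in> carrier (poly_ring n)" "-x + x = 0" by (auto simp: poly_ring_def polys_in_def in_keys_iff)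
    then show "\<exists>y\<in>carrier (poly_ring n). y \<oplus>\<^bsub>poly_ring n\<^esub> x = \<zero>\<^bsub>poly_ring n\<^esub>" by (auto simp: poly_ring_def intro: bexI[of _ "-x"])
  qed (auto simp: poly_ring_def algebra_simps polys_in_add, simp add: polys_in_def)
  show "Group.comm_monoid (poly_ring n :: 'k mpoly ring)"
    by (rule comm_monoidI) (auto simp: poly_ring_def algebra_simps polys_in_mult, simp add: polys_in_def)
qed (simp add: poly_ring_def algebra_simps)

lemma module_ideal_module: fixes R (structure) assumes "ideal I R" "cring R" shows "module R (ideal_module R I)"
proof -
  interpret cring R by fact
  interpret ideal I R by fact
  show ?thesis
  proof (rule moduleI)
    show "abelian_group (ideal_module R I)"
    proof (rule abelian_groupI)
      fix x assume "x \<in> carrier (ideal_module R I)"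
      then have "x \<in> I" by (simp add: ideal_module_def)
      then have "\<ominus> x \<in> I" "\<ominus> x \<oplus> x = \<zero>" by (auto intro: l_neg)
      then show "\<exists>y\<in>carrier (ideal_module R I). y \<oplus>\<^bsub>ideal_module R I\<^esub> x = \<zero>\<^bsub>ideal_module R I\<^esub>" by (auto simp: ideal_module_def)
    qed (auto simp: ideal_module_def a_assoc intro: a_comm)
  qed (auto simp: ideal_module_def I_l_closed l_distr r_distr m_assoc is_cring)
qed


section \<open>Depth\<close>

text \<open>The submodule $(f_1,\ldots,f_k)M$.\<close>

definition seq_smult ::
    "('a, 'm, 'c) module_scheme \<Rightarrow> 'a list \<Rightarrow> 'm set" where
  "seq_smult M fs =
     {(\<Oplus>\<^bsub>M\<^esub>i\<in>{..<length fs}. fs ! i \<odot>\<^bsub>M\<^esub> v i) | v. v \<in> {..<length fs} \<rightarrow> carrier M}"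

definition regular_sequence ::
    "('a, 'm, 'c) module_scheme \<Rightarrow> 'a list \<Rightarrow> bool" where
  "regular_sequence M fs \<longleftrightarrow>
     (\<forall>i<length fs. \<forall>x\<in>carrier M.
        fs ! i \<odot>\<^bsub>M\<^esub> x \<in> seq_smult M (take i fs) \<longrightarrow> x \<in> seq_smult M (take i fs)) \<and>
     seq_smult M fs \<noteq> carrier M"

text \<open>
  The depth of \<open>M\<close> with respect to an ideal \<open>J\<close>: the greatest length of an \<open>M\<close>-regular sequence
  in \<open>J\<close>. For a finitely generated module \<open>M\<close> with \<open>JM \<noteq> M\<close> over a Noetherian ring the set of
  these lengths is finite and nonempty (it contains 0).
\<close>

definition depth :: "'a set \<Rightarrow> ('a, 'm, 'c) module_scheme \<Rightarrow> nat" where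
  "depth J M = Max {length fs | fs. set fs \<subseteq> J \<and> regular_sequence M fs}"


section \<open>Stanley depth\<close>

text \<open>
  A $\mathbb{Z}^n$-grading of \<open>M\<close> is given by its family of components
  \<open>C :: (nat \<Rightarrow> int) \<Rightarrow> 'm set\<close>; only degrees vanishing outside \<open>{1..n}\<close> matter.
\<close>

definition homogeneous :: "nat \<Rightarrow> ((nat \<Rightarrow> int) \<Rightarrow> 'm set) \<Rightarrow> 'm \<Rightarrow> bool" where
  "homogeneous n C m \<longleftrightarrow> (\<exists>g. (\<forall>i. i \<notin> {1..n} \<longrightarrow> g i = 0) \<and> m \<in> C g)"

definition stanley_space ::
    "('k::field mpoly, 'm, 'c) module_scheme \<Rightarrow> 'm \<Rightarrow> nat set \<Rightarrow> 'm set" where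
  "stanley_space M m Z = {u \<odot>\<^bsub>M\<^esub> m | u. u \<in> polys_in Z}"

text \<open>
  A decomposition $\bigoplus_i m_i K[Z_i]$ is the list of the pairs $(m_i, Z_i)$. The summands are
  generated by homogeneous elements, hence are graded subspaces, so a direct
  sum of vector spaces is automatically one of graded vector spaces.
\<close>

definition stanley_decomposition ::
    "nat \<Rightarrow> ('k::field mpoly, 'm, 'c) module_scheme \<Rightarrow> ((nat \<Rightarrow> int) \<Rightarrow> 'm set) \<Rightarrow>
     ('m \<times> nat set) list \<Rightarrow> bool" where
  "stanley_decomposition n M C D \<longleftrightarrow>
     (\<forall>(m, Z)\<in>set D.
        m \<in> carrier M \<and> homogeneous n C m \<and> Z \<subseteq> {1..n} \<and>
        (\<forall>u\<in>polys_in Z. u \<odot>\<^bsub>M\<^esub> m = \<zero>\<^bsub>M\<^esub> \<longrightarrow> u = 0)) \<and>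
     (\<forall>x\<in>carrier M.
        \<exists>!v. v \<in> (\<Pi>\<^sub>E i\<in>{..<length D}. stanley_space M (fst (D ! i)) (snd (D ! i))) \<and>
             x = (\<Oplus>\<^bsub>M\<^esub>i\<in>{..<length D}. v i))"

definition sdepth_decomp :: "('m \<times> nat set) list \<Rightarrow> nat" where
  "sdepth_decomp D = Min ((\<lambda>(m, Z). card Z) ` set D)"

definition sdepth ::
    "nat \<Rightarrow> ('k::field mpoly, 'm, 'c) module_scheme \<Rightarrow> ((nat \<Rightarrow> int) \<Rightarrow> 'm set) \<Rightarrow> nat" where
  "sdepth n M C = Max {sdepth_decomp D | D. stanley_decomposition n M C D}"

text \<open>The $\mathbb{Z}^n$-grading that a monomial ideal inherits from the polynomial ring.\<close>

definition ideal_grading :: "'k::field mpoly set \<Rightarrow> (nat \<Rightarrow> int) \<Rightarrow> 'k mpoly set" where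
  "ideal_grading I g = {p \<in> I. \<forall>t\<in>Poly_Mapping.keys p. \<forall>i. int (Poly_Mapping.lookup t i) = g i}"


section \<open>The ideals and the recursive invariant\<close>

text \<open>
  Sequences are lists, so $a_i$ is \<open>\<alpha> ! (i - 1)\<close>.
\<close>

definition interval_ideal :: "nat \<Rightarrow> nat list \<Rightarrow> nat list \<Rightarrow> 'k::field mpoly set" where
  "interval_ideal n \<alpha> \<beta> =
     Idl\<^bsub>poly_ring n\<^esub> ((\<lambda>i. \<Prod>k\<in>{\<alpha> ! i..\<beta> ! i}. var k) ` {..<length \<alpha>})"

definition jidx :: "nat list \<Rightarrow> nat list \<Rightarrow> nat" where
  "jidx \<alpha> \<beta> = Max {i \<in> {1..length \<alpha>}. \<alpha> ! (i - 1) \<le> \<beta> ! 0}"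

definition alpha1 :: "nat list \<Rightarrow> nat list \<Rightarrow> nat list" where
  "alpha1 \<alpha> \<beta> = drop (jidx \<alpha> \<beta>) \<alpha>"

definition beta1 :: "nat list \<Rightarrow> nat list \<Rightarrow> nat list" where
  "beta1 \<alpha> \<beta> = drop (jidx \<alpha> \<beta>) \<beta>"

definition alpha2 :: "nat list \<Rightarrow> nat list \<Rightarrow> nat list" where
  "alpha2 \<alpha> \<beta> =
     (let j = jidx \<alpha> \<beta> in
      if j < length \<alpha> then
        if \<alpha> ! j > \<beta> ! 0 + 1 then (\<beta> ! 0 + 1) # drop j \<alpha>
        else (\<beta> ! 0 + 1) # drop (j + 1) \<alpha>
      else [\<beta> ! 0 + 1])"

definition beta2 :: "nat list \<Rightarrow> nat list \<Rightarrow> nat list" where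
  "beta2 \<alpha> \<beta> =
     (let j = jidx \<alpha> \<beta> in
      if j < length \<alpha> then
        if \<alpha> ! j > \<beta> ! 0 + 1 then \<beta> ! 1 # drop j \<beta>
        else \<beta> ! 1 # drop (j + 1) \<beta>
      else [\<beta> ! 1])"

text \<open>
  The last branch is only reached for lists that violate the standing assumptions
  ($a_1 \le b_1$ gives $1 \le j \le s$).
\<close>

function phi :: "nat \<Rightarrow> nat list \<Rightarrow> nat list \<Rightarrow> int" where
  "phi n \<alpha> \<beta> =
     (if length \<alpha> = 0 then int n
      else if jidx \<alpha> \<beta> = 1 then phi n (alpha1 \<alpha> \<beta>) (beta1 \<alpha> \<beta>) - 1
      else if length \<alpha> > 1 \<and> jidx \<alpha> \<beta> > 1 then phi n (alpha2 \<alpha> \<beta>) (beta2 \<alpha> \<beta>) - 1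
      else undefined)"
  by pat_completeness auto
termination
  by (relation "measure (\<lambda>(n, \<alpha>, \<beta>). length \<alpha>)") (auto simp: alpha1_def alpha2_def Let_def)

declare phi.simps [simp del]

end

theory Submission imports Defs begin

text \<open>
  Let \<open>I\<close> be the ideal and \<open>r\<close> the number of steps of the recursion, so that \<open>\<phi> = n - r\<close>. Unrolled,
  the recursion produces \<open>r\<close> disjoint intervals \<open>P\<^sub>1 < \<dots> < P\<^sub>r\<close>, the pieces: \<open>P\<^sub>1\<close> is the first interval,
  and the next piece after \<open>[p, q]\<close> is what the first interval starting to the right of \<open>p\<close> leaves
  beyond \<open>q\<close> (\<open>phi_eq_pieces\<close>). The value \<open>\<phi> + 1\<close> to be reached is \<open>n - (r - 1)\<close>.

  Both lower bounds come from one object: a filtration of \<open>I\<close> by monomial ideals whose successive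
  quotients are shifted copies of \<open>S/P\<^sub>C\<close>, where \<open>P\<^sub>C\<close> is generated by the variables with index in \<open>C\<close>
  and \<open>C\<close> has at most \<open>r - 1\<close> elements (\<open>prime_filt_intervals\<close>). It is built by adding the intervals
  from the last to the first; a new generator contributes \<open>S/J\<close>, with \<open>J\<close> again an ideal of intervals,
  cut off at the end of the new one. Such an \<open>S/J\<close> with first piece \<open>[p, q]\<close> is filtered by adding to
  \<open>J\<close> the products of the variables from \<open>c\<close> to \<open>q\<close>, for \<open>c = p, p + 1, \<dots>, q + 1\<close>: each successive
  quotient has as annihilator one variable plus a cut ideal with fewer pieces.
  A filtration of this kind splits the monomials of \<open>I\<close> into disjoint translates of the monomials in
  the variables outside \<open>C\<close>, which is a Stanley decomposition (\<open>sdepth_ge_if_prime_filt\<close>). Moreover a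
  sequence that is regular on all the quotients is regular on \<open>I\<close> (\<open>regular_on_prime_filt\<close>). Generic
  linear forms would do over an infinite field; the elementary symmetric polynomials
  \<open>e\<^sub>1, e\<^sub>2, \<dots>, e\<^sub>m\<close> with \<open>m = n - (r - 1)\<close> do over every field (\<open>elem_sym_regular_on\<close>).

  The upper bound uses Koszul homology with respect to the variables. Polynomials in the maximal
  ideal act on it as zero, so that passing to the quotient by a regular element moves a nonzero
  class one degree up; as nothing lives above degree \<open>n\<close>, a nonzero class in degree \<open>i\<close> bounds the
  length of a regular sequence by \<open>n - i\<close> (\<open>koszul_nonzero_regular_on\<close>). The ideal \<open>I\<close> has a nonzero
  class in degree \<open>r - 1\<close> (\<open>koszul_nonzero_intervals\<close>): the boundary in the Koszul complex of \<open>S\<close> of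
  \<open>x\<^bsup>V - C\<^esup> e\<^sub>C\<close>, where \<open>V\<close> is the union of the pieces and \<open>C\<close> the set of their left ends. It is
  detected by the functional that sums, over the transversals \<open>T\<close> of \<open>P\<^sub>2, \<dots>, P\<^sub>r\<close>, the coefficients of
  \<open>x\<^bsup>V - T\<^esup> e\<^sub>T\<close>.
\<close>

section \<open>Monomials\<close>

abbreviation keys :: "('a \<Rightarrow>\<^sub>0 'b::zero) \<Rightarrow> 'a set" where
  "keys \<equiv> Poly_Mapping.keys"

abbreviation lookup :: "('a \<Rightarrow>\<^sub>0 'b::zero) \<Rightarrow> 'a \<Rightarrow> 'b" where
  "lookup \<equiv> Poly_Mapping.lookup"

abbreviation single :: "'a \<Rightarrow> 'b \<Rightarrow> 'a \<Rightarrow>\<^sub>0 'b::zero" where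
  "single \<equiv> Poly_Mapping.single"

abbreviation monom :: "(nat \<Rightarrow>\<^sub>0 nat) \<Rightarrow> 'k::field mpoly" where
  "monom t \<equiv> single t 1"

definition expos :: "nat \<Rightarrow> (nat \<Rightarrow>\<^sub>0 nat) set" where
  "expos n = {t. keys t \<subseteq> {1..n}}"

definition indic :: "nat set \<Rightarrow> (nat \<Rightarrow>\<^sub>0 nat)" where
  "indic T = (\<Sum>i\<in>T. single i 1)"

definition restr :: "'a set \<Rightarrow> ('a \<Rightarrow>\<^sub>0 'b::zero) \<Rightarrow> ('a \<Rightarrow>\<^sub>0 'b)" where
  "restr U p = Abs_poly_mapping (\<lambda>t. if t \<in> U then lookup p t else 0)"

lemma lookup_restr: "lookup (restr U p) t = (if t \<in> U then lookup p t else 0)"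
proof -
  have "finite {t. (if t \<in> U then lookup p t else 0) \<noteq> 0}"
    by (rule finite_subset[OF _ finite_lookup[of p]]) auto
  then show ?thesis by (simp add: restr_def)
qed

lemma keys_restr: "keys (restr U p) = keys p \<inter> U"
  by (auto simp: in_keys_iff lookup_restr split: if_splits)

lemma restr_add: "restr U (p + q) = restr U p + restr U q" for p q :: "'a \<Rightarrow>\<^sub>0 'b::monoid_add"
  by (rule poly_mapping_eqI) (simp add: lookup_restr lookup_add)

lemma restr_id: "keys p \<subseteq> U \<Longrightarrow> restr U p = p"
  by (rule poly_mapping_eqI) (auto simp: lookup_restr in_keys_iff)

lemma restr_zero_if_disjoint: "keys p \<inter> U = {} \<Longrightarrow> restr U p = 0"
  by (rule poly_mapping_eqI) (auto simp: lookup_restr in_keys_iff)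

lemma restr_split: "p = restr U p + restr (- U) p" for p :: "'a \<Rightarrow>\<^sub>0 'b::monoid_add"
  by (rule poly_mapping_eqI) (simp add: lookup_restr lookup_add)

lemma keys_plus_nat: "keys (s + t) = keys s \<union> keys t"
  for s t :: "'a \<Rightarrow>\<^sub>0 nat"
  by (auto simp: in_keys_iff lookup_add)

lemma keys_add_subset: "keys p \<subseteq> U \<Longrightarrow> keys q \<subseteq> U \<Longrightarrow> keys (p + q) \<subseteq> U"
  using keys_add[of p q] by blast

lemma keys_sum_subset:
  assumes "\<And>i. i \<in> A \<Longrightarrow> keys (g i) \<subseteq> U"
  shows "keys (sum g A) \<subseteq> U"
proof -
  have "F \<subseteq> A \<Longrightarrow> keys (sum g F) \<subseteq> U" for F
  proof (induction F rule: infinite_finite_induct)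
    case (insert x F)
    then have "keys (g x + sum g F) \<subseteq> U"
      by (intro keys_add_subset assms) auto
    then show ?case unfolding sum.insert[OF insert(1,2)] .
  next
    case empty
    show ?case unfolding sum.empty by (metis keys_zero empty_subsetI)
  next
    case (infinite F)
    show ?case unfolding sum.infinite[OF infinite(1)] by (metis keys_zero empty_subsetI)
  qed
  from this[OF order_refl] show ?thesis .
qed

lemma lookup_monom_mult: "lookup (monom w * p) (w + t) = lookup p t"
proof -
  have "lookup (monom w * p) (w + t)
      = (\<Sum>l. ((\<Sum>q. lookup p q when w + t = l + q) when w = l))"
    unfolding lookup_mult lookup_single when_mult mult_1_left ..
  also have "\<dots> = (\<Sum>q. lookup p q when w + t = w + q)"
    by (rule Sum_any_when_equal')
  also have "\<dots> = (\<Sum>q. lookup p q when t = q)"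
    unfolding add_left_cancel ..
  finally show ?thesis unfolding Sum_any_when_equal' .
qed

lemma keys_monom_mult: "keys (monom w * p) = (+) w ` keys p"
proof
  show "keys (monom w * p) \<subseteq> (+) w ` keys p"
    using keys_mult[of "monom w" p] by auto
  show "(+) w ` keys p \<subseteq> keys (monom w * p)"
    by (auto simp: in_keys_iff lookup_monom_mult)
qed

lemma monom_mult_eq_0_iff: "monom w * p = 0 \<longleftrightarrow> p = 0"
  by (metis keys_monom_mult keys_eq_empty image_is_empty)

lemma lookup_indic: "finite T \<Longrightarrow> lookup (indic T) i = (if i \<in> T then 1 else 0)"
  by (simp add: indic_def lookup_sum lookup_single when_def)

lemma keys_indic: "finite T \<Longrightarrow> keys (indic T) = T"
  by (auto simp: in_keys_iff lookup_indic split: if_splits)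

lemma indic_insert: "finite T \<Longrightarrow> i \<notin> T \<Longrightarrow> indic (insert i T) = single i 1 + indic T"
  by (simp add: indic_def)

lemma monom_indic: "finite T \<Longrightarrow> monom (indic T) = (\<Prod>k\<in>T. var k)"
proof (induction T rule: finite_induct)
  case empty
  then show ?case by (simp add: indic_def)
next
  case (insert x F)
  have "monom (indic (insert x F)) = var x * (monom (indic F) :: 'a mpoly)"
    using insert(1,2) by (simp add: indic_insert var_def mult_single)
  then show ?case using insert by (metis prod.insert)
qed

lemma minus_plus_exponent:
  fixes s t :: "nat \<Rightarrow>\<^sub>0 nat"
  assumes "\<And>i. lookup s i \<le> lookup t i"
  shows "s + (t - s) = t"
  by (rule poly_mapping_eqI) (simp add: lookup_add lookup_minus assms)

lemma indic_plus_minus: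
  assumes "finite T" "T \<subseteq> keys t"
  shows "indic T + (t - indic T) = t"
  using assms by (intro minus_plus_exponent) (auto simp: lookup_indic in_keys_iff)

lemma expos_add_iff: "s + t \<in> expos n \<longleftrightarrow> s \<in> expos n \<and> t \<in> expos n"
  by (simp add: expos_def keys_plus_nat)

lemma expos_zero: "0 \<in> expos n"
  by (simp add: expos_def)

lemma polys_in_iff: "p \<in> polys_in {1..n} \<longleftrightarrow> keys p \<subseteq> expos n"
  by (auto simp: polys_in_def expos_def)

lemma sum_single_keys:
  "p = (\<Sum>t\<in>keys p. single t (lookup p t))"
proof (rule poly_mapping_eqI)
  fix u
  have "lookup (\<Sum>t\<in>keys p. single t (lookup p t)) u
     = (\<Sum>t\<in>keys p. if t = u then lookup p t else 0)"
    unfolding lookup_sum lookup_single when_def ..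
  also have "\<dots> = lookup p u" by (simp add: sum.delta' in_keys_iff)
  finally show "lookup p u =
    lookup (\<Sum>t\<in>keys p. single t (lookup p t)) u" ..
qed

text \<open>
  Truncated subtraction of exponents divides by a monomial wherever division is possible.
\<close>

lemma divide_by_monom:
  fixes p :: "'k::field mpoly"
  assumes "keys p \<subseteq> (+) w ` X"
  shows "\<exists>q. p = monom w * q \<and> keys q \<subseteq> X"
proof -
  define q where "q = (\<Sum>t\<in>keys p. single (t - w) (lookup p t))"
  have w: "w + (t - w) = t" "t - w \<in> X" if "t \<in> keys p" for t using assms that by auto
  have m: "monom w * q = (\<Sum>t\<in>keys p. single t (lookup p t))"
    unfolding q_def sum_distrib_left by (rule sum.cong[OF HOL.refl]) (simp only: mult_single w(1) mult_1_left)
  have "p = monom w * q" by (rule trans[OF sum_single_keys m[symmetric]])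
  moreover have "keys q \<subseteq> X"
    unfolding q_def using w(2) by (intro keys_sum_subset) (simp split: if_splits)
  ultimately show ?thesis by (intro exI[of _ q] conjI)
qed

section \<open>Submodules and regular sequences\<close>

text \<open>
  Submodules of the polynomial ring over the ring in the variables \<open>1, \<dots>, n\<close>; a quotient \<open>A/B\<close> is
  represented throughout by the pair of submodules \<open>A\<close>, \<open>B\<close>, which avoids cosets.
\<close>

definition submod :: "nat \<Rightarrow> 'k::field mpoly set \<Rightarrow> bool" where
  "submod n A \<longleftrightarrow> 0 \<in> A \<and> (\<forall>a\<in>A. \<forall>b\<in>A. a + b \<in> A) \<and> (\<forall>p\<in>polys_in {1..n}. \<forall>a\<in>A. p * a \<in> A)"

lemma submodD:
  assumes "submod n A"
  shows "0 \<in> A" "a \<in> A \<Longrightarrow> b \<in> A \<Longrightarrow> a + b \<in> A" "p \<in> polys_in {1..n} \<Longrightarrow> a \<in> A \<Longrightarrow> p * a \<in> A"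
  using assms unfolding submod_def by blast+

lemma submod_uminus:
  assumes "submod n A" "a \<in> A"
  shows "- a \<in> A"
proof -
  have "- 1 \<in> polys_in {1..n}" by (auto simp: polys_in_def in_keys_iff lookup_one when_def split: if_splits)
  from submodD(3)[OF assms(1) this assms(2)] show ?thesis by simp
qed

lemma submod_diff:
  assumes "submod n A" "a \<in> A" "b \<in> A"
  shows "a - b \<in> A"
  using submodD(2)[OF assms(1,2) submod_uminus[OF assms(1,3)]] by simp

lemma submod_sum: "submod n A \<Longrightarrow> (\<And>i. i \<in> X \<Longrightarrow> g i \<in> A) \<Longrightarrow> sum g X \<in> A"
proof (induction X rule: infinite_finite_induct)
  case (insert x F)
  then show ?case using submodD(2)[OF insert(4), of "g x" "sum g F"] by simp
qed (simp_all add: submodD(1))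

lemma submod_polys_in: "submod n (polys_in {1..n})"
  unfolding submod_def by (intro conjI ballI polys_in_add polys_in_mult) (simp_all add: polys_in_def)

text \<open>
  This is \<open>B + (f\<^sub>0, \<dots>, f\<^sub>i\<^sub>-\<^sub>1)A\<close>, so that it represents the submodule \<open>(f\<^sub>0, \<dots>, f\<^sub>i\<^sub>-\<^sub>1)M\<close> of \<open>M = A/B\<close>.
\<close>

primrec adjoin :: "(nat \<Rightarrow> 'k::field mpoly) \<Rightarrow> 'k mpoly set \<Rightarrow> 'k mpoly set \<Rightarrow> nat \<Rightarrow> 'k mpoly set" where
  "adjoin f A B 0 = B"
| "adjoin f A B (Suc i) = {y + f i * a | y a. y \<in> adjoin f A B i \<and> a \<in> A}"

text \<open>
  The condition on zero divisors alone; that \<open>(f)M \<noteq> M\<close> is a matter of degrees (\<open>adjoin_elem_sym_neq\<close>).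
\<close>

definition regular_on :: "(nat \<Rightarrow> 'k::field mpoly) \<Rightarrow> nat \<Rightarrow> 'k mpoly set \<Rightarrow> 'k mpoly set \<Rightarrow> bool" where
  "regular_on f k A B \<longleftrightarrow> (\<forall>i<k. \<forall>a\<in>A. f i * a \<in> adjoin f A B i \<longrightarrow> a \<in> adjoin f A B i)"

lemma regular_onD: "regular_on f k A B \<Longrightarrow> i < k \<Longrightarrow> a \<in> A \<Longrightarrow> f i * a \<in> adjoin f A B i \<Longrightarrow> a \<in> adjoin f A B i"
  by (simp add: regular_on_def)

lemma submod_adjoin:
  assumes A: "submod n A" and B: "submod n B"
  shows "submod n (adjoin f A B i)"
proof (induction i)
  case 0
  then show ?case by (simp add: B)
next
  case (Suc i)
  note IH = submodD[OF Suc] submod_diff[OF Suc]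
  show ?case unfolding submod_def
  proof (intro conjI ballI)
    show "0 \<in> adjoin f A B (Suc i)" using IH(1) submodD(1)[OF A] by (force intro: exI[of _ 0])
  next
    fix a b assume "a \<in> adjoin f A B (Suc i)" "b \<in> adjoin f A B (Suc i)"
    then obtain y c z d where *: "a = y + f i * c" "b = z + f i * d" "y \<in> adjoin f A B i" "z \<in> adjoin f A B i" "c \<in> A" "d \<in> A"
      by auto
    have "a + b = (y + z) + f i * (c + d)" by (simp add: * algebra_simps)
    moreover have "y + z \<in> adjoin f A B i" "c + d \<in> A" using * IH(2) submodD(2)[OF A] by auto
    ultimately show "a + b \<in> adjoin f A B (Suc i)" by auto
  next
    fix p a :: "'a mpoly" assume p: "p \<in> polys_in {1..n}" and "a \<in> adjoin f A B (Suc i)"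
    then obtain y c where *: "a = y + f i * c" "y \<in> adjoin f A B i" "c \<in> A" by auto
    have "p * a = p * y + f i * (p * c)" by (simp add: * algebra_simps)
    moreover have "p * y \<in> adjoin f A B i" "p * c \<in> A" using * p IH(3) submodD(3)[OF A] by auto
    ultimately show "p * a \<in> adjoin f A B (Suc i)" by auto
  qed
qed

lemma adjoin_Suc_subset: "0 \<in> A \<Longrightarrow> adjoin f A B i \<subseteq> adjoin f A B (Suc i)"
  by force

lemma base_subset_adjoin: "0 \<in> A \<Longrightarrow> B \<subseteq> adjoin f A B i"
proof (induction i)
  case (Suc i)
  then show ?case using adjoin_Suc_subset[of A f B i] by blast
qed simp

lemma adjoin_mono: "A \<subseteq> A' \<Longrightarrow> B \<subseteq> B' \<Longrightarrow> adjoin f A B i \<subseteq> adjoin f A' B' i"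
proof (induction i)
  case (Suc i)
  then show ?case by auto
qed simp

lemma adjoin_subset:
  assumes "submod n A" "B \<subseteq> A" "\<And>j. j < i \<Longrightarrow> f j \<in> polys_in {1..n}"
  shows "adjoin f A B i \<subseteq> A"
  using assms(3)
proof (induction i)
  case 0
  then show ?case by (simp add: assms)
next
  case (Suc i)
  then have "adjoin f A B i \<subseteq> A" by simp
  then show ?case using submodD(2,3)[OF assms(1)] Suc(2)[of i] by auto
qed

text \<open>
  An element of \<open>B + (f)A\<close> has a part in \<open>(f)A\<close> that does not depend on the base, which allows the base
  to be exchanged.
\<close>

lemma adjoin_base_sum:
  assumes "x \<in> adjoin f A B i"
  shows "\<exists>y b. b \<in> B \<and> x = y + b \<and> (\<forall>C. 0 \<in> C \<longrightarrow> y \<in> adjoin f A C i)"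
  using assms
proof (induction i arbitrary: x)
  case 0
  then show ?case by (intro exI[of _ 0] exI[of _ x]) auto
next
  case (Suc i)
  then obtain z a where z: "x = z + f i * a" "z \<in> adjoin f A B i" "a \<in> A" by auto
  from Suc.IH[OF z(2)] obtain y b where yb: "b \<in> B" "z = y + b" "\<forall>C. 0 \<in> C \<longrightarrow> y \<in> adjoin f A C i" by blast
  have "x = (y + f i * a) + b" by (simp add: z yb algebra_simps)
  moreover have "\<forall>C. 0 \<in> C \<longrightarrow> y + f i * a \<in> adjoin f A C (Suc i)" using yb(3) z(3) by auto
  ultimately show ?case using yb(1) by blast
qed

text \<open>
  The vanishing of \<open>Tor\<close> in elementary terms: when the sequence is regular on \<open>A/B\<close>, then
  \<open>(f)A \<inter> B = (f)B\<close>, here modulo \<open>C\<close>. One proceeds along the sequence: if \<open>y + f\<^sub>i a\<close> lies in \<open>B\<close>, then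
  regularity on \<open>A/B\<close> moves \<open>a\<close> into \<open>B\<close> up to an element of the earlier submodule.
\<close>

lemma adjoin_inter:
  assumes A: "submod n A" and B: "submod n B" and C: "submod n C" and CB: "C \<subseteq> B"
    and f: "\<And>i. i < k \<Longrightarrow> f i \<in> polys_in {1..n}"
    and reg: "regular_on f k A B" and ik: "i \<le> k"
  shows "adjoin f A C i \<inter> B \<subseteq> adjoin f B C i"
  using ik
proof (induction i)
  case 0
  then show ?case by simp
next
  case (Suc i)
  show ?case
  proof
    fix b assume b: "b \<in> adjoin f A C (Suc i) \<inter> B"
    then obtain y a where ya: "b = y + f i * a" "y \<in> adjoin f A C i" "a \<in> A" by auto
    have sub: "submod n (adjoin f A B i)" by (rule submod_adjoin[OF A B])
    have "y \<in> adjoin f A B i" using ya(2) adjoin_mono[OF order_refl CB] by blast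
    moreover have "b \<in> adjoin f A B i" using b base_subset_adjoin submodD(1)[OF A] by blast
    moreover have "f i * a = b - y" by (simp add: ya)
    ultimately have "f i * a \<in> adjoin f A B i" using submod_diff[OF sub] by simp
    then have "a \<in> adjoin f A B i" using regular_onD[OF reg] Suc.prems ya(3) by simp
    then obtain w b' where w: "b' \<in> B" "a = w + b'" "\<forall>C. 0 \<in> C \<longrightarrow> w \<in> adjoin f A C i"
      using adjoin_base_sum by metis
    have wC: "w \<in> adjoin f A C i" using w(3) submodD(1)[OF C] by blast
    have subC: "submod n (adjoin f A C i)" by (rule submod_adjoin[OF A C])
    have fi: "f i \<in> polys_in {1..n}" using f Suc.prems by simp
    have "b - f i * b' = y + f i * w" by (simp add: ya w(2) algebra_simps)
    moreover have "y + f i * w \<in> adjoin f A C i" using ya(2) wC submodD(2,3)[OF subC] fi by blast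
    moreover have "b - f i * b' \<in> B" using b w(1) fi submodD[OF B] submod_diff[OF B] by blast
    ultimately have "b - f i * b' \<in> adjoin f B C i" using Suc by auto
    then show "b \<in> adjoin f B C (Suc i)" using w(1) unfolding adjoin.simps
      by (intro CollectI exI[of _ "b - f i * b'"] exI[of _ b']) simp
  qed
qed

text \<open>
  A sequence regular on \<open>A/B\<close> and on \<open>B/C\<close> is regular on \<open>A/C\<close>: an element annihilated modulo \<open>f\<close> is first
  pushed into \<open>B\<close> by regularity on \<open>A/B\<close>; the relation that it satisfies can then be read in \<open>B/C\<close>
  thanks to \<open>adjoin_inter\<close>.
\<close>

lemma regular_on_trans:
  assumes A: "submod n A" and B: "submod n B" and C: "submod n C"
    and CB: "C \<subseteq> B" and BA: "B \<subseteq> A"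
    and f: "\<And>i. i < k \<Longrightarrow> f i \<in> polys_in {1..n}"
    and regA: "regular_on f k A B" and regB: "regular_on f k B C"
  shows "regular_on f k A C"
  unfolding regular_on_def
proof (intro allI impI ballI)
  fix i a assume i: "i < k" and a: "a \<in> A" and fa: "f i * a \<in> adjoin f A C i"
  have fi: "f i \<in> polys_in {1..n}" using f i by simp
  have subC: "submod n (adjoin f A C i)" by (rule submod_adjoin[OF A C])
  have "f i * a \<in> adjoin f A B i" using fa adjoin_mono[OF order_refl CB] by blast
  then have "a \<in> adjoin f A B i" using regular_onD[OF regA i a] by blast
  then obtain w b where w: "b \<in> B" "a = w + b" "\<forall>C. 0 \<in> C \<longrightarrow> w \<in> adjoin f A C i"
    using adjoin_base_sum by metis
  have wC: "w \<in> adjoin f A C i" using w(3) submodD(1)[OF C] by blast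
  have "f i * b = f i * a - f i * w" by (simp add: w(2) algebra_simps)
  then have "f i * b \<in> adjoin f A C i" using fa wC submodD(3)[OF subC] submod_diff[OF subC] fi by simp
  moreover have "f i * b \<in> B" using w(1) fi submodD[OF B] submod_diff[OF B] by blast
  ultimately have "f i * b \<in> adjoin f B C i" using adjoin_inter[OF A B C CB f regA, of i] i by auto
  then have "b \<in> adjoin f B C i" using regular_onD[OF regB i w(1)] by blast
  then have "b \<in> adjoin f A C i" using adjoin_mono[OF BA order_refl] by blast
  then show "a \<in> adjoin f A C i" using wC w(2) submodD(2)[OF subC] by simp
qed

text \<open>
  The quotient \<open>A/B\<close> is generated by \<open>u\<close> with annihilator \<open>P\<close>, hence isomorphic to \<open>S/P\<close>; the two auxiliary
  facts transport the submodules \<open>(f)M\<close> along multiplication by \<open>u\<close> in both directions.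
\<close>

lemma regular_on_cyclic:
  assumes B: "submod n B" and P: "submod n P" and SP: "P \<subseteq> polys_in {1..n}"
    and A: "A = {b + u * s | b s. b \<in> B \<and> s \<in> polys_in {1..n}}"
    and u: "u \<in> polys_in {1..n}"
    and colon: "\<And>s. s \<in> polys_in {1..n} \<Longrightarrow> u * s \<in> B \<longleftrightarrow> s \<in> P"
    and f: "\<And>i. i < k \<Longrightarrow> f i \<in> polys_in {1..n}"
    and reg: "regular_on f k (polys_in {1..n}) P"
  shows "regular_on f k A B"
proof -
  let ?S = "polys_in {1..n} :: 'a mpoly set"
  have S: "submod n ?S" by (rule submod_polys_in)
  have down: "\<exists>b s. b \<in> B \<and> s \<in> adjoin f ?S {0} i \<and> x = u * s + b"
    if "x \<in> adjoin f A B i" "i \<le> k" for x i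
    using that
  proof (induction i arbitrary: x)
    case 0
    then show ?case by (intro exI[of _ x] exI[of _ 0]) auto
  next
    case (Suc i)
    then obtain y a where y: "x = y + f i * a" "y \<in> adjoin f A B i" "a \<in> A" by auto
    from Suc.IH[OF y(2)] Suc.prems obtain b s where b: "b \<in> B" "s \<in> adjoin f ?S {0} i" "y = u * s + b" by auto
    from y(3) A obtain b' s' where b': "a = b' + u * s'" "b' \<in> B" "s' \<in> ?S" by auto
    have "f i \<in> ?S" using f Suc.prems by simp
    then have "f i * b' + b \<in> B" using b b' submodD[OF B] submod_diff[OF B] by blast
    moreover have "s + f i * s' \<in> adjoin f ?S {0} (Suc i)" using b b' by auto
    moreover have "x = u * (s + f i * s') + (f i * b' + b)" by (simp add: y b b' algebra_simps)
    ultimately show ?case by blast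
  qed
  have up: "u * s \<in> adjoin f A B i" if "s \<in> adjoin f ?S P i" "i \<le> k" for s i
    using that
  proof (induction i arbitrary: s)
    case 0
    then show ?case using colon[of s] SP by auto
  next
    case (Suc i)
    then obtain y a where y: "s = y + f i * a" "y \<in> adjoin f ?S P i" "a \<in> ?S" by auto
    have "u * a \<in> A" unfolding A using y(3) submodD(1)[OF B] by force
    moreover have "u * s = u * y + f i * (u * a)" by (simp add: y algebra_simps)
    moreover have "u * y \<in> adjoin f A B i" using Suc y by simp
    ultimately show ?case by auto
  qed
  have subA: "submod n A" unfolding submod_def
  proof (intro conjI ballI)
    show "0 \<in> A" unfolding A using submodD(1)[OF B] submodD(1)[OF S] by force
  next
    fix a b assume "a \<in> A" "b \<in> A"
    then obtain p q s t where *: "a = p + u * s" "b = q + u * t" "p \<in> B" "q \<in> B" "s \<in> ?S" "t \<in> ?S" using A by auto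
    have "a + b = (p + q) + u * (s + t)" by (simp add: * algebra_simps)
    then show "a + b \<in> A" unfolding A using * submodD(2)[OF B] submodD(2)[OF S] by blast
  next
    fix r a :: "'a mpoly" assume r: "r \<in> ?S" and "a \<in> A"
    then obtain p s where *: "a = p + u * s" "p \<in> B" "s \<in> ?S" using A by auto
    have "r * a = r * p + u * (r * s)" by (simp add: * algebra_simps)
    then show "r * a \<in> A" unfolding A using * r submodD(3)[OF B] submodD(3)[OF S] by blast
  qed
  show ?thesis unfolding regular_on_def
  proof (intro allI impI ballI)
    fix i a assume i: "i < k" and a: "a \<in> A" and fa: "f i * a \<in> adjoin f A B i"
    have fi: "f i \<in> ?S" using f i by simp
    from a A obtain b s where b: "a = b + u * s" "b \<in> B" "s \<in> ?S" by auto
    from down[OF fa] i obtain c t where c: "c \<in> B" "t \<in> adjoin f ?S {0} i" "f i * a = u * t + c" by auto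
    have tS: "t \<in> ?S" using adjoin_subset[OF S, of "{0}" i f] f i c(2) submodD(1)[OF S] by auto
    have "u * (f i * s - t) = c - f i * b" using c(3) unfolding b(1) by (simp add: algebra_simps)
    then have "u * (f i * s - t) \<in> B"
      using submod_diff[OF B c(1) submodD(3)[OF B fi b(2)]] by simp
    moreover have "f i * s - t \<in> ?S" using b(3) tS fi submodD[OF S] submod_diff[OF S] by blast
    ultimately have d: "f i * s - t \<in> P" using colon by blast
    have subP: "submod n (adjoin f ?S P i)" by (rule submod_adjoin[OF S P])
    have "t \<in> adjoin f ?S P i" using c(2) adjoin_mono[OF order_refl, of "{0}" P f ?S i] submodD(1)[OF P] by auto
    moreover have "f i * s - t \<in> adjoin f ?S P i" using d base_subset_adjoin submodD(1)[OF S] by blast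
    ultimately have "(f i * s - t) + t \<in> adjoin f ?S P i" using submodD(2)[OF subP] by blast
    then have "s \<in> adjoin f ?S P i" using regular_onD[OF reg i b(3)] by simp
    then have "u * s \<in> adjoin f A B i" using up i by simp
    moreover have "b \<in> adjoin f A B i" using b(2) base_subset_adjoin submodD(1)[OF subA] by blast
    ultimately show "a \<in> adjoin f A B i" unfolding b(1)
      using submodD(2)[OF submod_adjoin[OF subA B]] by blast
  qed
qed


section \<open>Filtrations with prime quotients\<close>

abbreviation multiples :: "nat \<Rightarrow> (nat \<Rightarrow>\<^sub>0 nat) \<Rightarrow> (nat \<Rightarrow>\<^sub>0 nat) set" where
  "multiples n w \<equiv> (+) w ` expos n"

text \<open>
  Monomial ideals are represented by their sets of exponents. A step adds the monomial \<open>w\<close>; its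
  condition says that \<open>(V : w)\<close> is generated by the variables in \<open>C\<close>, so that the new quotient is a
  shifted copy of \<open>S/P\<^sub>C\<close>, of dimension at least \<open>n - R\<close>.
\<close>

inductive prime_filt :: "nat \<Rightarrow> nat \<Rightarrow> (nat \<Rightarrow>\<^sub>0 nat) set \<Rightarrow> (nat \<Rightarrow>\<^sub>0 nat) set \<Rightarrow> bool"
  for n R :: nat and U :: "(nat \<Rightarrow>\<^sub>0 nat) set" where
  refl: "prime_filt n R U U"
| step: "prime_filt n R U V \<Longrightarrow> w \<in> expos n \<Longrightarrow> C \<subseteq> {1..n} \<Longrightarrow> card C \<le> R \<Longrightarrow>
         (\<And>t. t \<in> expos n \<Longrightarrow> w + t \<in> V \<longleftrightarrow> keys t \<inter> C \<noteq> {}) \<Longrightarrow>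
         prime_filt n R U (V \<union> multiples n w)"

lemma prime_filt_trans:
  assumes "prime_filt n R V W" "prime_filt n R U V"
  shows "prime_filt n R U W"
  using assms(1)
proof (induction rule: prime_filt.induct)
  case refl
  then show ?case by (rule assms(2))
next
  case (step V w C)
  then show ?case by (intro prime_filt.step)
qed

lemma prime_filt_mono:
  assumes "prime_filt n R U V" "R \<le> R'"
  shows "prime_filt n R' U V"
  using assms
proof (induction rule: prime_filt.induct)
  case refl
  then show ?case by (intro prime_filt.refl)
next
  case (step V w C)
  then show ?case by (intro prime_filt.step[of n R' U V w C]) auto
qed

lemma prime_filt_subset: "prime_filt n R U V \<Longrightarrow> U \<subseteq> V"
  by (induction rule: prime_filt.induct) auto

definition upset :: "nat \<Rightarrow> (nat \<Rightarrow>\<^sub>0 nat) set \<Rightarrow> bool" where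
  "upset n U \<longleftrightarrow> U \<subseteq> expos n \<and> (\<forall>u\<in>U. \<forall>t\<in>expos n. u + t \<in> U)"

lemma upset_multiples: "w \<in> expos n \<Longrightarrow> upset n (multiples n w)"
  by (auto simp: upset_def expos_add_iff add.assoc)

lemma upset_Un: "upset n U \<Longrightarrow> upset n V \<Longrightarrow> upset n (U \<union> V)"
  unfolding upset_def by blast

lemma upset_prime_filt: "prime_filt n R U V \<Longrightarrow> upset n U \<Longrightarrow> upset n V"
  by (induction rule: prime_filt.induct) (auto intro: upset_Un upset_multiples)

text \<open>
  The module \<open>(U + (u))/U\<close> is a shifted copy of \<open>S/(U : u)\<close>, so a filtration above \<open>U : u\<close> is shifted by \<open>u\<close>.
\<close>

lemma prime_filt_colon:
  assumes "prime_filt n R {t \<in> expos n. u + t \<in> U} V" "u \<in> expos n" "upset n U"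
  shows "prime_filt n R U (U \<union> (+) u ` V)"
  using assms(1)
proof (induction rule: prime_filt.induct)
  case refl
  have "U \<union> (+) u ` {t \<in> expos n. u + t \<in> U} = U" by auto
  then show ?case by (simp add: prime_filt.refl)
next
  case (step V w C)
  have sub: "{t \<in> expos n. u + t \<in> U} \<subseteq> V" by (rule prime_filt_subset[OF step(1)])
  have "prime_filt n R U ((U \<union> (+) u ` V) \<union> multiples n (u + w))"
  proof (rule prime_filt.step[OF step(6) _ step(3,4)])
    show "u + w \<in> expos n" using step(2) assms(2) by (simp add: expos_add_iff)
    fix t assume t: "t \<in> expos n"
    have "u + w + t \<in> U \<union> (+) u ` V \<longleftrightarrow> w + t \<in> V"
      using sub step(2) t by (auto simp: add.assoc expos_add_iff)
    then show "(u + w + t \<in> U \<union> (+) u ` V) = (keys t \<inter> C \<noteq> {})"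
      using step(5)[OF t] by simp
  qed
  moreover have "(U \<union> (+) u ` V) \<union> multiples n (u + w) = U \<union> (+) u ` (V \<union> multiples n w)"
    by (auto simp: image_Un image_image add.assoc)
  ultimately show ?case by simp
qed

lemma multiples_single_iff:
  assumes "a \<in> {1..n}"
  shows "t \<in> multiples n (single a 1) \<longleftrightarrow> t \<in> expos n \<and> a \<in> keys t"
proof
  assume "t \<in> multiples n (single a 1)"
  then show "t \<in> expos n \<and> a \<in> keys t"
    using assms by (auto simp: keys_plus_nat expos_def)
next
  assume *: "t \<in> expos n \<and> a \<in> keys t"
  then have "single a 1 + (t - single a 1) = t"
    by (intro minus_plus_exponent) (auto simp: lookup_single when_def in_keys_iff)
  then show "t \<in> multiples n (single a 1)" using * by (metis expos_add_iff imageI)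
qed

text \<open>
  Reducing a filtration modulo one more variable: a step whose monomial is divisible by the variable
  becomes void, and at the others the variable joins \<open>C\<close>.
\<close>

lemma prime_filt_add_var:
  assumes "prime_filt n R U V" "a \<in> {1..n}"
  shows "prime_filt n (Suc R) (U \<union> multiples n (single a 1)) (V \<union> multiples n (single a 1))"
  using assms(1)
proof (induction rule: prime_filt.induct)
  case refl
  then show ?case by (rule prime_filt.refl)
next
  case (step V w C)
  let ?X = "multiples n (single a 1)"
  note X = multiples_single_iff[OF assms(2)]
  show ?case
  proof (cases "a \<in> keys w")
    case True
    have "t \<in> ?X" if "t \<in> multiples n w" for t
      using that True step(2) unfolding X by (auto simp: keys_plus_nat expos_add_iff)
    then have "V \<union> multiples n w \<union> ?X = V \<union> ?X" by auto
    then show ?thesis using step(6) by simp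
  next
    case False
    have "prime_filt n (Suc R) (U \<union> ?X) ((V \<union> ?X) \<union> multiples n w)"
    proof (rule prime_filt.step[OF step(6,2), of "insert a C"])
      show "insert a C \<subseteq> {1..n}" using assms(2) step(3) by auto
      have "card (insert a C) \<le> Suc (card C)" by (rule card_insert_le_m1) auto
      then show "card (insert a C) \<le> Suc R" using step(4) by linarith
      fix t assume t: "t \<in> expos n"
      show "(w + t \<in> V \<union> ?X) = (keys t \<inter> insert a C \<noteq> {})"
        unfolding Un_iff X using step(5)[OF t] t step(2) False by (auto simp: keys_plus_nat expos_add_iff)
    qed
    moreover have "(V \<union> ?X) \<union> multiples n w = V \<union> multiples n w \<union> ?X" by auto
    ultimately show ?thesis by simp
  qed
qed

section \<open>Interval ideals and their pieces\<close>

definition interval_upset :: "nat \<Rightarrow> nat set set \<Rightarrow> (nat \<Rightarrow>\<^sub>0 nat) set" where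
  "interval_upset n F = {t \<in> expos n. \<exists>A\<in>F. A \<subseteq> keys t}"

lemma upset_interval_upset: "upset n (interval_upset n F)"
  by (auto simp: upset_def interval_upset_def expos_add_iff keys_plus_nat)

lemma multiples_indic:
  assumes "finite T" "T \<subseteq> {1..n}"
  shows "multiples n (indic T) = {t \<in> expos n. T \<subseteq> keys t}"
proof (intro equalityI subsetI)
  fix t assume "t \<in> multiples n (indic T)"
  then show "t \<in> {t \<in> expos n. T \<subseteq> keys t}"
    using assms by (auto simp: expos_def keys_plus_nat keys_indic simp del: atLeastAtMost_iff)
next
  fix t assume t: "t \<in> {t \<in> expos n. T \<subseteq> keys t}"
  then have "indic T + (t - indic T) = t" using indic_plus_minus[OF assms(1)] by blast
  then show "t \<in> multiples n (indic T)" using t by (metis (mono_tags, lifting) expos_add_iff imageI mem_Collect_eq)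
qed

text \<open>
  The state \<open>(l, h)\<close> records the two ends of the last piece. The next interval used is the first one
  with left end \<open>a > l\<close>; later intervals with \<open>a \<le> l\<close> contain the last piece and are skipped.
\<close>

fun pieces :: "nat \<Rightarrow> nat \<Rightarrow> (nat \<times> nat) list \<Rightarrow> (nat \<times> nat) list" where
  "pieces l h [] = []"
| "pieces l h ((a, b) # xs) =
     (if l < a then (max a (Suc h), b) # pieces (max a (Suc h)) b xs else pieces l h xs)"

definition interval_seq :: "(nat \<times> nat) list \<Rightarrow> bool" where
  "interval_seq xs \<longleftrightarrow> sorted_wrt (\<lambda>x y. fst x < fst y \<and> snd x < snd y) xs \<and> (\<forall>(a, b)\<in>set xs. 0 < a \<and> a \<le> b)"

lemma interval_seq_Cons:
  "interval_seq ((a, b) # xs) \<longleftrightarrow>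
     0 < a \<and> a \<le> b \<and> (\<forall>(c, d)\<in>set xs. a < c \<and> b < d) \<and> interval_seq xs"
  by (auto simp: interval_seq_def)

text \<open>
  Moving the last piece to the right, or dropping the first interval, leaves fewer pieces to come. The
  two claims need each other, hence a joint induction: when the first interval is used from the left
  state but skipped from the right one, the first claim needs the second; and when an interval that would be
  used is dropped, the next one is used instead and leads to a state further to the right, where
  the first claim applies.
\<close>

lemma length_pieces_mono_tl:
  assumes "interval_seq xs"
  shows "(\<forall>l l' h h'. l \<le> l' \<longrightarrow> h \<le> h' \<longrightarrow> length (pieces l' h' xs) \<le> length (pieces l h xs)) \<and>
         (\<forall>l h. length (pieces l h (tl xs)) \<le> length (pieces l h xs))"
  using assms
proof (induction xs rule: length_induct)
  case (1 xs)
  have IH1: "length (pieces l' h' ys) \<le> length (pieces l h ys)"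
    if "length ys < length xs" "interval_seq ys" "l \<le> l'" "h \<le> h'" for ys l l' h h'
    using 1(1) that by blast
  have IH2: "length (pieces l h (tl ys)) \<le> length (pieces l h ys)"
    if "length ys < length xs" "interval_seq ys" for ys l h
    using 1(1) that by blast
  show ?case
  proof (cases xs)
    case Nil
    then show ?thesis by simp
  next
    case (Cons x zs)
    obtain a b where x: "x = (a, b)" by (cases x)
    have zs: "interval_seq zs" "length zs < length xs" and gt: "\<forall>(c, d)\<in>set zs. a < c \<and> b < d"
      using 1(2) by (auto simp: Cons x interval_seq_Cons)
    have S: "length (pieces l h zs) \<le> length (pieces l h xs)" for l h
    proof (cases "l < a")
      case False
      then show ?thesis by (simp add: Cons x)
    next
      case True
      show ?thesis
      proof (cases zs)
        case Nil
        then show ?thesis by (simp add: Cons x)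
      next
        case (Cons z ys)
        obtain c d where z: "z = (c, d)" by (cases z)
        have cd: "a < c" "b < d" using gt by (auto simp: Cons z)
        have ys: "interval_seq ys" "length ys < length xs" using zs by (auto simp: Cons z interval_seq_Cons)
        have "length (pieces l h zs) = Suc (length (pieces (max c (Suc h)) d ys))"
          using True cd by (simp add: Cons z)
        also have "\<dots> \<le> Suc (length (pieces (max a (Suc h)) b ys))"
          using IH1[OF ys(2,1), of "max a (Suc h)" "max c (Suc h)" b d] cd by simp
        also have "\<dots> \<le> Suc (length (pieces (max a (Suc h)) b zs))"
          using IH2[OF zs(2,1), of "max a (Suc h)" b] by (simp add: Cons)
        also have "\<dots> = length (pieces l h xs)" using True by (simp add: \<open>xs = x # zs\<close> x)
        finally show ?thesis .
      qed
    qed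
    moreover have "length (pieces l' h' xs) \<le> length (pieces l h xs)" if le: "l \<le> l'" "h \<le> h'" for l l' h h'
    proof (cases "l' < a")
      case True
      then show ?thesis using le IH1[OF zs(2,1), of "max a (Suc h)" "max a (Suc h')" b b]
        by (simp add: Cons x)
    next
      case False
      then have "length (pieces l' h' xs) = length (pieces l' h' zs)" by (simp add: Cons x)
      also have "\<dots> \<le> length (pieces l h zs)" by (rule IH1[OF zs(2,1) le])
      also have "\<dots> \<le> length (pieces l h xs)" by (rule S)
      finally show ?thesis .
    qed
    ultimately show ?thesis by (simp add: Cons)
  qed
qed

lemma length_pieces_mono:
  assumes "interval_seq xs" "l \<le> l'" "h \<le> h'"
  shows "length (pieces l' h' xs) \<le> length (pieces l h xs)"
  using length_pieces_mono_tl[OF assms(1)] assms(2,3) by blast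

lemma length_pieces_le_Cons:
  assumes "interval_seq (x # xs)"
  shows "length (pieces l h xs) \<le> length (pieces l h (x # xs))"
  using conjunct2[OF length_pieces_mono_tl[OF assms(1)], rule_format, of l h] by simp

text \<open>
  The intervals that matter once a piece \<open>[l, h]\<close> has been dealt with, deprived of their elements up to \<open>h\<close>.
\<close>

definition cut_intervals :: "nat \<Rightarrow> nat \<Rightarrow> (nat \<times> nat) list \<Rightarrow> nat set set" where
  "cut_intervals l h xs = {{max a (Suc h)..b} |a b. (a, b) \<in> set xs \<and> l < a}"

lemma interval_upset_iff:
  "t \<in> interval_upset n (cut_intervals l h xs) \<longleftrightarrow>
     t \<in> expos n \<and> (\<exists>a b. (a, b) \<in> set xs \<and> l < a \<and> {max a (Suc h)..b} \<subseteq> keys t)"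
  by (auto simp: interval_upset_def cut_intervals_def)

text \<open>
  Let \<open>[p, b]\<close> be the first piece and \<open>w\<^sub>c\<close> the product of the variables from \<open>c\<close> to \<open>b\<close>. The ideals
  \<open>J + (w\<^sub>c)\<close> climb from \<open>J\<close> at \<open>c = p\<close> to \<open>S\<close> at \<open>c = b + 1\<close>. The ideal \<open>(J + (w\<^sub>c)) : w\<^sub>c\<^sub>+\<^sub>1\<close> contains
  \<open>x\<^sub>c\<close>, which makes all intervals through \<open>c\<close> redundant, and the others are the intervals starting after \<open>c\<close>,
  deprived of their elements up to \<open>b\<close>. By monotonicity these have at most as many pieces as remain
  after \<open>[p, b]\<close>, and the variable \<open>x\<^sub>c\<close> accounts for the piece \<open>[p, b]\<close> itself.
\<close>

lemma prime_filt_above_cut_intervals: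
  assumes "interval_seq xs" "\<forall>(a, b)\<in>set xs. b \<le> n" "\<forall>(a, b)\<in>set xs. l < a \<longrightarrow> h < b"
  shows "prime_filt n (length (pieces l h xs)) (interval_upset n (cut_intervals l h xs)) (expos n)"
  using assms
proof (induction xs arbitrary: l h)
  case Nil
  have "prime_filt n 0 {} ({} \<union> multiples n 0)"
    by (rule prime_filt.step[where C = "{}"]) (auto intro: prime_filt.refl simp: expos_zero)
  then show ?case by (simp add: interval_upset_def cut_intervals_def)
next
  case (Cons x xs)
  obtain a b where x: "x = (a, b)" by (cases x)
  have xs: "interval_seq xs" "\<forall>(a, b)\<in>set xs. b \<le> n" and gt: "\<And>c d. (c, d) \<in> set xs \<Longrightarrow> a < c \<and> b < d"
    and ab: "0 < a" "a \<le> b" "b \<le> n"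
    using Cons.prems by (auto simp: x interval_seq_Cons)
  show ?case
  proof (cases "l < a")
    case False
    then have "cut_intervals l h (x # xs) = cut_intervals l h xs" by (auto simp: cut_intervals_def x)
    then show ?thesis using False Cons.IH[OF xs, of l h] Cons.prems(3) by (simp add: x)
  next
    case True
    define p where "p = max a (Suc h)"
    have hb: "h < b" using Cons.prems(3) True by (auto simp: x)
    then have pb: "p \<le> b" using ab by (simp add: p_def)
    define R where "R = length (pieces l h (x # xs))"
    have R: "R = Suc (length (pieces p b xs))" using True by (simp add: R_def x p_def)
    define J where "J = interval_upset n (cut_intervals l h (x # xs))"
    have J: "t \<in> J \<longleftrightarrow> t \<in> expos n \<and> ({p..b} \<subseteq> keys t \<or> (\<exists>c d. (c, d) \<in> set xs \<and> {max c (Suc h)..d} \<subseteq> keys t))" for t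
      using True gt unfolding J_def interval_upset_iff by (fastforce simp: x p_def)
    \<comment> \<open>the ideal \<open>J + (w\<^sub>c)\<close>; it is \<open>J\<close> for \<open>c = p\<close> and everything for \<open>c = b + 1\<close>\<close>
    define U where "U c = J \<union> {t \<in> expos n. {c..b} \<subseteq> keys t}" for c
    have upU: "upset n (U c)" for c
      unfolding U_def J_def by (intro upset_Un upset_interval_upset) (auto simp: upset_def expos_add_iff keys_plus_nat)
    have steps: "prime_filt n R (U c) (U (Suc c))" if c: "p \<le> c" "c \<le> b" for c
    proof -
      have cn: "c \<in> {1..n}" using c ab by (auto simp: p_def)
      have fin: "finite {Suc c..b}" "{Suc c..b} \<subseteq> {1..n}" using ab by auto
      let ?u = "indic {Suc c..b}"
      have u: "?u \<in> expos n" "keys ?u = {Suc c..b}" using fin by (auto simp: expos_def keys_indic)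
      have colon: "{t \<in> expos n. ?u + t \<in> U c} =
        interval_upset n (cut_intervals c b xs) \<union> multiples n (single c 1)" (is "?L = ?Q")
      proof (rule Set.set_eqI)
        fix t
        have Lt: "t \<in> ?L \<longleftrightarrow> t \<in> expos n \<and> ({p..b} \<subseteq> {Suc c..b} \<union> keys t \<or> (\<exists>a' d. (a', d) \<in> set xs \<and> {max a' (Suc h)..d} \<subseteq> {Suc c..b} \<union> keys t) \<or> {c..b} \<subseteq> {Suc c..b} \<union> keys t)"
          using u by (auto simp: U_def J expos_add_iff keys_plus_nat)
        have Qt: "t \<in> ?Q \<longleftrightarrow> t \<in> expos n \<and> ((\<exists>a' d. (a', d) \<in> set xs \<and> c < a' \<and> {max a' (Suc b)..d} \<subseteq> keys t) \<or> c \<in> keys t)"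
          unfolding Un_iff interval_upset_iff multiples_single_iff[OF cn] by blast
        have cb: "{c..b} = insert c {Suc c..b}" "c \<notin> {Suc c..b}" "c \<in> {p..b}" using c by auto
        have 1: "{c..b} \<subseteq> {Suc c..b} \<union> keys t \<longleftrightarrow> c \<in> keys t" unfolding cb(1) using cb(2) by blast
        have 2: "{p..b} \<subseteq> {Suc c..b} \<union> keys t \<longrightarrow> c \<in> keys t" using cb(2,3) by blast
        \<comment> \<open>an interval through \<open>c\<close> is redundant, one that starts later loses its elements up to \<open>b\<close>\<close>
        have 3: "{max a' (Suc h)..d} \<subseteq> {Suc c..b} \<union> keys t \<longrightarrow>
            c < a' \<and> {max a' (Suc b)..d} \<subseteq> keys t \<or> c \<in> keys t"
          if "(a', d) \<in> set xs" for a' d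
        proof (cases "c < a'")
          case True
          show ?thesis
          proof
            assume sub: "{max a' (Suc h)..d} \<subseteq> {Suc c..b} \<union> keys t"
            have "{max a' (Suc b)..d} \<subseteq> {max a' (Suc h)..d}" using hb by auto
            then have "{max a' (Suc b)..d} \<subseteq> keys t" using sub by fastforce
            with True show "c < a' \<and> {max a' (Suc b)..d} \<subseteq> keys t \<or> c \<in> keys t" by simp
          qed
        next
          case False
          have "c \<in> {max a' (Suc h)..d}" using False c gt[OF that] by (auto simp: p_def)
          then show ?thesis using cb(2) by blast
        qed
        have 4: "c < a' \<and> {max a' (Suc b)..d} \<subseteq> keys t \<longrightarrow> {max a' (Suc h)..d} \<subseteq> {Suc c..b} \<union> keys t" for a' d
        proof
          assume *: "c < a' \<and> {max a' (Suc b)..d} \<subseteq> keys t"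
          show "{max a' (Suc h)..d} \<subseteq> {Suc c..b} \<union> keys t"
          proof
            fix y assume y: "y \<in> {max a' (Suc h)..d}"
            show "y \<in> {Suc c..b} \<union> keys t"
            proof (cases "y \<le> b")
              case False
              then have "y \<in> {max a' (Suc b)..d}" using y by auto
              then show ?thesis using * by blast
            qed (use y * in auto)
          qed
        qed
        show "t \<in> ?L \<longleftrightarrow> t \<in> ?Q" unfolding Lt Qt using 1 2 3 4 by meson
      qed
      have "prime_filt n (length (pieces c b xs)) (interval_upset n (cut_intervals c b xs)) (expos n)"
        using gt by (intro Cons.IH[OF xs]) auto
      moreover have "Suc (length (pieces c b xs)) \<le> R"
        using length_pieces_mono[OF xs(1) c(1), of b b] by (simp add: R)
      ultimately have "prime_filt n R (interval_upset n (cut_intervals c b xs) \<union> multiples n (single c 1)) (expos n \<union> multiples n (single c 1))"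
        using prime_filt_add_var[OF _ cn] prime_filt_mono by blast
      moreover have "expos n \<union> multiples n (single c 1) = expos n"
        using multiples_single_iff[OF cn] by blast
      ultimately have "prime_filt n R {t \<in> expos n. ?u + t \<in> U c} (expos n)" by (simp add: colon)
      from prime_filt_colon[OF this u(1) upU] have "prime_filt n R (U c) (U c \<union> multiples n ?u)" .
      moreover have "U c \<union> multiples n ?u = U (Suc c)"
        unfolding multiples_indic[OF fin] U_def using c by force
      ultimately show ?thesis by simp
    qed
    have "c \<le> Suc b \<longrightarrow> prime_filt n R (U p) (U c)" if "p \<le> c" for c
      using that
    proof (induction c rule: dec_induct)
      case base
      then show ?case by (simp add: prime_filt.refl)
    next
      case (step m)
      have "prime_filt n R (U p) (U (Suc m))" if "m \<le> b"
        using prime_filt_trans[OF steps[OF step(1) that]] step(3) that by simp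
      then show ?case by simp
    qed
    from this[of "Suc b"] pb have "prime_filt n R (U p) (U (Suc b))" by simp
    moreover have "U p = J" by (auto simp: U_def J)
    moreover have "U (Suc b) = expos n" by (auto simp: U_def J)
    ultimately show ?thesis by (simp add: R_def J_def)
  qed
qed

text \<open>
  Adding the generator of \<open>[a, b]\<close> to the ideal of the later intervals contributes \<open>S/J\<close>, where \<open>J\<close> is
  the ideal of the later intervals cut at \<open>b\<close>. The first piece being \<open>[a, b]\<close> itself, only the
  other pieces count, whence \<open>R\<close> is one less than their total number.
\<close>

lemma prime_filt_intervals:
  assumes "interval_seq xs" "\<forall>(a, b)\<in>set xs. b \<le> n" "length (pieces 0 0 xs) \<le> Suc R"
  shows "prime_filt n R {} (interval_upset n {{a..b} |a b. (a, b) \<in> set xs})"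
  using assms
proof (induction xs)
  case Nil
  then show ?case by (simp add: interval_upset_def prime_filt.refl)
next
  case (Cons x xs)
  obtain a b where x: "x = (a, b)" by (cases x)
  have xs: "interval_seq xs" "\<forall>(a, b)\<in>set xs. b \<le> n" and gt: "\<And>c d. (c, d) \<in> set xs \<Longrightarrow> a < c \<and> b < d"
    and ab: "0 < a" "a \<le> b" "b \<le> n"
    using Cons.prems by (auto simp: x interval_seq_Cons)
  let ?J = "interval_upset n {{a..b} |a b. (a, b) \<in> set xs}"
  have fin: "finite {a..b}" "{a..b} \<subseteq> {1..n}" using ab by auto
  let ?u = "indic {a..b}"
  have u: "?u \<in> expos n" "keys ?u = {a..b}" using fin by (auto simp: expos_def keys_indic)
  have 1: "prime_filt n R {} ?J"
    using Cons.IH[OF xs] length_pieces_le_Cons[OF Cons.prems(1), of 0 0] Cons.prems(3) by linarith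
  have colon: "{t \<in> expos n. ?u + t \<in> ?J} = interval_upset n (cut_intervals a b xs)" (is "?L = ?Q")
  proof (rule Set.set_eqI)
    fix t
    have Lt: "t \<in> ?L \<longleftrightarrow> t \<in> expos n \<and> (\<exists>c d. (c, d) \<in> set xs \<and> {c..d} \<subseteq> {a..b} \<union> keys t)"
      using u by (auto simp: interval_upset_def expos_add_iff keys_plus_nat)
    have Qt: "t \<in> ?Q \<longleftrightarrow> t \<in> expos n \<and> (\<exists>c d. (c, d) \<in> set xs \<and> {max c (Suc b)..d} \<subseteq> keys t)"
      unfolding interval_upset_iff using gt by blast
    have "{c..d} \<subseteq> {a..b} \<union> keys t \<longleftrightarrow> {max c (Suc b)..d} \<subseteq> keys t"
      if "(c, d) \<in> set xs" for c d
    proof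
      assume "{c..d} \<subseteq> {a..b} \<union> keys t"
      then show "{max c (Suc b)..d} \<subseteq> keys t" by fastforce
    next
      assume *: "{max c (Suc b)..d} \<subseteq> keys t"
      show "{c..d} \<subseteq> {a..b} \<union> keys t"
      proof
        fix y assume y: "y \<in> {c..d}"
        show "y \<in> {a..b} \<union> keys t"
        proof (cases "y \<le> b")
          case False
          then have "y \<in> {max c (Suc b)..d}" using y by auto
          then show ?thesis using * by blast
        qed (use y gt[OF that] in auto)
      qed
    qed
    then show "t \<in> ?L \<longleftrightarrow> t \<in> ?Q" unfolding Lt Qt by blast
  qed
  have "length (pieces a b xs) \<le> R" using Cons.prems(3) ab max_absorb1[of "Suc 0" a] by (simp add: x)
  moreover have "prime_filt n (length (pieces a b xs)) (interval_upset n (cut_intervals a b xs)) (expos n)"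
    using gt by (intro prime_filt_above_cut_intervals xs) auto
  ultimately have "prime_filt n R {t \<in> expos n. ?u + t \<in> ?J} (expos n)"
    unfolding colon by (rule prime_filt_mono[rotated])
  from prime_filt_colon[OF this u(1) upset_interval_upset] have "prime_filt n R ?J (?J \<union> multiples n ?u)" .
  moreover have "?J \<union> multiples n ?u = interval_upset n {{a..b} |a b. (a, b) \<in> set (x # xs)}"
    unfolding multiples_indic[OF fin] by (auto simp: interval_upset_def x)
  ultimately show ?case using prime_filt_trans[OF _ 1] by simp
qed

section \<open>Consequences of a prime filtration\<close>

text \<open>
  The monomials of the Stanley space of the monomial with exponent \<open>w\<close> and the variables \<open>Z\<close>.
\<close>

definition block :: "(nat \<Rightarrow>\<^sub>0 nat) \<times> nat set \<Rightarrow> (nat \<Rightarrow>\<^sub>0 nat) set" where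
  "block = (\<lambda>(w, Z). (+) w ` {t. keys t \<subseteq> Z})"

lemma nth_snoc: "j < length (D @ [x]) \<Longrightarrow> (j < length D \<and> (D @ [x]) ! j = D ! j) \<or> (j = length D \<and> (D @ [x]) ! j = x)"
  by (cases "j < length D") (auto simp: nth_append less_Suc_eq)

text \<open>
  The monomials that a step adds are those \<open>w + t\<close> with \<open>t\<close> free of the variables in \<open>C\<close>: a block with
  \<open>Z\<close> the complement of \<open>C\<close>.
\<close>

lemma prime_filt_blocks:
  assumes "prime_filt n R U V"
  shows "\<exists>D. (\<forall>(w, Z)\<in>set D. w \<in> expos n \<and> Z \<subseteq> {1..n} \<and> n - R \<le> card Z)
    \<and> (\<forall>i<length D. block (D ! i) \<subseteq> V - U)
    \<and> (\<forall>t\<in>V - U. \<exists>!i. i < length D \<and> t \<in> block (D ! i))"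
  using assms
proof (induction rule: prime_filt.induct)
  case refl
  then show ?case by (intro exI[of _ "[]"]) auto
next
  case (step V w C)
  then obtain D where D: "\<forall>(w, Z)\<in>set D. w \<in> expos n \<and> Z \<subseteq> {1..n} \<and> n - R \<le> card Z"
    "\<forall>i<length D. block (D ! i) \<subseteq> V - U" "\<forall>t\<in>V - U. \<exists>!i. i < length D \<and> t \<in> block (D ! i)" by blast
  let ?B = "(w, {1..n} - C)" and ?V = "V \<union> multiples n w"
  have UV: "U \<subseteq> V" by (rule prime_filt_subset[OF step(1)])
  have B: "block ?B = ?V - V"
  proof (rule Set.set_eqI)
    fix t
    show "t \<in> block ?B \<longleftrightarrow> t \<in> ?V - V"
    proof
      assume "t \<in> block ?B"
      then obtain s where s: "t = w + s" "keys s \<subseteq> {1..n} - C" by (auto simp: block_def)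
      then have "s \<in> expos n" by (auto simp: expos_def)
      moreover have "keys s \<inter> C = {}" using s by auto
      ultimately show "t \<in> ?V - V" using step(5)[of s] s by auto
    next
      assume t: "t \<in> ?V - V"
      then obtain s where s: "t = w + s" "s \<in> expos n" by auto
      then have "keys s \<inter> C = {}" using step(5)[of s] t by auto
      then show "t \<in> block ?B" using s by (auto simp: block_def expos_def)
    qed
  qed
  have card: "n - R \<le> card ({1..n} - C)"
    using step(3,4) by (simp add: card_Diff_subset finite_subset)
  show ?case
  proof (intro exI[of _ "D @ [?B]"] conjI ballI allI impI)
    fix x assume "x \<in> set (D @ [?B])"
    then show "case x of (w, Z) \<Rightarrow> w \<in> expos n \<and> Z \<subseteq> {1..n} \<and> n - R \<le> card Z"
      using D(1) step(2) card by auto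
  next
    fix i assume i: "i < length (D @ [?B])"
    show "block ((D @ [?B]) ! i) \<subseteq> ?V - U"
    proof (cases "i < length D")
      case True
      then show ?thesis using D(2) by (auto simp: nth_append)
    next
      case False
      then have "(D @ [?B]) ! i = ?B" using i by (simp add: nth_append)
      then show ?thesis using B UV by auto
    qed
  next
    fix t assume t: "t \<in> ?V - U"
    show "\<exists>!i. i < length (D @ [?B]) \<and> t \<in> block ((D @ [?B]) ! i)"
    proof (cases "t \<in> V")
      case True
      then obtain i where i: "i < length D" "t \<in> block (D ! i)" "\<And>j. j < length D \<Longrightarrow> t \<in> block (D ! j) \<Longrightarrow> j = i"
        using t D(3) by blast
      have "t \<notin> block ?B" using B True by blast
      then have "j = i" if "j < length (D @ [?B])" "t \<in> block ((D @ [?B]) ! j)" for j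
        using i(3)[of j] that nth_snoc[OF that(1)] by metis
      moreover have "(D @ [?B]) ! i = D ! i" using i(1) by (simp add: nth_append)
      ultimately show ?thesis using i(1,2) by (intro ex1I[of _ i]) simp_all
    next
      case False
      then have "t \<in> block ?B" using B t by blast
      moreover have "t \<notin> block (D ! j)" if "j < length D" for j using D(2) that False by blast
      then have "j = length D" if "j < length (D @ [?B])" "t \<in> block ((D @ [?B]) ! j)" for j
        using that nth_snoc[OF that(1)] by metis
      ultimately show ?thesis by (intro ex1I[of _ "length D"]) simp_all
    qed
  qed
qed

lemma submod_upset:
  assumes "upset n U"
  shows "submod n {p :: 'k::field mpoly. keys p \<subseteq> U}"
  unfolding submod_def
proof (intro conjI ballI)
  fix p q :: "'k mpoly"
  assume "p \<in> polys_in {1..n}" "q \<in> {p. keys p \<subseteq> U}"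
  then have p: "keys p \<subseteq> expos n" and q: "keys q \<subseteq> U" unfolding polys_in_iff by auto
  have "t \<in> U" if "t \<in> keys (p * q)" for t
  proof -
    obtain a b where "a \<in> keys p" "b \<in> keys q" "t = a + b"
      using \<open>t \<in> _\<close> keys_mult[of p q] by auto
    then show ?thesis using p q assms by (metis upset_def add.commute subsetD)
  qed
  then show "p * q \<in> {p. keys p \<subseteq> U}" by auto
next
  fix p q :: "'k mpoly"
  assume "p \<in> {p. keys p \<subseteq> U}" "q \<in> {p. keys p \<subseteq> U}"
  then show "p + q \<in> {p. keys p \<subseteq> U}" using keys_add_subset[of p U q] by simp
qed simp

lemma upset_ideal_subset:
  assumes "upset n U"
  shows "{p :: 'k::field mpoly. keys p \<subseteq> U} \<subseteq> polys_in {1..n}"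
proof
  fix p :: "'k mpoly" assume "p \<in> {p. keys p \<subseteq> U}"
  then show "p \<in> polys_in {1..n}" using assms unfolding polys_in_iff upset_def by blast
qed

lemma upset_meeting: "upset n {t \<in> expos n. keys t \<inter> C \<noteq> {}}"
  by (auto simp: upset_def expos_add_iff keys_plus_nat)

text \<open>
  The prime ideal \<open>P\<^sub>C\<close> generated by the variables with index in \<open>C\<close>.
\<close>

definition var_ideal :: "nat \<Rightarrow> nat set \<Rightarrow> 'k::field mpoly set" where
  "var_ideal n C = {p. keys p \<subseteq> {t \<in> expos n. keys t \<inter> C \<noteq> {}}}"

lemma submod_var_ideal: "submod n (var_ideal n C)"
  unfolding var_ideal_def by (rule submod_upset[OF upset_meeting])

lemma var_ideal_subset: "var_ideal n C \<subseteq> polys_in {1..n}"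
  unfolding var_ideal_def by (rule upset_ideal_subset[OF upset_meeting])

text \<open>
  A step contributes a quotient isomorphic to \<open>S/P\<^sub>C\<close>, and regularity on the quotients is glued along the filtration.
\<close>

lemma regular_on_prime_filt:
  fixes f :: "nat \<Rightarrow> 'k::field mpoly"
  assumes "prime_filt n R U V" "upset n U"
    and f: "\<And>i. i < k \<Longrightarrow> f i \<in> polys_in {1..n}"
    and reg: "\<And>C. C \<subseteq> {1..n} \<Longrightarrow> card C \<le> R \<Longrightarrow> regular_on f k (polys_in {1..n}) (var_ideal n C)"
  shows "regular_on f k {p. keys p \<subseteq> V} {p. keys p \<subseteq> U}"
  using assms(1)
proof (induction rule: prime_filt.induct)
  case refl
  let ?A = "{p :: 'k mpoly. keys p \<subseteq> U}"
  have "0 \<in> ?A" by simp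
  then have "?A \<subseteq> adjoin f ?A ?A i" for i by (rule base_subset_adjoin)
  then show ?case unfolding regular_on_def by blast
next
  case (step V w C)
  have V: "upset n V" by (rule upset_prime_filt[OF step(1) assms(2)])
  have V': "upset n (V \<union> multiples n w)" by (rule upset_Un[OF V upset_multiples[OF step(2)]])
  let ?I = "\<lambda>U. {p :: 'k mpoly. keys p \<subseteq> U}"
  have top: "?I (V \<union> multiples n w) = {b + monom w * s | b s. b \<in> ?I V \<and> s \<in> polys_in {1..n}}" (is "_ = ?X")
  proof (intro equalityI subsetI)
    fix p assume p: "p \<in> ?I (V \<union> multiples n w)"
    have "keys (restr (- V) p) \<subseteq> multiples n w" using p by (auto simp: keys_restr)
    from divide_by_monom[OF this] obtain s where s: "restr (- V) p = monom w * s" "keys s \<subseteq> expos n" by blast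
    have "p = restr V p + monom w * s" using restr_split[of p V] s(1) by simp
    moreover have "restr V p \<in> ?I V" by (simp add: keys_restr)
    ultimately show "p \<in> ?X" using s(2) polys_in_iff by blast
  next
    fix p assume "p \<in> ?X"
    then obtain b s where p: "p = b + monom w * s" "keys b \<subseteq> V" "keys s \<subseteq> expos n" unfolding polys_in_iff by auto
    have "keys (monom w * s) \<subseteq> multiples n w" using p(3) by (auto simp: keys_monom_mult)
    then show "p \<in> ?I (V \<union> multiples n w)" unfolding p(1) mem_Collect_eq
      using p(2) by (intro keys_add_subset) auto
  qed
  have reg1: "regular_on f k (?I (V \<union> multiples n w)) (?I V)"
  proof (rule regular_on_cyclic[OF submod_upset[OF V] submod_var_ideal var_ideal_subset top])
    show "monom w \<in> polys_in {1..n}" using step(2) unfolding polys_in_iff by simp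
    show "regular_on f k (polys_in {1..n}) (var_ideal n C)" by (rule reg[OF step(3,4)])
    fix s :: "'k mpoly" assume s: "s \<in> polys_in {1..n}"
    have "monom w * s \<in> ?I V \<longleftrightarrow> (\<forall>t\<in>keys s. w + t \<in> V)"
      by (auto simp: keys_monom_mult)
    also have "\<dots> \<longleftrightarrow> (\<forall>t\<in>keys s. keys t \<inter> C \<noteq> {})"
      using s step(5) unfolding polys_in_iff by blast
    also have "\<dots> \<longleftrightarrow> s \<in> var_ideal n C" using s unfolding var_ideal_def polys_in_iff by auto
    finally show "monom w * s \<in> ?I V \<longleftrightarrow> s \<in> var_ideal n C" .
  qed (rule f)
  show ?case
  proof (rule regular_on_trans[OF submod_upset[OF V'] submod_upset[OF V] submod_upset[OF assms(2)] _ _ _ reg1 step(6)])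
    show "?I U \<subseteq> ?I V" using prime_filt_subset[OF step(1)] by blast
    show "?I V \<subseteq> ?I (V \<union> multiples n w)" by blast
  qed (rule f)
qed


section \<open>Total degree\<close>

definition total_deg :: "nat \<Rightarrow> (nat \<Rightarrow>\<^sub>0 nat) \<Rightarrow> nat" where
  "total_deg n t = (\<Sum>i\<in>{1..n}. lookup t i)"

lemma total_deg_add: "total_deg n (s + t) = total_deg n s + total_deg n t"
  by (simp add: total_deg_def lookup_add sum.distrib)

lemma total_deg_indic:
  assumes "T \<subseteq> {1..n}"
  shows "total_deg n (indic T) = card T"
proof -
  have fin: "finite T" using assms finite_subset by blast
  have "total_deg n (indic T) = (\<Sum>i\<in>{1..n}. if i \<in> T then 1 else 0)"
    by (simp add: total_deg_def lookup_indic[OF fin])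
  also have "\<dots> = card ({1..n} \<inter> T)" by (simp add: sum.If_cases)
  also have "{1..n} \<inter> T = T" using assms by blast
  finally show ?thesis .
qed

abbreviation hcomp :: "nat \<Rightarrow> nat \<Rightarrow> 'k::field mpoly \<Rightarrow> 'k mpoly" where
  "hcomp n d p \<equiv> restr {t. total_deg n t = d} p"

definition is_hom :: "nat \<Rightarrow> nat \<Rightarrow> 'k::field mpoly \<Rightarrow> bool" where
  "is_hom n e p \<longleftrightarrow> (\<forall>t\<in>keys p. total_deg n t = e)"

lemma is_hom_hcomp: "is_hom n d (hcomp n d p)"
  by (simp add: is_hom_def keys_restr)

lemma hcomp_mult:
  assumes "is_hom n e f"
  shows "hcomp n d (f * p) = (if e \<le> d then f * hcomp n (d - e) p else 0)"
proof -
  have keys: "\<exists>t\<in>keys q. total_deg n s = e + total_deg n t" if "s \<in> keys (f * q)" for s q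
    using that keys_mult[of f q] assms by (force simp: is_hom_def total_deg_add)
  show ?thesis
  proof (cases "e \<le> d")
    case False
    then have "keys (f * p) \<inter> {t. total_deg n t = d} = {}" using keys by fastforce
    with False show ?thesis by (simp add: restr_zero_if_disjoint)
  next
    case True
    let ?D = "{t. total_deg n t = d - e}"
    have "f * p = f * restr ?D p + f * restr (- ?D) p"
      using restr_split[of p ?D] by (metis distrib_left)
    then have "hcomp n d (f * p) = hcomp n d (f * restr ?D p) + hcomp n d (f * restr (- ?D) p)"
      using restr_add by metis
    moreover have "hcomp n d (f * restr ?D p) = f * restr ?D p"
    proof (rule restr_id, rule subsetI)
      fix s assume "s \<in> keys (f * restr ?D p)"
      from keys[OF this] show "s \<in> {t. total_deg n t = d}" using True by (auto simp: keys_restr)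
    qed
    moreover have "hcomp n d (f * restr (- ?D) p) = 0"
    proof (rule restr_zero_if_disjoint, rule equals0I)
      fix s assume s: "s \<in> keys (f * restr (- ?D) p) \<inter> {t. total_deg n t = d}"
      then obtain t where "t \<in> keys (restr (- ?D) p)" "total_deg n s = e + total_deg n t" using keys by blast
      then show False using s by (auto simp: keys_restr)
    qed
    ultimately show ?thesis using True by simp
  qed
qed

lemma sum_hcomp: "p = (\<Sum>d\<in>total_deg n ` keys p. hcomp n d p)"
proof (rule poly_mapping_eqI)
  fix t
  have fin: "finite (total_deg n ` keys p)" by simp
  have "lookup (\<Sum>d\<in>total_deg n ` keys p. hcomp n d p) t
     = (\<Sum>d\<in>total_deg n ` keys p. if total_deg n t = d then lookup p t else 0)"
    by (simp add: lookup_sum lookup_restr)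
  also have "\<dots> = (if total_deg n t \<in> total_deg n ` keys p then lookup p t else 0)"
    by (rule sum.delta'[OF fin])
  also have "\<dots> = lookup p t" by (auto simp: in_keys_iff)
  finally show "lookup p t = lookup (\<Sum>d\<in>total_deg n ` keys p. hcomp n d p) t" ..
qed

definition hom_closed :: "nat \<Rightarrow> 'k::field mpoly set \<Rightarrow> bool" where
  "hom_closed n A \<longleftrightarrow> (\<forall>a\<in>A. \<forall>d. hcomp n d a \<in> A)"

lemma restr_polys_in: "p \<in> polys_in {1..n} \<Longrightarrow> restr U p \<in> polys_in {1..n}"
  unfolding polys_in_iff by (auto simp: keys_restr)

lemma hom_closed_var_ideal: "hom_closed n (var_ideal n C)"
  by (auto simp: hom_closed_def var_ideal_def keys_restr)

lemma hom_closed_adjoin: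
  assumes "hom_closed n B" "\<And>j. j < i \<Longrightarrow> \<exists>e. is_hom n e (f j)"
  shows "hom_closed n (adjoin f (polys_in {1..n}) B i)"
  using assms(2)
proof (induction i)
  case 0
  then show ?case by (simp add: assms(1))
next
  case (Suc i)
  let ?S = "polys_in {1..n} :: 'a mpoly set"
  have IH: "hom_closed n (adjoin f ?S B i)" using Suc by simp
  obtain e where e: "is_hom n e (f i)" using Suc.prems by blast
  show ?case unfolding hom_closed_def
  proof (intro ballI allI)
    fix p d assume "p \<in> adjoin f ?S B (Suc i)"
    then obtain y a where p: "p = y + f i * a" "y \<in> adjoin f ?S B i" "a \<in> ?S" by auto
    have y: "hcomp n d y \<in> adjoin f ?S B i" using IH p(2) by (simp add: hom_closed_def)
    show "hcomp n d p \<in> adjoin f ?S B (Suc i)"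
    proof (cases "e \<le> d")
      case True
      then have "hcomp n d p = hcomp n d y + f i * hcomp n (d - e) a"
        by (simp add: p(1) restr_add hcomp_mult[OF e])
      then show ?thesis using y restr_polys_in[OF p(3)] by auto
    next
      case False
      then have "hcomp n d p = hcomp n d y" by (simp add: p(1) restr_add hcomp_mult[OF e])
      then show ?thesis using y adjoin_Suc_subset[OF submodD(1)[OF submod_polys_in], of f n B i] by auto
    qed
  qed
qed

section \<open>Exchanging a variable for a regular sequence\<close>

definition plus_multiples :: "nat \<Rightarrow> 'k::field mpoly \<Rightarrow> 'k mpoly set \<Rightarrow> 'k mpoly set" where
  "plus_multiples n x B = {b + x * a | b a. b \<in> B \<and> a \<in> polys_in {1..n}}"

lemma adjoin_plus_multiples:
  assumes "submod n B"
  shows "adjoin f (polys_in {1..n}) (plus_multiples n x B) i = plus_multiples n x (adjoin f (polys_in {1..n}) B i)"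
proof (induction i)
  case 0
  then show ?case by simp
next
  case (Suc i)
  show ?case unfolding adjoin.simps Suc
  proof (intro equalityI subsetI)
    fix p assume "p \<in> {y + f i * a |y a. y \<in> plus_multiples n x (adjoin f (polys_in {1..n}) B i) \<and> a \<in> polys_in {1..n}}"
    then obtain y b a where *: "p = (y + x * b) + f i * a" "y \<in> adjoin f (polys_in {1..n}) B i" "a \<in> polys_in {1..n}" "b \<in> polys_in {1..n}"
      unfolding plus_multiples_def by blast
    have "p = (y + f i * a) + x * b" using * by (simp add: algebra_simps)
    then show "p \<in> plus_multiples n x {y + f i * a |y a. y \<in> adjoin f (polys_in {1..n}) B i \<and> a \<in> polys_in {1..n}}"
      unfolding plus_multiples_def using * by blast
  next
    fix p assume "p \<in> plus_multiples n x {y + f i * a |y a. y \<in> adjoin f (polys_in {1..n}) B i \<and> a \<in> polys_in {1..n}}"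
    then obtain y b a where *: "p = (y + f i * a) + x * b" "y \<in> adjoin f (polys_in {1..n}) B i" "a \<in> polys_in {1..n}" "b \<in> polys_in {1..n}"
      unfolding plus_multiples_def by blast
    have "p = (y + x * b) + f i * a" using * by (simp add: algebra_simps)
    then show "p \<in> {y + f i * a |y a. y \<in> plus_multiples n x (adjoin f (polys_in {1..n}) B i) \<and> a \<in> polys_in {1..n}}"
      unfolding plus_multiples_def using * by blast
  qed
qed

lemma subset_plus_multiples: "B \<subseteq> plus_multiples n x B"
proof
  fix b assume "b \<in> B"
  then show "b \<in> plus_multiples n x B" unfolding plus_multiples_def
    using submodD(1)[OF submod_polys_in[of n]] by (intro CollectI exI[of _ b] exI[of _ 0] conjI) simp_all
qed

text \<open>
  If \<open>x, f\<^sub>0, f\<^sub>1, \<dots>\<close> is regular on \<open>S/B\<close>, then \<open>x\<close> stays a nonzerodivisor modulo any initial part of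
  the \<open>f\<^sub>i\<close>. This half of the exchange of regular elements needs no grading.
\<close>

lemma nonzerodivisor_mod_adjoin:
  assumes B: "submod n B" and x: "x \<in> polys_in {1..n}"
    and f: "\<And>i. i < k \<Longrightarrow> f i \<in> polys_in {1..n}"
    and reg: "regular_on f k (polys_in {1..n}) (plus_multiples n x B)"
    and xB: "\<And>a. a \<in> polys_in {1..n} \<Longrightarrow> x * a \<in> B \<Longrightarrow> a \<in> B"
    and "i \<le> k" "a \<in> polys_in {1..n}" "x * a \<in> adjoin f (polys_in {1..n}) B i"
  shows "a \<in> adjoin f (polys_in {1..n}) B i"
  using assms(6-)
proof (induction i arbitrary: a)
  case 0
  then show ?case using xB by simp
next
  case (Suc i)
  let ?S = "polys_in {1..n} :: 'a mpoly set"
  note S = submod_polys_in[of n]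
  have sub: "submod n (adjoin f ?S B i)" by (rule submod_adjoin[OF S B])
  have fi: "f i \<in> ?S" using f Suc.prems(1) by simp
  obtain y b where y: "x * a = y + f i * b" "y \<in> adjoin f ?S B i" "b \<in> ?S" using Suc.prems(3) by auto
  have "f i * b = - y + x * a" by (simp add: y(1))
  moreover have "- y \<in> adjoin f ?S B i" by (rule submod_uminus[OF sub y(2)])
  ultimately have "f i * b \<in> adjoin f ?S (plus_multiples n x B) i"
    unfolding adjoin_plus_multiples[OF B] unfolding plus_multiples_def using Suc.prems(2) by blast
  then have "b \<in> adjoin f ?S (plus_multiples n x B) i"
    using regular_onD[OF reg] Suc.prems(1) y(3) by simp
  then obtain z c where z: "b = z + x * c" "z \<in> adjoin f ?S B i" "c \<in> ?S"
    unfolding adjoin_plus_multiples[OF B] unfolding plus_multiples_def by blast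
  have "x * (a - f i * c) = y + f i * z" using y(1) by (simp add: z(1) algebra_simps)
  moreover have "y + f i * z \<in> adjoin f ?S B i"
    by (rule submodD(2)[OF sub y(2) submodD(3)[OF sub fi z(2)]])
  moreover have "a - f i * c \<in> ?S" by (rule submod_diff[OF S Suc.prems(2) submodD(3)[OF S fi z(3)]])
  ultimately have "a - f i * c \<in> adjoin f ?S B i" using Suc.IH Suc.prems(1) by simp
  then show ?case unfolding adjoin.simps using z(3)
    by (intro CollectI exI[of _ "a - f i * c"] exI[of _ c]) simp
qed

text \<open>
  The other half: if \<open>x, f\<^sub>0, f\<^sub>1, \<dots>\<close> is regular on \<open>S/B\<close>, then so is \<open>f\<^sub>0, f\<^sub>1, \<dots>\<close>. Let \<open>F = B + (f\<^sub>0, \<dots>, f\<^sub>i\<^sub>-\<^sub>1)\<close> and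
  \<open>f\<^sub>i a \<in> F\<close>. Regularity modulo \<open>x\<close> gives \<open>a = y + x c\<close> with \<open>y \<in> F\<close>, and cancelling \<open>x\<close> gives
  \<open>f\<^sub>i c \<in> F\<close>. For homogeneous \<open>a\<close> the degree of \<open>c\<close> is smaller, so that this descent ends; the general case
  follows since everything is homogeneous.
\<close>

lemma regular_on_deform:
  assumes B: "submod n B" "hom_closed n B" and x: "x \<in> polys_in {1..n}" "is_hom n 1 x"
    and f: "\<And>i. i < k \<Longrightarrow> f i \<in> polys_in {1..n}" "\<And>i. i < k \<Longrightarrow> \<exists>e. is_hom n e (f i)"
    and reg: "regular_on f k (polys_in {1..n}) (plus_multiples n x B)"
    and xB: "\<And>a. a \<in> polys_in {1..n} \<Longrightarrow> x * a \<in> B \<Longrightarrow> a \<in> B"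
  shows "regular_on f k (polys_in {1..n}) B"
  unfolding regular_on_def
proof (intro allI impI ballI)
  let ?S = "polys_in {1..n} :: 'a mpoly set"
  fix i a assume i: "i < k" and a: "a \<in> ?S" and fa: "f i * a \<in> adjoin f ?S B i"
  let ?F = "adjoin f ?S B i"
  note S = submod_polys_in[of n]
  have sub: "submod n ?F" by (rule submod_adjoin[OF S B(1)])
  have fi: "f i \<in> ?S" using f(1) i by simp
  obtain e where e: "is_hom n e (f i)" using f(2)[OF i] by blast
  have hF: "hom_closed n ?F" using i f(2) by (intro hom_closed_adjoin[OF B(2)]) simp
  have hom: "a \<in> ?F" if "is_hom n d a" "a \<in> ?S" "f i * a \<in> ?F" for a d
    using that
  proof (induction d arbitrary: a rule: less_induct)
    case (less d)
    have da: "hcomp n d a = a" using less.prems(1) by (intro restr_id) (auto simp: is_hom_def)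
    have "f i * a \<in> adjoin f ?S (plus_multiples n x B) i"
      using less.prems(3) subset_plus_multiples[of ?F n x] unfolding adjoin_plus_multiples[OF B(1)] by blast
    then have "a \<in> adjoin f ?S (plus_multiples n x B) i" by (rule regular_onD[OF reg i less.prems(2)])
    then obtain y c where y: "a = y + x * c" "y \<in> ?F" "c \<in> ?S"
      unfolding adjoin_plus_multiples[OF B(1)] unfolding plus_multiples_def by blast
    have yd: "hcomp n d y \<in> ?F" using hF y(2) by (simp add: hom_closed_def)
    have split: "a = hcomp n d y + hcomp n d (x * c)" using da y(1) restr_add by metis
    show ?case
    proof (cases "1 \<le> d")
      case False
      then show ?thesis using split yd by (simp add: hcomp_mult[OF x(2)])
    next
      case True
      let ?c = "hcomp n (d - 1) c"
      have ac: "a = hcomp n d y + x * ?c" using split True by (simp add: hcomp_mult[OF x(2)])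
      have cS: "?c \<in> ?S" by (rule restr_polys_in[OF y(3)])
      have "x * (f i * ?c) = f i * a - f i * hcomp n d y" by (subst ac) (simp add: algebra_simps)
      also have "\<dots> \<in> ?F" by (rule submod_diff[OF sub less.prems(3) submodD(3)[OF sub fi yd]])
      finally have "x * (f i * ?c) \<in> ?F" .
      then have "f i * ?c \<in> ?F"
        using nonzerodivisor_mod_adjoin[OF B(1) x(1) f(1) reg xB _ submodD(3)[OF S fi cS], of i] i by simp
      then have "?c \<in> ?F" using less.IH[of "d - 1" ?c] True cS is_hom_hcomp[of n "d - 1" c] by simp
      then have "hcomp n d y + x * ?c \<in> ?F" by (intro submodD(2)[OF sub yd] submodD(3)[OF sub x(1)])
      then show ?thesis using ac by simp
    qed
  qed
  have "hcomp n d a \<in> ?F" for d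
  proof (rule hom[OF is_hom_hcomp restr_polys_in[OF a]])
    have "f i * hcomp n d a = hcomp n (d + e) (f i * a)" by (simp add: hcomp_mult[OF e])
    then show "f i * hcomp n d a \<in> ?F" using hF fa by (simp add: hom_closed_def)
  qed
  then have "(\<Sum>d\<in>total_deg n ` keys a. hcomp n d a) \<in> ?F" by (intro submod_sum[OF sub])
  then show "a \<in> ?F" using sum_hcomp[of a n] by simp
qed

section \<open>Elementary symmetric polynomials\<close>

definition elem_sym :: "nat \<Rightarrow> nat \<Rightarrow> 'k::field mpoly" where
  "elem_sym n k = (\<Sum>T | T \<subseteq> {1..n} \<and> card T = k. monom (indic T))"

lemma finite_subset_atLeastAtMost: "T \<subseteq> {1..n} \<Longrightarrow> finite T" for T :: "nat set"
  using finite_subset by blast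

lemma keys_elem_sym: "keys (elem_sym n k) \<subseteq> {t \<in> expos n. total_deg n t = k}"
  unfolding elem_sym_def
proof (rule keys_sum_subset)
  fix T assume T: "T \<in> {T. T \<subseteq> {1..n} \<and> card T = k}"
  then have "indic T \<in> expos n" "total_deg n (indic T) = k"
    using total_deg_indic keys_indic[OF finite_subset_atLeastAtMost] unfolding expos_def by blast+
  then show "keys (monom (indic T)) \<subseteq> {t \<in> expos n. total_deg n t = k}" by simp
qed

lemma elem_sym_polys_in: "elem_sym n k \<in> polys_in {1..n}"
  unfolding polys_in_iff using keys_elem_sym by blast

lemma is_hom_elem_sym: "is_hom n k (elem_sym n k)"
  unfolding is_hom_def using keys_elem_sym by blast

lemma single_expos: "c \<in> {1..n} \<Longrightarrow> single c 1 \<in> expos n"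
  unfolding expos_def by simp

lemma var_polys_in: "c \<in> {1..n} \<Longrightarrow> var c \<in> polys_in {1..n}"
  unfolding polys_in_iff var_def using single_expos by simp

lemma is_hom_var:
  assumes "c \<in> {1..n}"
  shows "is_hom n 1 (var c)"
proof -
  have "indic {c} = single c 1" by (simp add: indic_def)
  then have "total_deg n (single c 1) = 1" using total_deg_indic[of "{c}" n] assms by simp
  then show ?thesis unfolding is_hom_def var_def by simp
qed

lemma var_ideal_insert:
  assumes "c \<in> {1..n}"
  shows "(var_ideal n (insert c C) :: 'k::field mpoly set) = plus_multiples n (var c) (var_ideal n C)"
proof (intro equalityI subsetI)
  fix p :: "'k mpoly" assume p: "p \<in> var_ideal n (insert c C)"
  let ?U = "{t. keys t \<inter> C \<noteq> {}}"
  have "keys (restr (- ?U) p) \<subseteq> multiples n (single c 1)"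
  proof
    fix t assume "t \<in> keys (restr (- ?U) p)"
    then show "t \<in> multiples n (single c 1)"
      unfolding multiples_single_iff[OF assms] using p unfolding var_ideal_def keys_restr by auto
  qed
  from divide_by_monom[OF this] obtain q where q: "restr (- ?U) p = var c * q" "keys q \<subseteq> expos n"
    unfolding var_def by blast
  have "p = restr ?U p + var c * q" using restr_split[of p ?U] q(1) by simp
  moreover have "restr ?U p \<in> var_ideal n C" using p by (auto simp: var_ideal_def keys_restr)
  ultimately show "p \<in> plus_multiples n (var c) (var_ideal n C)"
    unfolding plus_multiples_def polys_in_iff using q(2) by blast
next
  fix p :: "'k mpoly" assume "p \<in> plus_multiples n (var c) (var_ideal n C)"
  then obtain b a where p: "p = b + var c * a" "b \<in> var_ideal n C" "keys a \<subseteq> expos n"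
    unfolding plus_multiples_def polys_in_iff by blast
  have "keys (var c * a) \<subseteq> multiples n (single c 1)"
    unfolding var_def keys_monom_mult using p(3) by blast
  then have "var c * a \<in> var_ideal n (insert c C)"
    unfolding var_ideal_def using multiples_single_iff[OF assms] by blast
  moreover have "b \<in> var_ideal n (insert c C)" using p(2) unfolding var_ideal_def by blast
  ultimately show "p \<in> var_ideal n (insert c C)" unfolding p(1) by (rule submodD(2)[OF submod_var_ideal, rotated 1])
qed

lemma var_nonzerodivisor_mod_var_ideal:
  assumes "c \<in> {1..n}" "c \<notin> C" "a \<in> polys_in {1..n}" "var c * a \<in> var_ideal n C"
  shows "a \<in> var_ideal n C"
proof -
  have "keys t \<inter> C \<noteq> {}" if "t \<in> keys a" for t
  proof -
    have "single c 1 + t \<in> keys (var c * a)"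
      unfolding var_def keys_monom_mult using that by blast
    then have "keys (single c (1::nat) + t) \<inter> C \<noteq> {}"
      using assms(4) unfolding var_ideal_def by blast
    then show ?thesis using assms(2) by (simp add: keys_plus_nat Int_Un_distrib2)
  qed
  then show ?thesis using assms(3) unfolding var_ideal_def polys_in_iff by blast
qed

text \<open>
  Modulo \<open>P\<^sub>C\<close> the last elementary symmetric polynomial that can survive is the product of all the
  remaining variables, since every other subset of the same size meets \<open>C\<close>.
\<close>

lemma elem_sym_mod_var_ideal:
  assumes "C \<subseteq> {1..n}"
  shows "elem_sym n (n - card C) - monom (indic ({1..n} - C)) \<in> (var_ideal n C :: 'k::field mpoly set)"
proof -
  let ?E = "{1..n} - C"
  let ?X = "{T. T \<subseteq> {1..n} \<and> card T = n - card C}"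
  have cE: "card ?E = n - card C" using assms finite_subset_atLeastAtMost by (simp add: card_Diff_subset)
  then have E: "?E \<in> ?X" by blast
  have fin: "finite ?X" by (rule finite_subset[of _ "Pow {1..n}"]) auto
  have "(elem_sym n (n - card C) :: 'k mpoly) = monom (indic ?E) + (\<Sum>T\<in>?X - {?E}. monom (indic T))"
    unfolding elem_sym_def by (rule sum.remove[OF fin E])
  moreover have "(\<Sum>T\<in>?X - {?E}. monom (indic T)) \<in> (var_ideal n C :: 'k mpoly set)"
  proof (rule submod_sum[OF submod_var_ideal])
    fix T assume T: "T \<in> ?X - {?E}"
    then have fT: "finite T" "T \<subseteq> {1..n}" "card T = card ?E" "T \<noteq> ?E" using finite_subset_atLeastAtMost cE by auto
    have "\<not> T \<subseteq> ?E" using fT card_subset_eq[of ?E T] by auto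
    then have "T \<inter> C \<noteq> {}" using fT(2) by blast
    then show "monom (indic T) \<in> (var_ideal n C :: 'k mpoly set)"
      unfolding var_ideal_def expos_def using fT(1,2) by (simp add: keys_indic)
  qed
  ultimately show ?thesis by simp
qed

text \<open>
  Induction on the number of variables outside \<open>C\<close>. All but the last of the polynomials are regular
  modulo any further variable \<open>x\<^sub>c\<close> by the induction hypothesis, hence regular by \<open>regular_on_deform\<close>. The last one is the
  product of the variables outside \<open>C\<close> modulo \<open>P\<^sub>C\<close>, and each of these is a nonzerodivisor modulo the
  earlier polynomials by \<open>nonzerodivisor_mod_adjoin\<close>.
\<close>

lemma elem_sym_regular_on:
  assumes "C \<subseteq> {1..n}"
  shows "regular_on (\<lambda>i. elem_sym n (Suc i)) (n - card C) (polys_in {1..n}) (var_ideal n C :: 'k::field mpoly set)"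
  using assms
proof (induction "n - card C" arbitrary: C)
  case 0
  then show ?case by (simp add: regular_on_def)
next
  case (Suc N)
  let ?f = "\<lambda>i. elem_sym n (Suc i) :: 'k mpoly"
  let ?S = "polys_in {1..n} :: 'k mpoly set"
  let ?P = "var_ideal n C :: 'k mpoly set"
  have C: "C \<subseteq> {1..n}" by fact
  have N: "n - card C = Suc N" using Suc.hyps(2) by simp
  have IH: "regular_on ?f N ?S (plus_multiples n (var c) ?P)" if "c \<in> {1..n} - C" for c
  proof -
    have "finite C" using C finite_subset_atLeastAtMost by blast
    then have "card (insert c C) = Suc (card C)" using that by simp
    then have "N = n - card (insert c C)" using N by linarith
    moreover have "insert c C \<subseteq> {1..n}" using that C by blast
    ultimately have "regular_on ?f N ?S (var_ideal n (insert c C))" using Suc.hyps(1) by metis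
    moreover have "c \<in> {1..n}" using that by blast
    ultimately show ?thesis using var_ideal_insert by metis
  qed
  have nzd: "a \<in> adjoin ?f ?S ?P N" if "c \<in> {1..n} - C" "a \<in> ?S" "var c * a \<in> adjoin ?f ?S ?P N" for c a
  proof (rule nonzerodivisor_mod_adjoin[OF submod_var_ideal _ elem_sym_polys_in IH[OF that(1)] _ order_refl that(2,3)])
    show "var c \<in> ?S" using that(1) var_polys_in by blast
    show "b \<in> ?P" if "b \<in> ?S" "var c * b \<in> ?P" for b
      using var_nonzerodivisor_mod_var_ideal that \<open>c \<in> {1..n} - C\<close> by blast
  qed
  have "{1..n} - C \<noteq> {}"
  proof
    assume "{1..n} - C = {}"
    then have "C = {1..n}" using C by blast
    then have "card C = n" by simp
    then show False using N by simp
  qed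
  then obtain c where c: "c \<in> {1..n} - C" by blast
  have "regular_on ?f N ?S ?P"
  proof (rule regular_on_deform[OF submod_var_ideal hom_closed_var_ideal _ _ elem_sym_polys_in _ IH[OF c]])
    show "var c \<in> ?S" "is_hom n 1 (var c)" using c var_polys_in is_hom_var by blast+
    show "\<exists>e. is_hom n e (?f i)" for i using is_hom_elem_sym by blast
    show "b \<in> ?P" if "b \<in> ?S" "var c * b \<in> ?P" for b
      using var_nonzerodivisor_mod_var_ideal that c by blast
  qed
  moreover have "a \<in> adjoin ?f ?S ?P N" if a: "a \<in> ?S" and fa: "?f N * a \<in> adjoin ?f ?S ?P N" for a
  proof -
    let ?F = "adjoin ?f ?S ?P N"
    have sub: "submod n ?F" by (rule submod_adjoin[OF submod_polys_in submod_var_ideal])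
    have "(?f N - monom (indic ({1..n} - C))) \<in> ?P" using elem_sym_mod_var_ideal[OF C] N by metis
    then have "a * (?f N - monom (indic ({1..n} - C))) \<in> ?P" by (rule submodD(3)[OF submod_var_ideal a])
    then have "a * (?f N - monom (indic ({1..n} - C))) \<in> ?F"
      using base_subset_adjoin[OF submodD(1)[OF submod_polys_in]] by blast
    from submod_diff[OF sub fa this] have "monom (indic ({1..n} - C)) * a \<in> ?F"
      by (simp add: algebra_simps)
    moreover have "finite E \<Longrightarrow> E \<subseteq> {1..n} - C \<Longrightarrow> monom (indic E) * a \<in> ?F \<longrightarrow> a \<in> ?F" for E
    proof (induction E rule: finite_induct)
      case empty
      then show ?case by (simp add: indic_def)
    next
      case (insert d E)
      have eq: "monom (indic (insert d E)) * a = var d * (monom (indic E) * a)"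
        using insert(1,2) by (simp add: indic_insert var_def mult_single flip: mult.assoc)
      have "indic E \<in> expos n" unfolding expos_def using insert by (auto simp: keys_indic)
      then have "(monom (indic E) :: 'k mpoly) \<in> ?S" unfolding polys_in_iff by simp
      then have "monom (indic E) * a \<in> ?S" by (rule polys_in_mult[OF _ a])
      then show ?case unfolding eq using nzd[of d "monom (indic E) * a"] insert by blast
    qed
    ultimately show ?thesis by (metis finite_Diff finite_atLeastAtMost order_refl)
  qed
  ultimately show ?case unfolding N regular_on_def by (metis less_Suc_eq)
qed


section \<open>Koszul homology\<close>

text \<open>
  The sign of moving the index \<open>i\<close> to its place in the increasing enumeration of \<open>T\<close>.
\<close>

definition ksign :: "nat \<Rightarrow> nat set \<Rightarrow> 'a::comm_ring_1" where
  "ksign i T = (- 1) ^ card {j \<in> T. j < i}"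

lemma ksign_square: "ksign i T * ksign i T = 1"
  by (simp add: ksign_def flip: power_add power_mult_distrib)

lemma ksign_insert:
  assumes "finite T" "i \<notin> T"
  shows "ksign j (insert i T) = (if i < j then - ksign j T else ksign j T)"
proof (cases "i < j")
  case True
  then have "{k \<in> insert i T. k < j} = insert i {k \<in> T. k < j}" by auto
  then show ?thesis using True assms by (simp add: ksign_def)
next
  case False
  then have "{k \<in> insert i T. k < j} = {k \<in> T. k < j}" by auto
  then show ?thesis using False by (simp add: ksign_def)
qed

text \<open>
  The terms are paired off rather than the sum compared with its negative, so that characteristic two
  is covered.
\<close>

lemma sum_antisymmetric:
  fixes F :: "nat \<Rightarrow> nat \<Rightarrow> 'a::ab_group_add"
  assumes "finite A" "\<And>i j. i \<in> A \<Longrightarrow> j \<in> A \<Longrightarrow> i \<noteq> j \<Longrightarrow> F i j = - F j i"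
  shows "(\<Sum>i\<in>A. \<Sum>j\<in>A - {i}. F i j) = 0"
proof -
  \<comment> \<open>split each unordered pair of indices by its order, and swap the summation on one half\<close>
  let ?G = "\<lambda>i j. if j < i then F i j else 0" and ?H = "\<lambda>i j. if i < j then F i j else 0"
  have inner: "(\<Sum>j\<in>A - {i}. F i j) = (\<Sum>j\<in>A. ?G i j) + (\<Sum>j\<in>A. ?H i j)" if "i \<in> A" for i
  proof -
    have "(\<Sum>j\<in>A. ?G i j) + (\<Sum>j\<in>A. ?H i j) = (\<Sum>j\<in>A. if j = i then 0 else F i j)"
      unfolding sum.distrib[symmetric] by (rule sum.cong) auto
    also have "\<dots> = (\<Sum>j\<in>A - {i}. F i j)"
      using assms(1) that by (simp add: sum.remove)
    finally show ?thesis by simp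
  qed
  have "(\<Sum>i\<in>A. \<Sum>j\<in>A. ?H i j) = (\<Sum>j\<in>A. \<Sum>i\<in>A. ?H i j)" by (rule sum.swap)
  also have "\<dots> = (\<Sum>j\<in>A. \<Sum>i\<in>A. - ?G j i)"
  proof (intro sum.cong HOL.refl)
    fix i j assume "j \<in> A" "i \<in> A"
    then show "?H i j = - ?G j i" using assms(2)[of i j] by auto
  qed
  also have "\<dots> = - (\<Sum>i\<in>A. \<Sum>j\<in>A. ?G i j)" by (simp only: sum_negf)
  finally have "(\<Sum>i\<in>A. \<Sum>j\<in>A. ?G i j) + (\<Sum>i\<in>A. \<Sum>j\<in>A. ?H i j) = 0" by (simp only: right_minus)
  moreover have "(\<Sum>i\<in>A. \<Sum>j\<in>A - {i}. F i j) = (\<Sum>i\<in>A. (\<Sum>j\<in>A. ?G i j) + (\<Sum>j\<in>A. ?H i j))"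
    by (rule sum.cong[OF HOL.refl inner])
  ultimately show ?thesis by (simp only: sum.distrib)
qed

text \<open>
  The Koszul differential. A chain is a function on index sets, with \<open>w T\<close> the coefficient of the basis
  element \<open>e\<^sub>T\<close>; chains of degree \<open>i\<close> are read off at the sets of size \<open>i\<close>.
\<close>

definition koszul_d :: "nat \<Rightarrow> (nat set \<Rightarrow> 'k::field mpoly) \<Rightarrow> nat set \<Rightarrow> 'k mpoly" where
  "koszul_d n w T = (\<Sum>i\<in>{1..n} - T. ksign i T * var i * w (insert i T))"

text \<open>
  Exterior multiplication by \<open>\<Sum>i. g\<^sub>i e\<^sub>i\<close>.
\<close>

definition koszul_h :: "(nat \<Rightarrow> 'k::field mpoly) \<Rightarrow> (nat set \<Rightarrow> 'k mpoly) \<Rightarrow> nat set \<Rightarrow> 'k mpoly" where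
  "koszul_h g w T = (\<Sum>i\<in>T. ksign i (T - {i}) * g i * w (T - {i}))"

lemma koszul_d_d:
  assumes "T \<subseteq> {1..n}"
  shows "koszul_d n (koszul_d n w) T = 0"
proof -
  have T: "finite T" using assms by (rule finite_subset_atLeastAtMost)
  let ?F = "\<lambda>i j. ksign i T * ksign j (insert i T) * (var i * var j) * w (insert j (insert i T))"
  have "koszul_d n (koszul_d n w) T = (\<Sum>i\<in>{1..n} - T. \<Sum>j\<in>{1..n} - T - {i}. ?F i j)"
    unfolding koszul_d_def sum_distrib_left
  proof (intro sum.cong HOL.refl)
    fix i show "{1..n} - insert i T = {1..n} - T - {i}" by blast
  qed (simp only: ac_simps)
  also have "\<dots> = 0"
  proof (rule sum_antisymmetric)
    fix i j assume ij: "i \<in> {1..n} - T" "j \<in> {1..n} - T" "i \<noteq> j"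
    have "(ksign i T * ksign j (insert i T) :: 'a mpoly) = - (ksign j T * ksign i (insert j T))"
      using ij T by (simp add: ksign_insert not_less_iff_gr_or_eq ac_simps)
    then show "?F i j = - ?F j i" by (simp only: insert_commute[of j i T] mult.commute[of "var i" "var j"] mult_minus_left)
  qed simp
  finally show ?thesis .
qed

text \<open>
  Elements of the maximal ideal act as zero on Koszul homology. In the two double sums the terms that
  remove \<open>i\<close> and add \<open>j \<noteq> i\<close> cancel; the terms with \<open>i = j\<close> add up to \<open>f\<close>.
\<close>

lemma koszul_homotopy:
  assumes T: "T \<subseteq> {1..n}" and f: "f = (\<Sum>i\<in>{1..n}. var i * g i)"
  shows "koszul_d n (koszul_h g w) T + koszul_h g (koszul_d n w) T = f * w T"
proof -
  have fin: "finite T" using T by (rule finite_subset_atLeastAtMost)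
  let ?N = "{1..n} - T"
  let ?K = "\<lambda>i j. ksign i (T - {i}) * ksign j (T - {i}) * (var j * g i) * w (insert j (T - {i}))"
  have dh: "ksign j T * var j * koszul_h g w (insert j T) = var j * g j * w T - (\<Sum>i\<in>T. ?K i j)" if j: "j \<in> ?N" for j
  proof -
    have "koszul_h g w (insert j T) = ksign j T * g j * w T + (\<Sum>i\<in>T. ksign i (insert j (T - {i})) * g i * w (insert j (T - {i})))"
    proof -
      have "koszul_h g w (insert j T) = ksign j (insert j T - {j}) * g j * w (insert j T - {j}) + (\<Sum>i\<in>T. ksign i (insert j T - {i}) * g i * w (insert j T - {i}))"
        unfolding koszul_h_def using fin j by (subst sum.insert) auto
      also have "insert j T - {j} = T" using j by blast
      also have "(\<Sum>i\<in>T. ksign i (insert j T - {i}) * g i * w (insert j T - {i})) = (\<Sum>i\<in>T. ksign i (insert j (T - {i})) * g i * w (insert j (T - {i})))"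
      proof (rule sum.cong[OF HOL.refl])
        fix i assume "i \<in> T"
        then have "insert j T - {i} = insert j (T - {i})" using j by blast
        then show "ksign i (insert j T - {i}) * g i * w (insert j T - {i}) = ksign i (insert j (T - {i})) * g i * w (insert j (T - {i}))" by simp
      qed
      finally show ?thesis .
    qed
    then have "ksign j T * var j * koszul_h g w (insert j T)
      = ksign j T * ksign j T * (var j * g j * w T) + (\<Sum>i\<in>T. ksign j T * ksign i (insert j (T - {i})) * (var j * g i) * w (insert j (T - {i})))"
      by (simp add: distrib_left sum_distrib_left ac_simps)
    also have "(\<Sum>i\<in>T. ksign j T * ksign i (insert j (T - {i})) * (var j * g i) * w (insert j (T - {i}))) = (\<Sum>i\<in>T. - ?K i j)"
    proof (rule sum.cong[OF HOL.refl])
      fix i assume i: "i \<in> T"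
      have *: "finite (T - {i})" "j \<notin> T - {i}" "i \<notin> T - {i}" "i \<noteq> j" using fin i j by auto
      have "insert i (T - {i}) = T" using i by blast
      then have "(ksign j T :: 'a mpoly) = (if i < j then - ksign j (T - {i}) else ksign j (T - {i}))"
        using ksign_insert[OF *(1,3), of j] by metis
      moreover have "i < j \<longleftrightarrow> \<not> j < i" using *(4) by linarith
      ultimately have "(ksign j T * ksign i (insert j (T - {i})) :: 'a mpoly) = - (ksign i (T - {i}) * ksign j (T - {i}))"
        unfolding ksign_insert[OF *(1,2)] by (cases "i < j") (simp_all add: ac_simps)
      then show "ksign j T * ksign i (insert j (T - {i})) * (var j * g i) * w (insert j (T - {i})) = - ?K i j"
        by (simp only: mult_minus_left)
    qed
    finally show ?thesis by (simp add: ksign_square sum_negf)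
  qed
  have hd: "ksign i (T - {i}) * g i * koszul_d n w (T - {i}) = var i * g i * w T + (\<Sum>j\<in>?N. ?K i j)" if i: "i \<in> T" for i
  proof -
    have N: "{1..n} - (T - {i}) = insert i ?N" using i T by blast
    have "koszul_d n w (T - {i}) = ksign i (T - {i}) * var i * w T + (\<Sum>j\<in>?N. ksign j (T - {i}) * var j * w (insert j (T - {i})))"
      unfolding koszul_d_def N using i by (subst sum.insert) (auto simp: insert_absorb)
    then have "ksign i (T - {i}) * g i * koszul_d n w (T - {i}) = ksign i (T - {i}) * ksign i (T - {i}) * (var i * g i * w T) + (\<Sum>j\<in>?N. ?K i j)"
      by (simp add: distrib_left sum_distrib_left ac_simps)
    then show ?thesis by (simp add: ksign_square)
  qed
  have "koszul_d n (koszul_h g w) T = (\<Sum>j\<in>?N. var j * g j * w T) - (\<Sum>j\<in>?N. \<Sum>i\<in>T. ?K i j)"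
    unfolding koszul_d_def sum_subtractf[symmetric] by (rule sum.cong[OF HOL.refl dh])
  moreover have "koszul_h g (koszul_d n w) T = (\<Sum>i\<in>T. var i * g i * w T) + (\<Sum>i\<in>T. \<Sum>j\<in>?N. ?K i j)"
    unfolding koszul_h_def sum.distrib[symmetric] by (rule sum.cong[OF HOL.refl hd])
  moreover have "(\<Sum>j\<in>?N. \<Sum>i\<in>T. ?K i j) = (\<Sum>i\<in>T. \<Sum>j\<in>?N. ?K i j)" by (rule sum.swap)
  moreover have "f * w T = (\<Sum>j\<in>?N. var j * g j * w T) + (\<Sum>i\<in>T. var i * g i * w T)"
    unfolding f sum_distrib_right by (rule sum.subset_diff[OF T]) simp
  ultimately show ?thesis by simp
qed

text \<open>
  Koszul homology of \<open>A/B\<close> in degree \<open>i\<close> does not vanish: some chain with values in \<open>A\<close> is a cycle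
  modulo \<open>B\<close> and not a boundary modulo \<open>B\<close>.
\<close>

definition koszul_nonzero :: "nat \<Rightarrow> nat \<Rightarrow> 'k::field mpoly set \<Rightarrow> 'k mpoly set \<Rightarrow> bool" where
  "koszul_nonzero n i A B \<longleftrightarrow>
     (\<exists>w. (\<forall>T\<subseteq>{1..n}. card T = i \<longrightarrow> w T \<in> A) \<and> (\<forall>T\<subseteq>{1..n}. Suc (card T) = i \<longrightarrow> koszul_d n w T \<in> B)
        \<and> \<not> (\<exists>v. (\<forall>T\<subseteq>{1..n}. card T = Suc i \<longrightarrow> v T \<in> A) \<and> (\<forall>T\<subseteq>{1..n}. card T = i \<longrightarrow> w T - koszul_d n v T \<in> B)))"

lemma koszul_nonzero_le: "koszul_nonzero n i A B \<Longrightarrow> i \<le> n"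
proof (rule ccontr)
  assume nz: "koszul_nonzero n i A B" and "\<not> i \<le> n"
  then have no: "T \<subseteq> {1..n} \<Longrightarrow> card T \<noteq> i \<and> card T \<noteq> Suc i" for T
    using card_mono[of "{1..n}" T] by auto
  show False using nz no unfolding koszul_nonzero_def by blast
qed

lemma ksign_polys_in: "(ksign i T :: 'k::field mpoly) \<in> polys_in {1..n}"
proof -
  have 1: "(1 :: 'k mpoly) \<in> polys_in {1..n}" by (simp add: polys_in_def)
  have "(ksign i T :: 'k mpoly) = 1 \<or> (ksign i T :: 'k mpoly) = - 1"
    unfolding ksign_def by (cases "even (card {j \<in> T. j < i})") simp_all
  then show ?thesis using 1 submod_uminus[OF submod_polys_in 1] by auto
qed

lemma koszul_d_mem:
  assumes "submod n A" "T \<subseteq> {1..n}" "\<And>U. U \<subseteq> {1..n} \<Longrightarrow> card U = Suc (card T) \<Longrightarrow> w U \<in> A"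
  shows "koszul_d n w T \<in> A"
  unfolding koszul_d_def
proof (rule submod_sum[OF assms(1)])
  fix i assume i: "i \<in> {1..n} - T"
  have "finite T" using assms(2) by (rule finite_subset_atLeastAtMost)
  then have "card (insert i T) = Suc (card T)" using i by simp
  then have "w (insert i T) \<in> A" using assms(2) i by (intro assms(3)) auto
  moreover have "ksign i T * var i \<in> polys_in {1..n}"
    using i var_polys_in by (intro polys_in_mult ksign_polys_in) blast
  ultimately show "ksign i T * var i * w (insert i T) \<in> A" using submodD(3)[OF assms(1)] by blast
qed

lemma koszul_d_cong:
  assumes "T \<subseteq> {1..n}" "\<And>U. U \<subseteq> {1..n} \<Longrightarrow> card U = Suc (card T) \<Longrightarrow> w U = v U"
  shows "koszul_d n w T = koszul_d n v T"
  unfolding koszul_d_def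
proof (rule sum.cong[OF HOL.refl])
  fix i assume i: "i \<in> {1..n} - T"
  have "finite T" using assms(1) by (rule finite_subset_atLeastAtMost)
  then have "w (insert i T) = v (insert i T)" using i assms(1) by (intro assms(2)) auto
  then show "ksign i T * var i * w (insert i T) = ksign i T * var i * v (insert i T)" by simp
qed

lemma koszul_d_add: "koszul_d n (\<lambda>T. w T + v T) T = koszul_d n w T + koszul_d n v T"
  by (simp add: koszul_d_def distrib_left sum.distrib)

lemma koszul_d_mult: "koszul_d n (\<lambda>T. f * v T) T = f * koszul_d n v T"
  by (simp add: koszul_d_def sum_distrib_left ac_simps)

lemma koszul_h_mem:
  assumes "submod n A" "T \<subseteq> {1..n}" "\<And>i. i \<in> {1..n} \<Longrightarrow> g i \<in> polys_in {1..n}"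
    "\<And>U. U \<subseteq> {1..n} \<Longrightarrow> Suc (card U) = card T \<Longrightarrow> w U \<in> A"
  shows "koszul_h g w T \<in> A"
  unfolding koszul_h_def
proof (rule submod_sum[OF assms(1)])
  fix i assume i: "i \<in> T"
  have "finite T" using assms(2) by (rule finite_subset_atLeastAtMost)
  then have "Suc (card (T - {i})) = card T" using i by (rule card_Suc_Diff1)
  then have "w (T - {i}) \<in> A" using assms(2) by (intro assms(4)) auto
  moreover have "ksign i (T - {i}) * g i \<in> polys_in {1..n}"
    using i assms(2,3) by (intro polys_in_mult ksign_polys_in) blast
  ultimately show "ksign i (T - {i}) * g i * w (T - {i}) \<in> A" using submodD(3)[OF assms(1)] by blast
qed

text \<open>
  The connecting map of \<open>0 \<rightarrow> M \<rightarrow> M \<rightarrow> M/fM \<rightarrow> 0\<close> made explicit. For a cycle \<open>w\<close>, the chain \<open>h w\<close> has boundary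
  \<open>f w\<close> by the homotopy, so it is a cycle modulo \<open>f\<close>. If it were a boundary modulo \<open>f\<close>, say \<open>h w = d v + f a\<close>, then
  \<open>f w = f d a\<close>, and cancelling \<open>f\<close> would make \<open>w\<close> a boundary.
\<close>

lemma koszul_nonzero_quotient:
  assumes A: "submod n A" and B: "submod n B"
    and f: "f = (\<Sum>i\<in>{1..n}. var i * g i)" and g: "\<And>i. i \<in> {1..n} \<Longrightarrow> g i \<in> polys_in {1..n}"
    and reg: "\<And>a. a \<in> A \<Longrightarrow> f * a \<in> B \<Longrightarrow> a \<in> B"
    and nz: "koszul_nonzero n i A B"
  shows "koszul_nonzero n (Suc i) A {y + f * a | y a. y \<in> B \<and> a \<in> A}"
proof -
  from nz obtain w where w: "\<And>T. T \<subseteq> {1..n} \<Longrightarrow> card T = i \<Longrightarrow> w T \<in> A"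
    "\<And>T. T \<subseteq> {1..n} \<Longrightarrow> Suc (card T) = i \<Longrightarrow> koszul_d n w T \<in> B"
    and nb: "\<not> (\<exists>v. (\<forall>T\<subseteq>{1..n}. card T = Suc i \<longrightarrow> v T \<in> A) \<and> (\<forall>T\<subseteq>{1..n}. card T = i \<longrightarrow> w T - koszul_d n v T \<in> B))"
    unfolding koszul_nonzero_def by blast
  let ?w = "koszul_h g w"
  have hB: "koszul_h g (koszul_d n w) T \<in> B" if "T \<subseteq> {1..n}" "card T = i" for T
    using that w(2) by (intro koszul_h_mem[OF B that(1) g]) auto
  have dw: "koszul_d n ?w T = - koszul_h g (koszul_d n w) T + f * w T" if "T \<subseteq> {1..n}" for T
    using koszul_homotopy[OF that f, of w] by (simp add: algebra_simps)
  show ?thesis unfolding koszul_nonzero_def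
  proof (intro exI[of _ ?w] conjI allI impI notI)
    fix T assume T: "T \<subseteq> {1..n}" "card T = Suc i"
    show "?w T \<in> A" using w(1) T(2) by (intro koszul_h_mem[OF A T(1) g]) auto
  next
    fix T assume T: "T \<subseteq> {1..n}" "Suc (card T) = Suc i"
    then have i: "card T = i" by simp
    show "koszul_d n ?w T \<in> {y + f * a | y a. y \<in> B \<and> a \<in> A}"
      unfolding dw[OF T(1)] using submod_uminus[OF B hB[OF T(1) i]] w(1)[OF T(1) i] by blast
  next
    assume "\<exists>v. (\<forall>T\<subseteq>{1..n}. card T = Suc (Suc i) \<longrightarrow> v T \<in> A) \<and>
      (\<forall>T\<subseteq>{1..n}. card T = Suc i \<longrightarrow> ?w T - koszul_d n v T \<in> {y + f * a | y a. y \<in> B \<and> a \<in> A})"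
    then obtain v where v: "\<forall>T\<subseteq>{1..n}. card T = Suc i \<longrightarrow> ?w T - koszul_d n v T \<in> {y + f * a | y a. y \<in> B \<and> a \<in> A}" by blast
    define z where "z T = (SOME z. ?w T - koszul_d n v T = fst z + f * snd z \<and> fst z \<in> B \<and> snd z \<in> A)" for T
    define y a where "y T = fst (z T)" and "a T = snd (z T)" for T
    have ya: "?w T - koszul_d n v T = y T + f * a T \<and> y T \<in> B \<and> a T \<in> A" if "T \<subseteq> {1..n}" "card T = Suc i" for T
    proof -
      have "?w T - koszul_d n v T \<in> {y + f * a | y a. y \<in> B \<and> a \<in> A}" using v that by blast
      then obtain y a where "?w T - koszul_d n v T = y + f * a" "y \<in> B" "a \<in> A" by blast
      then have "\<exists>z. ?w T - koszul_d n v T = fst z + f * snd z \<and> fst z \<in> B \<and> snd z \<in> A"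
        by (intro exI[of _ "(y, a)"]) simp
      then show ?thesis unfolding y_def a_def z_def by (rule someI_ex)
    qed
    have bound: "w T - koszul_d n a T \<in> B" if T: "T \<subseteq> {1..n}" "card T = i" for T
    proof (rule reg)
      have aA: "koszul_d n a T \<in> A" using ya T(2) by (intro koszul_d_mem[OF A T(1)]) simp
      show "w T - koszul_d n a T \<in> A" by (rule submod_diff[OF A w(1)[OF T] aA])
      have "koszul_d n ?w T = koszul_d n (\<lambda>T. koszul_d n v T + (y T + f * a T)) T"
      proof (rule koszul_d_cong[OF T(1)])
        fix U :: "nat set" assume "U \<subseteq> {1..n}" "card U = Suc (card T)"
        then have "?w U - koszul_d n v U = y U + f * a U" using ya T(2) by simp
        then show "?w U = koszul_d n v U + (y U + f * a U)" by (simp add: algebra_simps)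
      qed
      also have "\<dots> = koszul_d n y T + f * koszul_d n a T"
        unfolding koszul_d_add koszul_d_mult koszul_d_d[OF T(1)] by simp
      finally have "f * (w T - koszul_d n a T) = koszul_d n y T + koszul_h g (koszul_d n w) T"
        using dw[OF T(1)] by (simp add: algebra_simps)
      moreover have "koszul_d n y T \<in> B" using ya T(2) by (intro koszul_d_mem[OF B T(1)]) simp
      ultimately show "f * (w T - koszul_d n a T) \<in> B" using submodD(2)[OF B _ hB[OF T]] by simp
    qed
    have "\<forall>T\<subseteq>{1..n}. card T = Suc i \<longrightarrow> a T \<in> A" using ya by blast
    moreover have "\<forall>T\<subseteq>{1..n}. card T = i \<longrightarrow> w T - koszul_d n a T \<in> B" using bound by blast
    ultimately show False using nb by blast
  qed
qed

text \<open>
  Each element of the sequence raises the degree of a nonzero class by one, and no index set has more than \<open>n\<close>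
  elements.
\<close>

lemma koszul_nonzero_regular_on:
  assumes A: "submod n A" and B: "submod n B"
    and f: "\<And>j. j < k \<Longrightarrow> \<exists>g. (\<forall>i\<in>{1..n}. g i \<in> polys_in {1..n}) \<and> f j = (\<Sum>i\<in>{1..n}. var i * g i)"
    and reg: "regular_on f k A B" and nz: "koszul_nonzero n i A B"
  shows "i + k \<le> n"
proof -
  have "j \<le> k \<longrightarrow> koszul_nonzero n (i + j) A (adjoin f A B j)" for j
  proof (induction j)
    case 0
    then show ?case using nz by simp
  next
    case (Suc j)
    show ?case
    proof
      assume j: "Suc j \<le> k"
      then obtain g where g: "\<forall>i\<in>{1..n}. g i \<in> polys_in {1..n}" "f j = (\<Sum>i\<in>{1..n}. var i * g i)" using f[of j] by auto
      have "koszul_nonzero n (Suc (i + j)) A {y + f j * a | y a. y \<in> adjoin f A B j \<and> a \<in> A}"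
      proof (rule koszul_nonzero_quotient[OF A submod_adjoin[OF A B] g(2)])
        show "g i \<in> polys_in {1..n}" if "i \<in> {1..n}" for i using g(1) that by blast
        show "a \<in> adjoin f A B j" if "a \<in> A" "f j * a \<in> adjoin f A B j" for a
          using regular_onD[OF reg _ that] j by simp
        show "koszul_nonzero n (i + j) A (adjoin f A B j)" using Suc j by simp
      qed
      then show "koszul_nonzero n (i + Suc j) A (adjoin f A B (Suc j))" by simp
    qed
  qed
  then have "koszul_nonzero n (i + k) A (adjoin f A B k)" by blast
  then show ?thesis by (rule koszul_nonzero_le)
qed


section \<open>Position of the pieces in the intervals\<close>

definition pieces_union :: "(nat \<times> nat) list \<Rightarrow> nat set" where
  "pieces_union ps = (\<Union>(p, q)\<in>set ps. {p..q})"

lemma pieces_bounds: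
  assumes "interval_seq xs" "\<forall>(a, b)\<in>set xs. l < a \<longrightarrow> h < b" "(p, q) \<in> set (pieces l h xs)"
  shows "l < p \<and> h < p \<and> p \<le> q"
  using assms
proof (induction xs arbitrary: l h)
  case (Cons x xs)
  obtain a b where x: "x = (a, b)" by (cases x)
  have xs: "interval_seq xs" and gt: "\<And>c d. (c, d) \<in> set xs \<Longrightarrow> a < c \<and> b < d" and ab: "a \<le> b"
    using Cons.prems(1) by (auto simp: x interval_seq_Cons)
  show ?case
  proof (cases "l < a")
    case False
    then show ?thesis using Cons.IH[OF xs, of l h] Cons.prems(2,3) by (simp add: x)
  next
    case True
    then have hb: "h < b" using Cons.prems(2) by (simp add: x)
    have "\<forall>(c, d)\<in>set xs. max a (Suc h) < c \<longrightarrow> b < d" using gt by blast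
    from Cons.IH[OF xs this] Cons.prems(3) True hb ab show ?thesis by (auto simp: x)
  qed
qed simp

lemma pieces_separated:
  assumes "interval_seq xs" "\<forall>(a, b)\<in>set xs. l < a \<longrightarrow> h < b"
  shows "sorted_wrt (\<lambda>x y. snd x < fst y) (pieces l h xs)"
  using assms
proof (induction xs arbitrary: l h)
  case (Cons x xs)
  obtain a b where x: "x = (a, b)" by (cases x)
  have xs: "interval_seq xs" and gt: "\<And>c d. (c, d) \<in> set xs \<Longrightarrow> a < c \<and> b < d"
    using Cons.prems(1) by (auto simp: x interval_seq_Cons)
  show ?case
  proof (cases "l < a")
    case False
    then show ?thesis using Cons.IH[OF xs, of l h] Cons.prems(2) by (simp add: x)
  next
    case True
    have *: "\<forall>(c, d)\<in>set xs. max a (Suc h) < c \<longrightarrow> b < d" using gt by blast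
    have "b < fst y" if "y \<in> set (pieces (max a (Suc h)) b xs)" for y
      using pieces_bounds[OF xs *, of "fst y" "snd y"] that by simp
    then show ?thesis using True Cons.IH[OF xs *] by (simp add: x)
  qed
qed simp

text \<open>
  An interval that is skipped starts no later than the last piece and ends after it.
\<close>

lemma piece_in_interval:
  assumes "interval_seq xs" "(c, d) \<in> set xs" "l < c" "\<forall>(a, b)\<in>set xs. l < a \<longrightarrow> h < b"
  shows "\<exists>(p, q)\<in>set (pieces l h xs). {p..q} \<subseteq> {c..d}"
  using assms
proof (induction xs arbitrary: l h)
  case (Cons x xs)
  obtain a b where x: "x = (a, b)" by (cases x)
  have xs: "interval_seq xs" and gt: "\<And>c d. (c, d) \<in> set xs \<Longrightarrow> a < c \<and> b < d"
    using Cons.prems(1) by (auto simp: x interval_seq_Cons)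
  show ?case
  proof (cases "l < a")
    case False
    then have "(c, d) \<in> set xs" using Cons.prems(2,3) by (auto simp: x)
    then show ?thesis using False Cons.IH[OF xs, of l h] Cons.prems(3,4) by (simp add: x)
  next
    case True
    let ?p = "max a (Suc h)"
    have *: "\<forall>(c, d)\<in>set xs. ?p < c \<longrightarrow> b < d" using gt by blast
    show ?thesis
    proof (cases "(c, d) \<in> set xs \<and> ?p < c")
      case c: True
      then show ?thesis using Cons.IH[OF xs _ _ *] True by (auto simp: x)
    next
      case False
      then have "{?p..b} \<subseteq> {c..d}" using Cons.prems(2) gt[of c d] by (auto simp: x)
      then show ?thesis using True by (simp add: x)
    qed
  qed
qed simp

text \<open>
  A piece is cut from an interval that is covered by the pieces up to this one, because the part that
  was cut away lies in the preceding piece. As the interval starts to the right of the left end of the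
  preceding piece, the left end of its own piece is the only left end that it contains.
\<close>

lemma piece_from_interval:
  assumes "interval_seq xs" "\<forall>(a, b)\<in>set xs. l < a \<longrightarrow> h < b" "(p, q) \<in> set (pieces l h xs)"
  shows "\<exists>a. (a, q) \<in> set xs \<and> l < a \<and> {a..q} \<subseteq> {Suc l..h} \<union> pieces_union (pieces l h xs)
     \<and> {a..q} \<inter> fst ` set (pieces l h xs) = {p}"
  using assms
proof (induction xs arbitrary: l h)
  case (Cons x xs)
  obtain a b where x: "x = (a, b)" by (cases x)
  have xs: "interval_seq xs" and gt: "\<And>c d. (c, d) \<in> set xs \<Longrightarrow> a < c \<and> b < d" and ab: "a \<le> b"
    using Cons.prems(1) by (auto simp: x interval_seq_Cons)
  show ?case
  proof (cases "l < a")
    case False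
    then have "\<exists>a. (a, q) \<in> set xs \<and> l < a \<and> {a..q} \<subseteq> {Suc l..h} \<union> pieces_union (pieces l h xs)
     \<and> {a..q} \<inter> fst ` set (pieces l h xs) = {p}" using Cons.IH[OF xs, of l h] Cons.prems(2,3) by (simp add: x)
    then show ?thesis using False by (auto simp: x)
  next
    case True
    let ?p = "max a (Suc h)" and ?ps = "pieces (max a (Suc h)) b xs"
    have hb: "h < b" using Cons.prems(2) True by (simp add: x)
    have pb: "?p \<le> b" using ab hb by simp
    have ps: "pieces l h (x # xs) = (?p, b) # ?ps" using True by (simp add: x)
    have un: "pieces_union (pieces l h (x # xs)) = {?p..b} \<union> pieces_union ?ps" by (simp add: ps pieces_union_def)
    have *: "\<forall>(c, d)\<in>set xs. ?p < c \<longrightarrow> b < d" using gt by blast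
    have above: "b < p' \<and> ?p < p'" if "(p', q') \<in> set ?ps" for p' q'
      using pieces_bounds[OF xs * that] by simp
    show ?thesis
    proof (cases "(p, q) = (?p, b)")
      case pq: True
      have "{a..b} \<subseteq> {Suc l..h} \<union> {?p..b}" using True by auto
      moreover have "{a..b} \<inter> fst ` set (pieces l h (x # xs)) = {?p}"
      proof -
        have "y \<notin> {a..b}" if "y \<in> fst ` set ?ps" for y
        proof -
          obtain q' where "(y, q') \<in> set ?ps" using \<open>y \<in> _\<close> by (metis imageE prod.collapse)
          then show ?thesis using above[of y q'] by simp
        qed
        moreover have "?p \<in> {a..b}" using pb by simp
        ultimately show ?thesis unfolding ps list.set image_insert fst_conv by blast
      qed
      moreover have "(a, b) \<in> set (x # xs)" by (simp add: x)
      moreover have "p = ?p" "q = b" using pq by simp_all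
      ultimately show ?thesis using True unfolding un by blast
    next
      case False
      then have "(p, q) \<in> set ?ps" using Cons.prems(3) unfolding ps by auto
      from Cons.IH[OF xs * this] obtain c where c: "(c, q) \<in> set xs" "?p < c"
        "{c..q} \<subseteq> {Suc ?p..b} \<union> pieces_union ?ps" "{c..q} \<inter> fst ` set ?ps = {p}" by blast
      have "{c..q} \<subseteq> {Suc l..h} \<union> pieces_union (pieces l h (x # xs))"
      proof -
        have "{Suc ?p..b} \<subseteq> {?p..b}" by auto
        then show ?thesis using c(3) unfolding un by blast
      qed
      moreover have "{c..q} \<inter> fst ` set (pieces l h (x # xs)) = {p}"
      proof -
        have "?p \<notin> {c..q}" using c(2) by (meson atLeastAtMost_iff leD)
        moreover have "fst ` set (pieces l h (x # xs)) = insert ?p (fst ` set ?ps)" by (simp add: ps)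
        ultimately show ?thesis using c(4) Int_insert_right_if0 by metis
      qed
      moreover have "(c, q) \<in> set (x # xs)" "l < c" using c(1,2) True by simp_all
      ultimately show ?thesis by blast
    qed
  qed
qed simp

section \<open>A nonzero Koszul class\<close>

lemma lookup_ksign_mult: "lookup (ksign i T * p) t = ksign i T * lookup p t"
  for p :: "'k::field mpoly"
  unfolding ksign_def by (cases "even (card {j \<in> T. j < i})") simp_all

definition transversals :: "nat set set \<Rightarrow> nat set set" where
  "transversals \<P> = {T. T \<subseteq> \<Union>\<P> \<and> (\<forall>P\<in>\<P>. \<exists>t. T \<inter> P = {t})}"

text \<open>
  The vertices of \<open>U\<close> whose removal leaves a transversal are the two vertices in the one member of the
  family that \<open>U\<close> meets twice, or there are none. By convexity the two are neighbours in \<open>U\<close>, so their signs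
  are opposite.
\<close>

lemma sum_sign_transversals:
  assumes fin: "finite U" and U: "U \<subseteq> \<Union>\<P>"
    and disj: "\<And>P Q. P \<in> \<P> \<Longrightarrow> Q \<in> \<P> \<Longrightarrow> P \<noteq> Q \<Longrightarrow> P \<inter> Q = {}"
    and conv: "\<And>P x y z. P \<in> \<P> \<Longrightarrow> x \<in> P \<Longrightarrow> z \<in> P \<Longrightarrow> x \<le> y \<Longrightarrow> y \<le> z \<Longrightarrow> y \<in> P"
  shows "(\<Sum>i\<in>{i \<in> U. U - {i} \<in> transversals \<P>}. ksign i (U - {i})) = (0 :: 'a::comm_ring_1)"
proof (cases "{i \<in> U. U - {i} \<in> transversals \<P>} = {}")
  case True
  then show ?thesis by (simp only: sum.empty)
next
  case False
  then obtain i where i: "i \<in> U" "U - {i} \<in> transversals \<P>" by blast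
  obtain P where P: "P \<in> \<P>" "i \<in> P" using i(1) U by blast
  obtain j where j: "(U - {i}) \<inter> P = {j}" using i(2) P(1) unfolding transversals_def by blast
  have ij: "i \<noteq> j" "j \<in> U" "j \<in> P" "U \<inter> P = {i, j}" using j i(1) P(2) by auto
  have "U - {j} \<in> transversals \<P>" unfolding transversals_def
  proof (intro CollectI conjI ballI)
    show "U - {j} \<subseteq> \<Union>\<P>" using U by blast
    fix Q assume Q: "Q \<in> \<P>"
    show "\<exists>t. (U - {j}) \<inter> Q = {t}"
    proof (cases "Q = P")
      case True
      then show ?thesis using ij by (intro exI[of _ i]) auto
    next
      case False
      then have "i \<notin> Q" "j \<notin> Q" using disj[OF Q P(1)] P(2) ij(3) by auto
      then have "(U - {j}) \<inter> Q = (U - {i}) \<inter> Q" by blast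
      then show ?thesis using i(2) Q unfolding transversals_def by simp
    qed
  qed
  moreover have "m = i \<or> m = j" if mT: "m \<in> U" "U - {m} \<in> transversals \<P>" for m
  proof (rule ccontr)
    assume m: "\<not> (m = i \<or> m = j)"
    obtain t where "(U - {m}) \<inter> P = {t}" using mT(2) P(1) unfolding transversals_def by blast
    moreover have "i \<in> (U - {m}) \<inter> P" "j \<in> (U - {m}) \<inter> P" using m i(1) P(2) ij by auto
    ultimately show False using ij(1) by (metis singletonD)
  qed
  ultimately have set: "{i \<in> U. U - {i} \<in> transversals \<P>} = {i, j}" using i ij(2) by blast
  have sgn: "ksign y (U - {y}) = (- ksign x (U - {x}) :: 'a)" if "x < y" "{x, y} = {i, j}" for x y
  proof -
    have xy: "x \<in> P" "y \<in> P" "x \<in> U" "y \<in> U" "U \<inter> P = {x, y}" using that(2) ij i(1) P(2) by (auto simp: doubleton_eq_iff)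
    have no: "k < x" if "k \<in> U" "k \<noteq> x" "k < y" for k
    proof (rule ccontr)
      assume "\<not> k < x"
      then have "k \<in> P" using conv[OF P(1) xy(1,2), of k] that by simp
      then show False using that xy(5) by blast
    qed
    have "{k \<in> U - {y}. k < y} = insert x {k \<in> U - {x}. k < x}"
      using no that(1) xy(3) by auto
    then have "card {k \<in> U - {y}. k < y} = Suc (card {k \<in> U - {x}. k < x})" using fin by simp
    then show ?thesis by (simp add: ksign_def)
  qed
  have "ksign i (U - {i}) + ksign j (U - {j}) = (0 :: 'a)"
  proof (cases "i < j")
    case True
    then show ?thesis using sgn[of i j] by simp
  next
    case False
    then have "j < i" using ij(1) by simp
    then show ?thesis using sgn[of j i] by (simp add: insert_commute)
  qed
  then show ?thesis unfolding set using ij(1) by simp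
qed

lemma finite_transversals: "finite (\<Union>\<P>) \<Longrightarrow> finite (transversals \<P>)"
  by (rule finite_subset[of _ "Pow (\<Union>\<P>)"]) (auto simp: transversals_def)

text \<open>
  Grouping the terms by the set \<open>insert i T\<close> reduces the claim to \<open>sum_sign_transversals\<close>.
\<close>

lemma sum_transversals_zero:
  fixes c :: "nat set \<Rightarrow> 'a::comm_ring_1"
  assumes fin: "finite (\<Union>\<P>)"
    and disj: "\<And>P Q. P \<in> \<P> \<Longrightarrow> Q \<in> \<P> \<Longrightarrow> P \<noteq> Q \<Longrightarrow> P \<inter> Q = {}"
    and conv: "\<And>P x y z. P \<in> \<P> \<Longrightarrow> x \<in> P \<Longrightarrow> z \<in> P \<Longrightarrow> x \<le> y \<Longrightarrow> y \<le> z \<Longrightarrow> y \<in> P"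
  shows "(\<Sum>T\<in>transversals \<P>. \<Sum>i\<in>\<Union>\<P> - T. ksign i T * c (insert i T)) = 0"
proof -
  let ?V = "\<Union>\<P>"
  have "(\<Sum>T\<in>transversals \<P>. \<Sum>i\<in>?V - T. ksign i T * c (insert i T))
    = (\<Sum>(T, i)\<in>(SIGMA T:transversals \<P>. ?V - T). ksign i T * c (insert i T))"
    using fin finite_transversals[OF fin] by (intro sum.Sigma) auto
  also have "\<dots> = (\<Sum>(U, i)\<in>(SIGMA U:Pow ?V. {i \<in> U. U - {i} \<in> transversals \<P>}). ksign i (U - {i}) * c U)"
    by (rule sum.reindex_bij_witness[where i = "\<lambda>(U, i). (U - {i}, i)" and j = "\<lambda>(T, i). (insert i T, i)"])
       (auto simp: insert_absorb transversals_def)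
  also have "\<dots> = (\<Sum>U\<in>Pow ?V. \<Sum>i\<in>{i \<in> U. U - {i} \<in> transversals \<P>}. ksign i (U - {i}) * c U)"
    using fin by (intro sum.Sigma[symmetric]) (auto dest: finite_subset)
  also have "\<dots> = (\<Sum>U\<in>Pow ?V. (\<Sum>i\<in>{i \<in> U. U - {i} \<in> transversals \<P>}. ksign i (U - {i})) * c U)"
    by (simp only: sum_distrib_right)
  also have "\<dots> = 0"
  proof (rule sum.neutral, rule ballI)
    fix U assume "U \<in> Pow ?V"
    then have U: "finite U" "U \<subseteq> ?V" using fin finite_subset by auto
    have "(\<Sum>i\<in>{i \<in> U. U - {i} \<in> transversals \<P>}. ksign i (U - {i})) = (0 :: 'a)"
      by (rule sum_sign_transversals[OF U disj conv])
    then show "(\<Sum>i\<in>{i \<in> U. U - {i} \<in> transversals \<P>}. ksign i (U - {i})) * c U = 0" by (simp only: mult_zero_left)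
  qed
  finally show ?thesis .
qed

lemma card_transversal:
  assumes fin: "finite \<P>" "finite (\<Union>\<P>)" and T: "T \<in> transversals \<P>"
    and disj: "\<And>P Q. P \<in> \<P> \<Longrightarrow> Q \<in> \<P> \<Longrightarrow> P \<noteq> Q \<Longrightarrow> P \<inter> Q = {}"
  shows "card T = card \<P>"
proof -
  have eq: "T = (\<Union>P\<in>\<P>. T \<inter> P)" using T unfolding transversals_def by blast
  have fT: "finite T" using T fin(2) finite_subset unfolding transversals_def by blast
  have "card T = card (\<Union>P\<in>\<P>. T \<inter> P)" using eq by (rule arg_cong)
  also have "\<dots> = (\<Sum>P\<in>\<P>. card (T \<inter> P))"
  proof (rule card_UN_disjoint[OF fin(1)])
    show "\<forall>P\<in>\<P>. finite (T \<inter> P)" using fT by blast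
    show "\<forall>P\<in>\<P>. \<forall>Q\<in>\<P>. P \<noteq> Q \<longrightarrow> T \<inter> P \<inter> (T \<inter> Q) = {}" using disj by blast
  qed
  also have "\<dots> = (\<Sum>P\<in>\<P>. 1)"
  proof (rule sum.cong[OF HOL.refl])
    fix P assume "P \<in> \<P>"
    then obtain t where "T \<inter> P = {t}" using T unfolding transversals_def by blast
    then show "card (T \<inter> P) = 1" by simp
  qed
  finally show ?thesis by simp
qed

lemma lookup_var_mult:
  fixes p :: "'k::field mpoly"
  assumes "finite V"
  shows "lookup (var i * p) (indic V) = (if i \<in> V then lookup p (indic (V - {i})) else 0)"
proof (cases "i \<in> V")
  case True
  then have "indic V = single i 1 + indic (V - {i})"
    using assms indic_insert[of "V - {i}" i] by (simp add: insert_absorb)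
  then show ?thesis using True by (simp only: var_def lookup_monom_mult if_True)
next
  case False
  have "indic V \<notin> keys (var i * p)"
  proof
    assume "indic V \<in> keys (var i * p)"
    then obtain t where "indic V = single i 1 + t" unfolding var_def keys_monom_mult by blast
    then have "i \<in> keys (indic V)" by (simp add: keys_plus_nat)
    then show False using False assms by (simp add: keys_indic)
  qed
  then show ?thesis using False by (simp add: in_keys_iff)
qed

lemma separated_distinct:
  fixes qs :: "(nat \<times> nat) list"
  assumes "sorted_wrt (\<lambda>x y. snd x < fst y) qs" "\<forall>(p, q)\<in>set qs. p \<le> q"
  shows "distinct (map fst qs)"
    and "(p, q) \<in> set qs \<Longrightarrow> (p', q') \<in> set qs \<Longrightarrow> (p, q) = (p', q') \<or> q < p' \<or> q' < p"
proof -
  show "distinct (map fst qs)"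
    using assms
  proof (induction qs)
    case (Cons x qs)
    obtain p q where x: "x = (p, q)" by (cases x)
    have "p \<noteq> fst y" if "y \<in> set qs" for y
    proof -
      have "q < fst y" "p \<le> q" using Cons.prems \<open>y \<in> set qs\<close> by (simp_all add: x)
      then show ?thesis by linarith
    qed
    then show ?case using Cons by (auto simp: x)
  qed simp
  show "(p, q) \<in> set qs \<Longrightarrow> (p', q') \<in> set qs \<Longrightarrow> (p, q) = (p', q') \<or> q < p' \<or> q' < p"
    using assms(1)
  proof (induction qs)
    case (Cons x qs)
    have *: "\<And>y. y \<in> set qs \<Longrightarrow> snd x < fst y" using Cons.prems(3) by simp
    show ?case
    proof (cases "x = (p, q) \<or> x = (p', q')")
      case True
      then show ?thesis using *[of "(p, q)"] *[of "(p', q')"] Cons.prems(1,2) by auto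
    next
      case False
      then show ?thesis using Cons by auto
    qed
  qed simp
qed

lemma lookup_koszul_d:
  fixes v :: "nat set \<Rightarrow> 'k::field mpoly"
  assumes V: "V \<subseteq> {1..n}"
  shows "lookup (koszul_d n v T) (indic (V - T)) =
    (\<Sum>i\<in>V - T. ksign i T * lookup (v (insert i T)) (indic (V - insert i T)))"
proof -
  have fin: "finite (V - T)" using V finite_subset_atLeastAtMost by blast
  have "lookup (koszul_d n v T) (indic (V - T)) =
    (\<Sum>i\<in>{1..n} - T. ksign i T * lookup (var i * v (insert i T)) (indic (V - T)))"
    unfolding koszul_d_def lookup_sum by (simp only: mult.assoc lookup_ksign_mult)
  also have "\<dots> = (\<Sum>i\<in>V - T. ksign i T * lookup (var i * v (insert i T)) (indic (V - T)))"
    using V by (intro sum.mono_neutral_right) (auto simp: lookup_var_mult[OF fin])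
  also have "\<dots> = (\<Sum>i\<in>V - T. ksign i T * lookup (v (insert i T)) (indic (V - insert i T)))"
  proof (rule sum.cong[OF HOL.refl])
    fix i assume i: "i \<in> V - T"
    have "V - T - {i} = V - insert i T" by blast
    then show "ksign i T * lookup (var i * v (insert i T)) (indic (V - T))
      = ksign i T * lookup (v (insert i T)) (indic (V - insert i T))"
      using i by (simp add: lookup_var_mult[OF fin])
  qed
  finally show ?thesis .
qed

text \<open>
  The cycle takes values in \<open>I\<close> because putting back a left end into \<open>V - C\<close> completes the interval from which
  its piece was cut (\<open>piece_from_interval\<close>). The functional is nonzero on it, as only the
  transversal consisting of the left ends of \<open>P\<^sub>2, \<dots>, P\<^sub>r\<close> contributes. The functional kills the boundaries of chains with values in
  \<open>I\<close>: adding to \<open>T\<close> a vertex of the first piece gives a transversal of all pieces, whose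
  complement in \<open>V\<close> contains no interval because every interval contains a piece; and adding a vertex of another piece
  gives terms that cancel by \<open>sum_transversals_zero\<close>.
\<close>

lemma koszul_nonzero_intervals:
  assumes xs: "interval_seq xs" and n: "\<forall>(a, b)\<in>set xs. b \<le> n" and ne: "xs \<noteq> []"
  shows "koszul_nonzero n (length (pieces 0 0 xs) - 1)
    {p :: 'k::field mpoly. keys p \<subseteq> interval_upset n {{a..b} |a b. (a, b) \<in> set xs}} {0}"
proof -
  let ?U = "interval_upset n {{a..b} |a b. (a, b) \<in> set xs}"
  let ?I = "{p :: 'k mpoly. keys p \<subseteq> ?U}"
  have I: "submod n ?I" by (rule submod_upset[OF upset_interval_upset])
  have pos: "\<forall>(a, b)\<in>set xs. 0 < a \<longrightarrow> 0 < b" using xs by (auto simp: interval_seq_def)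
  have pos': "0 < a" if "(a, b) \<in> set xs" for a b using xs that by (auto simp: interval_seq_def)
  have "pieces 0 0 xs \<noteq> []"
  proof (cases xs)
    case (Cons x ys)
    obtain a b where x: "x = (a, b)" by (cases x)
    have "0 < a" using pos'[of a b] Cons x by simp
    then show ?thesis by (simp add: Cons x)
  qed (use ne in simp)
  then obtain x ps where "pieces 0 0 xs = x # ps" by (meson list.exhaust)
  then obtain p1 q1 where ps: "pieces 0 0 xs = (p1, q1) # ps" by (cases x) simp
  have bounds: "0 < p \<and> p \<le> q \<and> q \<le> n" if "(p, q) \<in> set ((p1, q1) # ps)" for p q
  proof -
    have "(p, q) \<in> set (pieces 0 0 xs)" using that ps by simp
    then show ?thesis using pieces_bounds[OF xs pos, of p q] piece_from_interval[OF xs pos, of p q] n by blast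
  qed
  have sep: "sorted_wrt (\<lambda>x y. snd x < fst y) ((p1, q1) # ps)" using pieces_separated[OF xs pos] by (simp only: ps)
  have sep': "sorted_wrt (\<lambda>x y. snd x < fst y) ps" "\<forall>(p, q)\<in>set ps. p \<le> q" using sep bounds by auto
  have q1: "q1 < p" if "(p, q) \<in> set ps" for p q using sep that by auto
  have p1: "p1 \<le> q1" using bounds by auto
  define V where "V = pieces_union ((p1, q1) # ps)"
  define \<P> where "\<P> = (\<lambda>(p, q). {p..q}) ` set ps"
  define C where "C = fst ` set ps"
  have UP: "\<Union>\<P> = pieces_union ps" by (auto simp: \<P>_def pieces_union_def)
  have V_eq: "V = {p1..q1} \<union> \<Union>\<P>" unfolding UP by (simp add: V_def pieces_union_def)
  have V: "V \<subseteq> {1..n}" unfolding V_def pieces_union_def using bounds by fastforce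
  have finV: "finite V" using V by (rule finite_subset_atLeastAtMost)
  have finP: "finite (\<Union>\<P>)" "finite \<P>" using finV V_eq by (auto simp: \<P>_def)
  have q1P: "q1 < x" if "x \<in> \<Union>\<P>" for x using that q1 unfolding UP pieces_union_def by fastforce
  have disj: "P \<inter> Q = {}" if "P \<in> \<P>" "Q \<in> \<P>" "P \<noteq> Q" for P Q
  proof -
    obtain p q p' q' where *: "P = {p..q}" "Q = {p'..q'}" "(p, q) \<in> set ps" "(p', q') \<in> set ps"
      using \<open>P \<in> \<P>\<close> \<open>Q \<in> \<P>\<close> by (auto simp: \<P>_def)
    then show ?thesis using separated_distinct(2)[OF sep' *(3,4)] \<open>P \<noteq> Q\<close> by auto
  qed
  have conv: "y \<in> P" if "P \<in> \<P>" "x \<in> P" "z \<in> P" "x \<le> y" "y \<le> z" for P x y z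
    using that by (auto simp: \<P>_def)
  have dist: "distinct ps" using separated_distinct(1)[OF sep'] by (simp add: distinct_map)
  have cardP: "card \<P> = length ps"
  proof -
    have "inj_on (\<lambda>(p, q). {p..q}) (set ps)" using sep'(2) by (auto simp: inj_on_def)
    then show ?thesis unfolding \<P>_def using dist by (simp add: card_image distinct_card)
  qed
  have cardC: "card C = length ps"
    using separated_distinct(1)[OF sep'] by (metis C_def distinct_card length_map list.set_map)
  have finC: "finite C" by (simp add: C_def)
  have CP: "C \<subseteq> \<Union>\<P>"
  proof
    fix y assume "y \<in> C"
    then obtain q where q: "(y, q) \<in> set ps" by (auto simp: C_def)
    then have "y \<in> {y..q}" "{y..q} \<in> \<P>" using sep'(2) unfolding \<P>_def by force+
    then show "y \<in> \<Union>\<P>" by blast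
  qed
  have p1C: "p1 \<notin> \<Union>\<P>" "p1 \<notin> C" using q1P[of p1] p1 CP by auto
  have CT: "C \<in> transversals \<P>" unfolding transversals_def
  proof (intro CollectI conjI ballI CP)
    fix P assume "P \<in> \<P>"
    then obtain p q where pq: "P = {p..q}" "(p, q) \<in> set ps" by (auto simp: \<P>_def)
    have "y = p" if y: "y \<in> C \<inter> P" for y
    proof -
      obtain q' where q': "(y, q') \<in> set ps" using y by (auto simp: C_def)
      have "y \<le> q'" using q' sep'(2) by auto
      moreover have "p \<le> y" "y \<le> q" using y pq(1) by simp_all
      moreover have "(y, q') = (p, q) \<or> q' < p \<or> q < y" by (rule separated_distinct(2)[OF sep' q' pq(2)])
      ultimately show ?thesis by (metis Pair_inject le_trans leD)
    qed
    moreover have "p \<in> C" unfolding C_def using pq(2) by (metis fst_conv imageI)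
    moreover have "p \<in> P" using pq sep'(2) by auto
    ultimately have "C \<inter> P = {p}" by blast
    then show "\<exists>t. C \<inter> P = {t}" by blast
  qed
  have TrP: "T \<subseteq> \<Union>\<P>" if "T \<in> transversals \<P>" for T using that unfolding transversals_def by blast
  have Trn: "T \<subseteq> {1..n}" if "T \<in> transversals \<P>" for T using TrP[OF that] V V_eq by blast
  have Trc: "card T = length ps" if "T \<in> transversals \<P>" for T
    unfolding cardP[symmetric] by (rule card_transversal[OF finP(2,1) that disj])
  let ?C = "insert p1 C"
  \<comment> \<open>\<open>x\<^bsup>V - C\<^esup> e\<^sub>C\<close> for the set of all left ends; here \<open>C\<close> itself leaves out the first of them, \<open>p1\<close>\<close>
  define z where "z T = (if T = ?C then monom (indic (V - ?C)) else 0 :: 'k mpoly)" for T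
  let ?w = "koszul_d n z"
  let ?L = "\<lambda>v T. lookup (v T :: 'k mpoly) (indic (V - T))"
  have wI: "?w T \<in> ?I" for T
    unfolding koszul_d_def
  proof (rule submod_sum[OF I])
    fix i assume i: "i \<in> {1..n} - T"
    show "ksign i T * var i * z (insert i T) \<in> ?I"
    proof (cases "insert i T = ?C")
      case False
      then show ?thesis using submodD(1)[OF I] by (simp add: z_def)
    next
      case True
      then have iC: "i \<in> ?C" by blast
      then have "\<exists>q. (i, q) \<in> set ((p1, q1) # ps)" unfolding C_def by force
      then obtain q where q: "(i, q) \<in> set (pieces 0 0 xs)" unfolding ps by blast
      from piece_from_interval[OF xs pos q] obtain a where a: "(a, q) \<in> set xs"
        "{a..q} \<subseteq> {Suc 0..0} \<union> pieces_union (pieces 0 0 xs)" "{a..q} \<inter> fst ` set (pieces 0 0 xs) = {i}" by blast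
      have "{a..q} \<subseteq> V" "{a..q} \<inter> ?C = {i}" using a(2,3) by (auto simp: ps V_def C_def)
      then have sub: "{a..q} \<subseteq> insert i (V - ?C)" by blast
      have fin: "finite (insert i (V - ?C))" using finV by simp
      have "var i * monom (indic (V - ?C)) = (monom (indic (insert i (V - ?C))) :: 'k mpoly)"
        using finV iC indic_insert[of "V - ?C" i] by (simp add: var_def mult_single)
      moreover have "indic (insert i (V - ?C)) \<in> ?U"
      proof -
        have "indic (insert i (V - ?C)) \<in> expos n"
          unfolding expos_def mem_Collect_eq keys_indic[OF fin] using i V by blast
        moreover have "{a..q} \<in> {{a..b} |a b. (a, b) \<in> set xs}" using a(1) by blast
        moreover have "{a..q} \<subseteq> keys (indic (insert i (V - ?C)))"
          unfolding keys_indic[OF fin] by (rule sub)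
        ultimately show ?thesis unfolding interval_upset_def by blast
      qed
      ultimately have "var i * z (insert i T) \<in> ?I" using True by (simp add: z_def)
      then have "ksign i T * (var i * z (insert i T)) \<in> ?I" by (rule submodD(3)[OF I ksign_polys_in])
      then show ?thesis by (simp only: mult.assoc)
    qed
  qed
  have len: "length (pieces 0 0 xs) - 1 = length ps" by (simp add: ps)
  show ?thesis unfolding len koszul_nonzero_def
  proof (intro exI[of _ ?w] conjI allI impI notI)
    show "?w T \<in> ?I" for T by (rule wI)
    show "koszul_d n ?w T \<in> {0}" if "T \<subseteq> {1..n}" for T using koszul_d_d[OF that] by blast
    assume "\<exists>v. (\<forall>T\<subseteq>{1..n}. card T = Suc (length ps) \<longrightarrow> v T \<in> ?I) \<and>
             (\<forall>T\<subseteq>{1..n}. card T = length ps \<longrightarrow> ?w T - koszul_d n v T \<in> {0})"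
    then obtain v where v: "\<forall>T\<subseteq>{1..n}. card T = Suc (length ps) \<longrightarrow> v T \<in> ?I"
      "\<forall>T\<subseteq>{1..n}. card T = length ps \<longrightarrow> ?w T - koszul_d n v T \<in> {0}" by blast
    have wv: "?w T = koszul_d n v T" if "T \<in> transversals \<P>" for T
      using v(2) Trn[OF that] Trc[OF that] by simp
    have "(\<Sum>T\<in>transversals \<P>. ?L ?w T) = (\<Sum>T\<in>transversals \<P>. ?L (koszul_d n v) T)"
      by (rule sum.cong[OF HOL.refl]) (simp only: wv)
    also have "\<dots> = (\<Sum>T\<in>transversals \<P>. \<Sum>i\<in>\<Union>\<P> - T. ksign i T * ?L v (insert i T))"
    proof (rule sum.cong[OF HOL.refl])
      fix T assume T: "T \<in> transversals \<P>"
      have finT: "finite T" using Trn[OF T] by (rule finite_subset_atLeastAtMost)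
      \<comment> \<open>with a vertex of the first piece added, \<open>T\<close> meets every interval\<close>
      have zero: "?L v (insert i T) = 0" if i: "i \<in> V - T" "i \<notin> \<Union>\<P>" for i
      proof -
        have i1: "i \<in> {p1..q1}" using i V_eq by blast
        have "card (insert i T) = Suc (length ps)" using finT i(1) Trc[OF T] by simp
        moreover have "insert i T \<subseteq> {1..n}" using i(1) V Trn[OF T] by blast
        ultimately have "v (insert i T) \<in> ?I" using v(1) by blast
        moreover have "indic (V - insert i T) \<notin> ?U"
        proof
          assume "indic (V - insert i T) \<in> ?U"
          then obtain a b where ab: "(a, b) \<in> set xs" "{a..b} \<subseteq> V - insert i T"
            unfolding interval_upset_def using keys_indic[of "V - insert i T"] finV by auto
          obtain p q where pq: "(p, q) \<in> set (pieces 0 0 xs)" "{p..q} \<subseteq> {a..b}"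
            using piece_in_interval[OF xs ab(1) pos'[OF ab(1)] pos] by blast
          show False
          proof (cases "(p, q) = (p1, q1)")
            case True
            then show ?thesis using i1 pq(2) ab(2) by blast
          next
            case False
            then have "(p, q) \<in> set ps" using pq(1) unfolding ps by auto
            then have "{p..q} \<in> \<P>" unfolding \<P>_def by force
            then obtain t where "T \<inter> {p..q} = {t}" using T unfolding transversals_def by blast
            then show ?thesis using pq(2) ab(2) by blast
          qed
        qed
        ultimately have "indic (V - insert i T) \<notin> keys (v (insert i T))" by blast
        then show ?thesis by (simp add: in_keys_iff)
      qed
      have "?L (koszul_d n v) T = (\<Sum>i\<in>V - T. ksign i T * ?L v (insert i T))" by (rule lookup_koszul_d[OF V])
      also have "\<dots> = (\<Sum>i\<in>\<Union>\<P> - T. ksign i T * ?L v (insert i T))"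
      proof (rule sum.mono_neutral_right)
        show "finite (V - T)" using finV by simp
        show "\<Union>\<P> - T \<subseteq> V - T" using V_eq by blast
        show "\<forall>i\<in>(V - T) - (\<Union>\<P> - T). ksign i T * ?L v (insert i T) = 0"
        proof
          fix i assume "i \<in> (V - T) - (\<Union>\<P> - T)"
          then have "?L v (insert i T) = 0" by (intro zero) blast+
          then show "ksign i T * ?L v (insert i T) = 0" by (simp only: mult_zero_right)
        qed
      qed
      finally show "?L (koszul_d n v) T = (\<Sum>i\<in>\<Union>\<P> - T. ksign i T * ?L v (insert i T))" .
    qed
    also have "\<dots> = 0" by (rule sum_transversals_zero[OF finP(1) disj conv])
    finally have zero: "(\<Sum>T\<in>transversals \<P>. ?L ?w T) = 0" .
    have "?L ?w T = (if T = C then ksign p1 C else 0)" if T: "T \<in> transversals \<P>" for T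
    proof -
      have p1T: "p1 \<notin> T" using TrP[OF T] p1C by blast
      have "?L ?w T = (\<Sum>i\<in>V - T. ksign i T * ?L z (insert i T))" by (rule lookup_koszul_d[OF V])
      also have "\<dots> = (\<Sum>i\<in>V - T. if i = p1 then (if T = C then ksign p1 C else 0) else 0)"
      proof (rule sum.cong[OF HOL.refl])
        fix i assume i: "i \<in> V - T"
        have "insert i T = ?C \<longleftrightarrow> i = p1 \<and> T = C"
        proof
          assume h: "insert i T = ?C"
          have "p1 \<in> insert i T" unfolding h by (rule insertI1)
          then have "i = p1" using p1T by blast
          then show "i = p1 \<and> T = C" using h insert_ident[OF p1T p1C(2)] by blast
        qed simp
        then show "ksign i T * ?L z (insert i T) = (if i = p1 then (if T = C then ksign p1 C else 0) else 0)"
          unfolding z_def by (cases "i = p1 \<and> T = C") auto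
      qed
      also have "\<dots> = (if T = C then ksign p1 C else 0)"
      proof -
        have "p1 \<in> V - T" using p1T p1 V_eq by simp
        then show ?thesis using finV by (simp add: sum.delta)
      qed
      finally show ?thesis .
    qed
    then have "(\<Sum>T\<in>transversals \<P>. ?L ?w T) = (\<Sum>T\<in>transversals \<P>. if T = C then ksign p1 C else 0)"
      by (intro sum.cong[OF HOL.refl])
    also have "\<dots> = ksign p1 C" using CT finite_transversals[OF finP(1)] by (simp add: sum.delta)
    finally have "ksign p1 C = (0 :: 'k)" using zero by simp
    then show False using ksign_square[of p1 C, where 'a = 'k] by simp
  qed
qed


section \<open>Ideals of the polynomial ring as modules\<close>

lemma poly_ring_simps:
  "carrier (poly_ring n) = polys_in {1..n}" "mult (poly_ring n) = (*)" "add (poly_ring n) = (+)"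
  "zero (poly_ring n) = 0" "one (poly_ring n) = 1"
  by (simp_all add: poly_ring_def)

lemma submod_if_ideal:
  assumes "ideal I (poly_ring n)"
  shows "submod n I" "I \<subseteq> polys_in {1..n}"
proof -
  interpret ideal I "poly_ring n" by fact
  show "I \<subseteq> polys_in {1..n}" using a_subset by (simp add: poly_ring_def)
  show "submod n I" unfolding submod_def
    using additive_subgroup.zero_closed[OF is_additive_subgroup] additive_subgroup.a_closed[OF is_additive_subgroup] I_l_closed
    by (simp add: poly_ring_def)
qed

lemma ideal_if_submod:
  fixes I :: "'k::field mpoly set"
  assumes "submod n I" "I \<subseteq> polys_in {1..n}"
  shows "ideal I (poly_ring n)"
proof -
  interpret cring "poly_ring n :: 'k mpoly ring" by (rule cring_poly_ring)
  show ?thesis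
  proof (rule idealI[OF ring_axioms])
    show "subgroup I (add_monoid (poly_ring n))"
    proof (rule add.subgroupI)
      show "I \<subseteq> carrier (poly_ring n)" using assms(2) by (simp add: poly_ring_def)
      show "I \<noteq> {}" using submodD(1)[OF assms(1)] by blast
      fix a assume a: "a \<in> I"
      have "a \<in> carrier (poly_ring n)" "- a \<in> carrier (poly_ring n)"
        using a submod_uminus[OF assms(1) a] assms(2) by (auto simp: poly_ring_def)
      moreover have "- a \<oplus>\<^bsub>poly_ring n\<^esub> a = \<zero>\<^bsub>poly_ring n\<^esub>" by (simp add: poly_ring_def)
      ultimately have "\<ominus>\<^bsub>poly_ring n\<^esub> a = - a" using minus_equality by blast
      then show "\<ominus>\<^bsub>poly_ring n\<^esub> a \<in> I" using submod_uminus[OF assms(1) a] by simp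
      fix b assume "b \<in> I"
      then show "a \<oplus>\<^bsub>poly_ring n\<^esub> b \<in> I" using submodD(2)[OF assms(1) a] by (simp add: poly_ring_def)
    qed
    fix a x :: "'k mpoly" assume a: "a \<in> I" and x: "x \<in> carrier (poly_ring n)"
    have "x * a \<in> I" using submodD(3)[OF assms(1) _ a] x by (simp add: poly_ring_def)
    then show "x \<otimes>\<^bsub>poly_ring n\<^esub> a \<in> I" "a \<otimes>\<^bsub>poly_ring n\<^esub> x \<in> I"
      by (simp_all add: poly_ring_def mult.commute)
  qed
qed

lemma genideal_submod:
  fixes G :: "'k::field mpoly set"
  assumes "G \<subseteq> polys_in {1..n}"
  shows "submod n (Idl\<^bsub>poly_ring n\<^esub> G)" "G \<subseteq> Idl\<^bsub>poly_ring n\<^esub> G"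
    "submod n J \<Longrightarrow> J \<subseteq> polys_in {1..n} \<Longrightarrow> G \<subseteq> J \<Longrightarrow> Idl\<^bsub>poly_ring n\<^esub> G \<subseteq> J"
proof -
  interpret cring "poly_ring n :: 'k mpoly ring" by (rule cring_poly_ring)
  have G: "G \<subseteq> carrier (poly_ring n)" using assms by (simp only: poly_ring_simps)
  show "submod n (Idl\<^bsub>poly_ring n\<^esub> G)" by (rule submod_if_ideal(1)[OF genideal_ideal[OF G]])
  show "G \<subseteq> Idl\<^bsub>poly_ring n\<^esub> G" by (rule genideal_self[OF G])
  show "submod n J \<Longrightarrow> J \<subseteq> polys_in {1..n} \<Longrightarrow> G \<subseteq> J \<Longrightarrow> Idl\<^bsub>poly_ring n\<^esub> G \<subseteq> J"
    by (rule genideal_minimal[OF ideal_if_submod])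
qed

lemma max_ideal_expand:
  fixes f :: "'k::field mpoly"
  assumes "f \<in> max_ideal n"
  shows "\<exists>g. (\<forall>i\<in>{1..n}. g i \<in> polys_in {1..n}) \<and> f = (\<Sum>i\<in>{1..n}. var i * g i)"
proof -
  let ?J = "{f :: 'k mpoly. \<exists>g. (\<forall>i\<in>{1..n}. g i \<in> polys_in {1..n}) \<and> f = (\<Sum>i\<in>{1..n}. var i * g i)}"
  have "submod n ?J" unfolding submod_def
  proof (intro conjI ballI)
    show "0 \<in> ?J" by (intro CollectI exI[of _ "\<lambda>_. 0"]) (simp add: submodD(1)[OF submod_polys_in[unfolded One_nat_def]])
  next
    fix a b :: "'k mpoly" assume "a \<in> ?J" "b \<in> ?J"
    then obtain g h where g: "\<forall>i\<in>{1..n}. g i \<in> polys_in {1..n}" "a = (\<Sum>i\<in>{1..n}. var i * g i)"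
      and h: "\<forall>i\<in>{1..n}. h i \<in> polys_in {1..n}" "b = (\<Sum>i\<in>{1..n}. var i * h i)" by blast
    have "a + b = (\<Sum>i\<in>{1..n}. var i * (g i + h i))" by (simp add: g(2) h(2) sum.distrib distrib_left)
    moreover have "\<forall>i\<in>{1..n}. g i + h i \<in> polys_in {1..n}" using g(1) h(1) polys_in_add by blast
    ultimately show "a + b \<in> ?J" by (intro CollectI exI[of _ "\<lambda>i. g i + h i"]) simp
  next
    fix p a :: "'k mpoly" assume p: "p \<in> polys_in {1..n}" and "a \<in> ?J"
    then obtain g where g: "\<forall>i\<in>{1..n}. g i \<in> polys_in {1..n}" "a = (\<Sum>i\<in>{1..n}. var i * g i)" by blast
    have "p * a = (\<Sum>i\<in>{1..n}. var i * (p * g i))" by (simp add: g(2) sum_distrib_left ac_simps)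
    moreover have "\<forall>i\<in>{1..n}. p * g i \<in> polys_in {1..n}" using g(1) p polys_in_mult by blast
    ultimately show "p * a \<in> ?J" by (intro CollectI exI[of _ "\<lambda>i. p * g i"]) simp
  qed
  moreover have "?J \<subseteq> polys_in {1..n}"
  proof
    fix f :: "'k mpoly" assume "f \<in> ?J"
    then obtain g where g: "\<forall>i\<in>{1..n}. g i \<in> polys_in {1..n}" "f = (\<Sum>i\<in>{1..n}. var i * g i)" by blast
    show "f \<in> polys_in {1..n}" unfolding g(2)
      using g(1) by (intro submod_sum[OF submod_polys_in] polys_in_mult var_polys_in) blast+
  qed
  moreover have "var ` {1..n} \<subseteq> ?J"
  proof
    fix x :: "'k mpoly" assume "x \<in> var ` {1..n}"
    then obtain i where i: "i \<in> {1..n}" "x = var i" by blast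
    have "(\<Sum>j\<in>{1..n}. var j * (if j = i then 1 else 0)) = (\<Sum>j\<in>{1..n}. if j = i then x else 0)"
      by (rule sum.cong) (simp_all add: i(2))
    also have "\<dots> = x" using i(1) by simp
    finally show "x \<in> ?J" by (intro CollectI exI[of _ "\<lambda>j. if j = i then 1 else 0"]) (simp add: polys_in_def)
  qed
  moreover have "(var ` {1..n} :: 'k mpoly set) \<subseteq> polys_in {1..n}" using var_polys_in by blast
  ultimately have "max_ideal n \<subseteq> ?J" unfolding max_ideal_def by (intro genideal_submod(3))
  then show ?thesis using assms by blast
qed

lemma elem_sym_max_ideal: "elem_sym n (Suc k) \<in> (max_ideal n :: 'k::field mpoly set)"
proof -
  have vars: "(var ` {1..n} :: 'k mpoly set) \<subseteq> polys_in {1..n}" using var_polys_in by blast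
  note J = genideal_submod(1,2)[OF vars, folded max_ideal_def]
  show ?thesis unfolding elem_sym_def
  proof (rule submod_sum[OF J(1)])
    fix T assume "T \<in> {T. T \<subseteq> {1..n} \<and> card T = Suc k}"
    then have T: "T \<subseteq> {1..n}" "finite T" "T \<noteq> {}" using finite_subset_atLeastAtMost by auto
    then obtain i where i: "i \<in> T" by blast
    have "indic T = single i 1 + indic (T - {i})"
      using indic_insert[of "T - {i}" i] i T(2) by (simp add: insert_absorb)
    then have eq: "monom (indic T) = (monom (indic (T - {i})) * var i :: 'k mpoly)"
      by (simp add: var_def mult_single add.commute)
    have "keys (indic (T - {i})) = T - {i}" using T(2) by (intro keys_indic) simp
    then have "indic (T - {i}) \<in> expos n" unfolding expos_def using T(1) by blast
    then have "(monom (indic (T - {i})) :: 'k mpoly) \<in> polys_in {1..n}" unfolding polys_in_iff by simp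
    moreover have "var i \<in> (max_ideal n :: 'k mpoly set)" using J(2) i T(1) by blast
    ultimately show "monom (indic T) \<in> (max_ideal n :: 'k mpoly set)" unfolding eq by (rule submodD(3)[OF J(1)])
  qed
qed

lemma interval_ideal_eq:
  assumes len: "length \<alpha> = length \<beta>" and xs: "interval_seq (zip \<alpha> \<beta>)" "\<forall>(a, b)\<in>set (zip \<alpha> \<beta>). b \<le> n"
  shows "(interval_ideal n \<alpha> \<beta> :: 'k::field mpoly set) =
    {p. keys p \<subseteq> interval_upset n {{a..b} |a b. (a, b) \<in> set (zip \<alpha> \<beta>)}}"
    (is "_ = ?I")
proof -
  let ?U = "interval_upset n {{a..b} |a b. (a, b) \<in> set (zip \<alpha> \<beta>)}"
  let ?G = "(\<lambda>i. \<Prod>k\<in>{\<alpha> ! i..\<beta> ! i}. var k) ` {..<length \<alpha>} :: 'k mpoly set"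
  have G: "?G = (\<lambda>(a, b). monom (indic {a..b})) ` set (zip \<alpha> \<beta>)"
  proof -
    have "set (zip \<alpha> \<beta>) = (\<lambda>i. (\<alpha> ! i, \<beta> ! i)) ` {..<length \<alpha>}"
      using len by (auto simp: set_zip)
    then show ?thesis by (simp add: image_image monom_indic)
  qed
  have ab: "{a..b} \<subseteq> {1..n}" if "(a, b) \<in> set (zip \<alpha> \<beta>)" for a b
    using that xs unfolding interval_seq_def by fastforce
  have U: "indic {a..b} \<in> ?U" if "(a, b) \<in> set (zip \<alpha> \<beta>)" for a b
  proof -
    have k: "keys (indic {a..b}) = {a..b}" by (rule keys_indic) simp
    have "indic {a..b} \<in> expos n" unfolding expos_def using ab[OF that] k by blast
    then show ?thesis unfolding interval_upset_def using k that by blast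
  qed
  have up: "upset n ?U" by (rule upset_interval_upset)
  have I: "submod n ?I" by (rule submod_upset[OF up])
  have IS: "?I \<subseteq> polys_in {1..n}" by (rule upset_ideal_subset[OF up])
  have GI: "?G \<subseteq> ?I" unfolding G using U by auto
  then have GS: "?G \<subseteq> polys_in {1..n}" using IS by blast
  note J = genideal_submod[OF GS, folded interval_ideal_def]
  show ?thesis
  proof
    show "interval_ideal n \<alpha> \<beta> \<subseteq> ?I" by (rule J(3)[OF I IS GI])
    show "?I \<subseteq> interval_ideal n \<alpha> \<beta>"
    proof
      fix p :: "'k mpoly" assume p: "p \<in> ?I"
      have "(\<Sum>t\<in>keys p. single t (lookup p t)) \<in> interval_ideal n \<alpha> \<beta>"
      proof (rule submod_sum[OF J(1)])
        fix t assume "t \<in> keys p"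
        then have "t \<in> ?U" using p by blast
        then obtain a b where t: "t \<in> expos n" "(a, b) \<in> set (zip \<alpha> \<beta>)" "{a..b} \<subseteq> keys t"
          unfolding interval_upset_def by blast
        have eq: "indic {a..b} + (t - indic {a..b}) = t" by (rule indic_plus_minus[OF _ t(3)]) simp
        let ?q = "single (t - indic {a..b}) (lookup p t)"
        have "t - indic {a..b} \<in> expos n" using eq t(1) by (metis expos_add_iff)
        then have "?q \<in> polys_in {1..n}" unfolding polys_in_iff by simp
        moreover have "(monom (indic {a..b}) :: 'k mpoly) \<in> interval_ideal n \<alpha> \<beta>"
          using subsetD[OF J(2)[unfolded G] imageI[OF t(2)]] by simp
        ultimately have "?q * monom (indic {a..b}) \<in> interval_ideal n \<alpha> \<beta>" by (rule submodD(3)[OF J(1)])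
        then show "single t (lookup p t) \<in> interval_ideal n \<alpha> \<beta>"
          using eq by (simp add: mult_single add.commute)
      qed
      then show "p \<in> interval_ideal n \<alpha> \<beta>" using sum_single_keys[of p] by simp
    qed
  qed
qed

lemma finsum_ideal_module:
  fixes I :: "'k::field mpoly set"
  assumes "ideal I (poly_ring n)" "finite A" "\<And>i. i \<in> A \<Longrightarrow> v i \<in> I"
  shows "finsum (ideal_module (poly_ring n) I) v A = sum v A"
proof -
  interpret M: module "poly_ring n" "ideal_module (poly_ring n) I"
    by (rule module_ideal_module[OF assms(1) cring_poly_ring])
  show ?thesis using assms(2,3)
  proof (induction A rule: finite_induct)
    case empty
    then show ?case using M.finsum_empty by (simp add: ideal_module_def poly_ring_def)
  next
    case (insert x F)
    have "v \<in> F \<rightarrow> carrier (ideal_module (poly_ring n) I)" "v x \<in> carrier (ideal_module (poly_ring n) I)"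
      using insert by (auto simp: ideal_module_def)
    from M.finsum_insert[OF insert(1,2) this] insert show ?case
      by (simp add: ideal_module_def poly_ring_def)
  qed
qed

lemma adjoin_eq_sums:
  fixes A :: "'k::field mpoly set"
  shows "adjoin f A {0} k = {(\<Sum>i<k. f i * v i) | v. v \<in> {..<k} \<rightarrow> A}"
proof (induction k)
  case 0
  show ?case by auto
next
  case (Suc k)
  show ?case
  proof (intro equalityI subsetI)
    fix x assume "x \<in> adjoin f A {0} (Suc k)"
    then obtain y a where x: "x = y + f k * a" "y \<in> adjoin f A {0} k" "a \<in> A" by auto
    then obtain v where v: "y = (\<Sum>i<k. f i * v i)" "v \<in> {..<k} \<rightarrow> A" using Suc by blast
    have "x = (\<Sum>i<Suc k. f i * (v(k := a)) i)" by (simp add: x v)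
    moreover have "v(k := a) \<in> {..<Suc k} \<rightarrow> A" using v(2) x(3) by (auto simp: less_Suc_eq)
    ultimately show "x \<in> {(\<Sum>i<Suc k. f i * v i) | v. v \<in> {..<Suc k} \<rightarrow> A}" by blast
  next
    fix x assume "x \<in> {(\<Sum>i<Suc k. f i * v i) | v. v \<in> {..<Suc k} \<rightarrow> A}"
    then obtain v where v: "x = (\<Sum>i<Suc k. f i * v i)" "v \<in> {..<Suc k} \<rightarrow> A" by blast
    have "(\<Sum>i<k. f i * v i) \<in> adjoin f A {0} k" unfolding Suc using v(2) by (intro CollectI exI[of _ v]) auto
    moreover have "x = (\<Sum>i<k. f i * v i) + f k * v k" "v k \<in> A" using v by auto
    ultimately show "x \<in> adjoin f A {0} (Suc k)" by auto
  qed
qed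

lemma seq_smult_ideal_module:
  fixes I :: "'k::field mpoly set"
  assumes I: "ideal I (poly_ring n)" and fs: "set fs \<subseteq> polys_in {1..n}" and k: "k \<le> length fs"
  shows "seq_smult (ideal_module (poly_ring n) I) (take k fs) = adjoin ((!) fs) I {0} k"
proof -
  let ?M = "ideal_module (poly_ring n) I"
  have smult: "x \<odot>\<^bsub>?M\<^esub> y = x * y" for x y by (simp add: ideal_module_def poly_ring_def)
  have car: "carrier ?M = I" by (simp add: ideal_module_def)
  have len: "length (take k fs) = k" using k by simp
  have sums: "finsum ?M (\<lambda>i. take k fs ! i * v i) {..<k} = (\<Sum>i<k. fs ! i * v i)" if v: "v \<in> {..<k} \<rightarrow> I" for v
  proof -
    have "take k fs ! i * v i \<in> I" if "i < k" for i
    proof (rule submodD(3)[OF submod_if_ideal(1)[OF I]])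
      show "take k fs ! i \<in> polys_in {1..n}" using fs \<open>i < k\<close> k by auto
      show "v i \<in> I" using v \<open>i < k\<close> by blast
    qed
    then have "finsum ?M (\<lambda>i. take k fs ! i * v i) {..<k} = (\<Sum>i<k. take k fs ! i * v i)"
      by (intro finsum_ideal_module[OF I]) simp_all
    then show ?thesis by simp
  qed
  show ?thesis unfolding seq_smult_def adjoin_eq_sums smult car len using sums by (metis (no_types, lifting))
qed

lemma regular_sequence_ideal_module:
  fixes I :: "'k::field mpoly set"
  assumes I: "ideal I (poly_ring n)" and fs: "set fs \<subseteq> polys_in {1..n}"
  shows "regular_sequence (ideal_module (poly_ring n) I) fs \<longleftrightarrow>
    regular_on ((!) fs) (length fs) I {0} \<and> adjoin ((!) fs) I {0} (length fs) \<noteq> I"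
proof -
  let ?M = "ideal_module (poly_ring n) I"
  have smult: "x \<odot>\<^bsub>?M\<^esub> y = x * y" for x y by (simp add: ideal_module_def poly_ring_def)
  have car: "carrier ?M = I" by (simp add: ideal_module_def)
  have eq: "seq_smult ?M (take k fs) = adjoin ((!) fs) I {0} k" if "k \<le> length fs" for k
    by (rule seq_smult_ideal_module[OF I fs that])
  show ?thesis unfolding regular_sequence_def regular_on_def smult car
    using eq eq[of "length fs"] by simp
qed

section \<open>Depth\<close>

lemma regular_on_cong:
  assumes "\<And>i. i < k \<Longrightarrow> f i = g i"
  shows "regular_on f k A B \<longleftrightarrow> regular_on g k A B"
proof -
  have "i \<le> k \<longrightarrow> adjoin f A B i = adjoin g A B i" for i
    by (induction i) (simp_all add: assms)
  then show ?thesis unfolding regular_on_def using assms by (metis less_imp_le)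
qed

lemma regular_on_le: "regular_on f k A B \<Longrightarrow> k' \<le> k \<Longrightarrow> regular_on f k' A B"
  by (simp add: regular_on_def)

lemma max_ideal_polys_in: "(max_ideal n :: 'k::field mpoly set) \<subseteq> polys_in {1..n}"
  unfolding max_ideal_def using var_polys_in by (intro genideal_submod(3)[OF _ submod_polys_in]) blast+

text \<open>
  The elementary symmetric polynomials raise the degree, so a monomial of least degree is not reached.
\<close>

lemma adjoin_elem_sym_neq:
  fixes A :: "'k::field mpoly set"
  assumes U: "U \<noteq> {}" and A: "A = {p :: 'k mpoly. keys p \<subseteq> U}"
  shows "adjoin (\<lambda>i. elem_sym n (Suc i)) A {0} m \<noteq> A"
proof -
  obtain t where t: "t \<in> U" "\<And>s. s \<in> U \<Longrightarrow> total_deg n t \<le> total_deg n s"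
    using ex_has_least_nat[of "\<lambda>t. t \<in> U" _ "total_deg n"] U by blast
  have deg: "\<forall>s\<in>keys p. total_deg n t < total_deg n s" if "p \<in> adjoin (\<lambda>i. elem_sym n (Suc i)) A {0} i" for p i
    using that
  proof (induction i arbitrary: p)
    case 0
    then show ?case by simp
  next
    case (Suc i)
    then obtain y a where p: "p = y + elem_sym n (Suc i) * a" "y \<in> adjoin (\<lambda>i. elem_sym n (Suc i)) A {0} i" "a \<in> A" by auto
    show ?case
    proof
      fix s assume "s \<in> keys p"
      then consider "s \<in> keys y" | "s \<in> keys (elem_sym n (Suc i) * a)"
        using keys_add[of y "elem_sym n (Suc i) * a"] p(1) by blast
      then show "total_deg n t < total_deg n s"
      proof cases
        case 1
        then show ?thesis using Suc.IH[OF p(2)] by blast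
      next
        case 2
        then obtain b c where bc: "s = b + c" "b \<in> keys (elem_sym n (Suc i) :: 'k mpoly)" "c \<in> keys a"
          using keys_mult[of "elem_sym n (Suc i)" a] by blast
        have "total_deg n b = Suc i" using bc(2) is_hom_elem_sym[of n "Suc i", where 'a = 'k] unfolding is_hom_def by blast
        moreover have "total_deg n t \<le> total_deg n c" using t(2) bc(3) p(3) A by blast
        ultimately show ?thesis by (simp add: bc(1) total_deg_add)
      qed
    qed
  qed
  have "monom t \<in> A" using t(1) A by simp
  moreover have "monom t \<notin> adjoin (\<lambda>i. elem_sym n (Suc i)) A {0} m"
  proof
    assume "monom t \<in> adjoin (\<lambda>i. elem_sym n (Suc i)) A {0} m"
    from deg[OF this] show False by simp
  qed
  ultimately show ?thesis by blast
qed

lemma interval_upset_nonempty: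
  assumes "interval_seq xs" "\<forall>(a, b)\<in>set xs. b \<le> n" "xs \<noteq> []"
  shows "interval_upset n {{a..b} |a b. (a, b) \<in> set xs} \<noteq> {}"
proof -
  obtain a b where ab: "(a, b) \<in> set xs" using assms(3) by (cases xs) auto
  have "{a..b} \<subseteq> {1..n}" using ab assms(1,2) by (auto simp: interval_seq_def)
  moreover have "keys (indic {a..b}) = {a..b}" by (rule keys_indic) simp
  moreover have "{a..b} \<in> {{a..b} |a b. (a, b) \<in> set xs}" using ab by blast
  ultimately have "indic {a..b} \<in> interval_upset n {{a..b} |a b. (a, b) \<in> set xs}"
    by (simp only: interval_upset_def expos_def mem_Collect_eq) blast
  then show ?thesis by blast
qed

lemma length_pieces_le: "length (pieces l h xs) \<le> length xs"
  by (induction l h xs rule: pieces.induct) auto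

lemma pieces_nonempty:
  assumes "interval_seq xs" "xs \<noteq> []"
  shows "pieces 0 0 xs \<noteq> []"
  using assms by (cases xs) (auto simp: interval_seq_Cons)

text \<open>
  A nonzero Koszul class bounds the lengths of regular sequences, and the elementary symmetric
  polynomials attain the bound.
\<close>

lemma depth_interval_upset:
  fixes I :: "'k::field mpoly set"
  assumes xs: "interval_seq xs" "\<forall>(a, b)\<in>set xs. b \<le> n" "xs \<noteq> []"
    and I: "I = {p. keys p \<subseteq> interval_upset n {{a..b} |a b. (a, b) \<in> set xs}}"
  shows "depth (max_ideal n) (ideal_module (poly_ring n) I) = n - (length (pieces 0 0 xs) - 1)"
proof -
  let ?U = "interval_upset n {{a..b} |a b. (a, b) \<in> set xs}"
  let ?R = "length (pieces 0 0 xs) - 1"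
  let ?m = "n - ?R"
  let ?f = "\<lambda>i. elem_sym n (Suc i) :: 'k mpoly"
  have up: "upset n ?U" by (rule upset_interval_upset)
  have subI: "submod n I" unfolding I by (rule submod_upset[OF up])
  have IS: "I \<subseteq> polys_in {1..n}" unfolding I by (rule upset_ideal_subset[OF up])
  have idI: "ideal I (poly_ring n)" by (rule ideal_if_submod[OF subI IS])
  have zero: "submod n ({0} :: 'k mpoly set)" by (simp add: submod_def)
  have le: "length fs \<le> ?m" if "set fs \<subseteq> max_ideal n" "regular_sequence (ideal_module (poly_ring n) I) fs" for fs
  proof -
    have "set fs \<subseteq> polys_in {1..n}" using that(1) max_ideal_polys_in by blast
    then have "regular_on ((!) fs) (length fs) I {0}" using regular_sequence_ideal_module[OF idI] that(2) by blast
    moreover have "\<exists>g. (\<forall>i\<in>{1..n}. g i \<in> polys_in {1..n}) \<and> fs ! j = (\<Sum>i\<in>{1..n}. var i * g i)" if "j < length fs" for j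
      using max_ideal_expand[of "fs ! j" n] \<open>set fs \<subseteq> max_ideal n\<close> that nth_mem by blast
    moreover have "koszul_nonzero n ?R I {0}" unfolding I by (rule koszul_nonzero_intervals[OF xs])
    ultimately have "?R + length fs \<le> n" by (intro koszul_nonzero_regular_on[OF subI zero])
    then show ?thesis by simp
  qed
  have "regular_on ?f ?m {p. keys p \<subseteq> ?U} {p. keys p \<subseteq> {}}"
  proof (rule regular_on_prime_filt)
    show "prime_filt n ?R {} ?U" by (rule prime_filt_intervals[OF xs(1,2)]) simp
    show "upset n {}" by (simp add: upset_def)
    show "?f i \<in> polys_in {1..n}" for i by (rule elem_sym_polys_in)
    show "regular_on ?f ?m (polys_in {1..n}) (var_ideal n C)" if "C \<subseteq> {1..n}" "card C \<le> ?R" for C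
      by (rule regular_on_le[OF elem_sym_regular_on[OF that(1)]]) (use that(2) in simp)
  qed
  then have reg: "regular_on ?f ?m I {0}" by (simp add: I)
  let ?fs = "map ?f [0..<?m]"
  have fsJ: "set ?fs \<subseteq> max_ideal n" using elem_sym_max_ideal by auto
  have fsS: "set ?fs \<subseteq> polys_in {1..n}" using elem_sym_polys_in by auto
  have "?U \<noteq> {}" by (rule interval_upset_nonempty[OF xs])
  then have "adjoin ?f I {0} ?m \<noteq> I" by (rule adjoin_elem_sym_neq[OF _ I])
  moreover have "adjoin ((!) ?fs) I {0} ?m = adjoin ?f I {0} ?m"
  proof -
    have "i \<le> ?m \<longrightarrow> adjoin ((!) ?fs) I {0} i = adjoin ?f I {0} i" for i by (induction i) simp_all
    then show ?thesis by blast
  qed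
  moreover have "regular_on ((!) ?fs) ?m I {0}"
    using reg regular_on_cong[of ?m "(!) ?fs" ?f I "{0}"] by simp
  ultimately have "regular_sequence (ideal_module (poly_ring n) I) ?fs"
    unfolding regular_sequence_ideal_module[OF idI fsS] by simp
  then have mem: "?m \<in> {length fs | fs. set fs \<subseteq> max_ideal n \<and> regular_sequence (ideal_module (poly_ring n) I) fs}"
    using fsJ by (intro CollectI exI[of _ ?fs]) simp
  show ?thesis unfolding depth_def
  proof (rule Max_eqI)
    show "finite {length fs | fs. set fs \<subseteq> max_ideal n \<and> regular_sequence (ideal_module (poly_ring n) I) fs}"
      by (rule finite_subset[of _ "{..?m}"]) (use le in auto)
    show "k \<le> ?m" if "k \<in> {length fs | fs. set fs \<subseteq> max_ideal n \<and> regular_sequence (ideal_module (poly_ring n) I) fs}" for k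
      using that le by blast
  qed (rule mem)
qed

section \<open>Stanley depth\<close>

text \<open>
  A monomial lies in exactly one block, so the components of an element of \<open>I\<close> are its restrictions to the
  blocks. An upper bound for the Stanley depth of all decompositions is also needed, since \<open>sdepth\<close> is
  a maximum; the decompositions are nonempty because \<open>I \<noteq> 0\<close>.
\<close>

lemma sdepth_ge_if_prime_filt:
  fixes I :: "'k::field mpoly set"
  assumes filt: "prime_filt n R {} U" and ne: "U \<noteq> {}" and I: "I = {p. keys p \<subseteq> U}"
  shows "n - R \<le> sdepth n (ideal_module (poly_ring n) I) (ideal_grading I)"
proof -
  let ?M = "ideal_module (poly_ring n) I"
  have up: "upset n U" by (rule upset_prime_filt[OF filt]) (simp add: upset_def)
  have subI: "submod n I" unfolding I by (rule submod_upset[OF up])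
  have IS: "I \<subseteq> polys_in {1..n}" unfolding I by (rule upset_ideal_subset[OF up])
  have idI: "ideal I (poly_ring n)" by (rule ideal_if_submod[OF subI IS])
  have smult: "x \<odot>\<^bsub>?M\<^esub> y = x * y" and zero: "\<zero>\<^bsub>?M\<^esub> = 0" and car: "carrier ?M = I" for x y
    by (simp_all add: ideal_module_def poly_ring_def)
  from prime_filt_blocks[OF filt] obtain B where B: "\<forall>(w, Z)\<in>set B. w \<in> expos n \<and> Z \<subseteq> {1..n} \<and> n - R \<le> card Z"
    "\<forall>i<length B. block (B ! i) \<subseteq> U" "\<forall>t\<in>U. \<exists>!i. i < length B \<and> t \<in> block (B ! i)"
    unfolding Diff_empty by blast
  define D where "D = map (\<lambda>(w, Z). (monom w :: 'k mpoly, Z)) B"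
  have lenD: "length D = length B" by (simp add: D_def)
  have space: "stanley_space ?M (fst (D ! i)) (snd (D ! i)) = {p. keys p \<subseteq> block (B ! i)}" if "i < length B" for i
  proof -
    obtain w Z where wZ: "B ! i = (w, Z)" by (cases "B ! i")
    have D: "D ! i = (monom w, Z)" using that by (simp add: D_def wZ)
    have pZ: "u \<in> polys_in Z \<longleftrightarrow> keys u \<subseteq> {t. keys t \<subseteq> Z}" for u :: "'k mpoly"
      by (auto simp: polys_in_def)
    show ?thesis unfolding D stanley_space_def smult fst_conv snd_conv wZ
    proof (intro equalityI subsetI)
      fix p :: "'k mpoly" assume "p \<in> {u * monom w |u. u \<in> polys_in Z}"
      then obtain u where "p = u * monom w" "u \<in> polys_in Z" by blast
      then have u: "p = monom w * u" "keys u \<subseteq> {t. keys t \<subseteq> Z}"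
        using pZ by (simp_all only: mult.commute)
      then show "p \<in> {p. keys p \<subseteq> block (w, Z)}" by (auto simp: keys_monom_mult block_def)
    next
      fix p :: "'k mpoly" assume "p \<in> {p. keys p \<subseteq> block (w, Z)}"
      then have "keys p \<subseteq> (+) w ` {t. keys t \<subseteq> Z}" by (simp add: block_def)
      from divide_by_monom[OF this] obtain u where "p = monom w * u" "u \<in> polys_in Z" unfolding pZ by blast
      moreover from this(1) have "p = u * monom w" by (metis mult.commute)
      ultimately show "p \<in> {u * monom w |u. u \<in> polys_in Z}" by blast
    qed
  qed
  have spaceI: "p \<in> I" if "i < length B" "p \<in> stanley_space ?M (fst (D ! i)) (snd (D ! i))" for i p
  proof -
    have "keys p \<subseteq> block (B ! i)" using that(2) unfolding space[OF that(1)] by simp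
    then show ?thesis using B(2) that(1) unfolding I by blast
  qed
  have sums: "(\<Oplus>\<^bsub>?M\<^esub>i\<in>{..<length D}. v i) = (\<Sum>i<length B. v i)"
    if "v \<in> (\<Pi>\<^sub>E i\<in>{..<length D}. stanley_space ?M (fst (D ! i)) (snd (D ! i)))" for v
    unfolding lenD using that spaceI lenD by (intro finsum_ideal_module[OF idI]) (auto simp: PiE_iff)
  have dec: "stanley_decomposition n ?M (ideal_grading I) D" unfolding stanley_decomposition_def
  proof (intro conjI ballI)
    fix x assume "x \<in> set D"
    then obtain w Z where wZ: "x = (monom w, Z)" "(w, Z) \<in> set B" by (auto simp: D_def)
    obtain i where i: "i < length B" "B ! i = (w, Z)" using wZ(2) by (meson in_set_conv_nth)
    have wU: "w \<in> U"
    proof -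
      have "w + 0 \<in> block (w, Z)" unfolding block_def by force
      then show ?thesis using B(2) i by force
    qed
    have Z: "w \<in> expos n" "Z \<subseteq> {1..n}" using B(1) wZ(2) by auto
    have mI: "monom w \<in> I" using wU by (simp add: I)
    have hom: "homogeneous n (ideal_grading I) (monom w)" unfolding homogeneous_def
    proof (intro exI[of _ "\<lambda>i. int (lookup w i)"] conjI allI impI)
      show "int (lookup w i) = 0" if "i \<notin> {1..n}" for i
      proof -
        have "i \<notin> keys w" using Z(1) that unfolding expos_def by blast
        then show ?thesis by (simp add: in_keys_iff)
      qed
      show "monom w \<in> ideal_grading I (\<lambda>i. int (lookup w i))" using mI by (simp add: ideal_grading_def)
    qed
    have free: "u = 0" if "u * monom w = 0" for u :: "'k mpoly"
      using that monom_mult_eq_0_iff[of w u] by (metis mult.commute)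
    note hom
    moreover have "\<forall>u\<in>polys_in Z. u * monom w = 0 \<longrightarrow> u = (0 :: 'k mpoly)" using free by blast
    ultimately show "case x of (m, Z) \<Rightarrow> m \<in> carrier ?M \<and> homogeneous n (ideal_grading I) m \<and> Z \<subseteq> {1..n} \<and>
      (\<forall>u\<in>polys_in Z. u \<odot>\<^bsub>?M\<^esub> m = \<zero>\<^bsub>?M\<^esub> \<longrightarrow> u = 0)"
      unfolding wZ(1) smult zero car prod.case using mI Z(2) by (intro conjI)
  next
    fix x assume "x \<in> carrier ?M"
    then have "x \<in> I" by (simp only: car)
    then have x: "keys x \<subseteq> U" unfolding I by (rule CollectD)
    let ?V = "\<Pi>\<^sub>E i\<in>{..<length D}. stanley_space ?M (fst (D ! i)) (snd (D ! i))"
    define v where "v = (\<lambda>i. if i \<in> {..<length D} then restr (block (B ! i)) x else undefined)"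
    have vV: "v \<in> ?V"
    proof (rule PiE_I)
      fix i assume i: "i \<in> {..<length D}"
      then have "i < length B" using lenD by simp
      then show "v i \<in> stanley_space ?M (fst (D ! i)) (snd (D ! i))"
        using i by (simp add: space v_def keys_restr)
    qed (simp add: v_def)
    have unique: "lookup (\<Sum>i<length B. u i) t = lookup (u j) t"
      if u: "u \<in> ?V" and j: "j < length B" "t \<in> block (B ! j)" for u j t
    proof -
      have zero: "lookup (u i) t = 0" if i: "i < length B" "i \<noteq> j" for i
      proof -
        have "keys (u i) \<subseteq> block (B ! i)" using u i(1) space[OF i(1)] lenD by (auto simp: PiE_iff)
        moreover have "t \<notin> block (B ! i)" using B(2,3) i j by blast
        ultimately show ?thesis by (metis in_keys_iff subsetD)
      qed
      have "lookup (\<Sum>i<length B. u i) t = (\<Sum>i<length B. if i = j then lookup (u j) t else 0)"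
        unfolding lookup_sum by (rule sum.cong) (auto simp: zero)
      then show ?thesis using j(1) by simp
    qed
    have eq: "u i = restr (block (B ! i)) x" if u: "u \<in> ?V" "x = (\<Sum>i<length B. u i)" and i: "i < length B" for u i
    proof (rule poly_mapping_eqI)
      fix t
      show "lookup (u i) t = lookup (restr (block (B ! i)) x) t"
      proof (cases "t \<in> block (B ! i)")
        case True
        then show ?thesis using unique[OF u(1) i True] u(2) by (simp add: lookup_restr)
      next
        case False
        have "keys (u i) \<subseteq> block (B ! i)" using u(1) i space[OF i] lenD by (auto simp: PiE_iff)
        then have "lookup (u i) t = 0" using False by (metis in_keys_iff subsetD)
        then show ?thesis using False by (simp add: lookup_restr)
      qed
    qed
    have xv: "x = (\<Sum>i<length B. v i)"
    proof (rule poly_mapping_eqI)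
      fix t
      show "lookup x t = lookup (\<Sum>i<length B. v i) t"
      proof (cases "t \<in> U")
        case True
        then obtain j where j: "j < length B" "t \<in> block (B ! j)" using B(3) by blast
        show ?thesis using unique[OF vV j] j lenD by (simp add: v_def lookup_restr)
      next
        case False
        then have "lookup x t = 0" using x by (metis in_keys_iff subsetD)
        moreover have "lookup (\<Sum>i<length B. v i) t = 0"
          unfolding lookup_sum using calculation lenD by (intro sum.neutral) (simp add: v_def lookup_restr)
        ultimately show ?thesis by simp
      qed
    qed
    show "\<exists>!v. v \<in> ?V \<and> x = (\<Oplus>\<^bsub>?M\<^esub>i\<in>{..<length D}. v i)"
    proof (rule ex1I[of _ v])
      show "v \<in> ?V \<and> x = (\<Oplus>\<^bsub>?M\<^esub>i\<in>{..<length D}. v i)" using vV xv sums[OF vV] by simp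
      fix u assume u: "u \<in> ?V \<and> x = (\<Oplus>\<^bsub>?M\<^esub>i\<in>{..<length D}. u i)"
      then have xu: "x = (\<Sum>i<length B. u i)" using sums[of u] by simp
      show "u = v"
      proof (rule PiE_ext[OF conjunct1[OF u] vV])
        fix i assume "i \<in> {..<length D}"
        then show "u i = v i" using eq[OF conjunct1[OF u] xu, of i] lenD by (simp add: v_def)
      qed
    qed
  qed
  obtain t where "t \<in> U" using ne by blast
  have bound: "D' \<noteq> [] \<and> sdepth_decomp D' \<le> n" if "stanley_decomposition n ?M (ideal_grading I) D'" for D'
  proof -
    have "D' \<noteq> []"
    proof
      assume "D' = []"
      have "x = 0" if x: "x \<in> I" for x
      proof -
        have "\<exists>v. x = (\<Oplus>\<^bsub>?M\<^esub>i\<in>{..<length D'}. v i)"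
          using \<open>stanley_decomposition n ?M (ideal_grading I) D'\<close> x unfolding stanley_decomposition_def car by blast
        then show ?thesis using finsum_ideal_module[OF idI, of "{}"] \<open>D' = []\<close> by auto
      qed
      moreover have "monom t \<in> I" using \<open>t \<in> U\<close> by (simp add: I)
      ultimately have "(monom t :: 'k mpoly) = 0" by blast
      then have "keys (monom t :: 'k mpoly) = {}" by (simp only: keys_zero)
      then show False by simp
    qed
    then obtain m Z where mZ: "(m, Z) \<in> set D'" by (metis list.set_intros(1) list.exhaust surj_pair)
    have "Z \<subseteq> {1..n}" using that mZ unfolding stanley_decomposition_def by blast
    then have "card Z \<le> n" using card_mono[of "{1..n}" Z] by simp
    moreover have "card Z \<in> (\<lambda>(m, Z). card Z) ` set D'" using mZ by force
    then have "sdepth_decomp D' \<le> card Z" unfolding sdepth_decomp_def by (intro Min_le) simp_all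
    ultimately show ?thesis using \<open>D' \<noteq> []\<close> by simp
  qed
  have "n - R \<le> sdepth_decomp D" unfolding sdepth_decomp_def
  proof (rule Min.boundedI)
    show "(\<lambda>(m, Z). card Z) ` set D \<noteq> {}" using bound[OF dec] by simp
    fix c assume "c \<in> (\<lambda>(m, Z). card Z) ` set D"
    then show "n - R \<le> c" using B(1) by (auto simp: D_def)
  qed simp
  also have "sdepth_decomp D \<le> sdepth n ?M (ideal_grading I)" unfolding sdepth_def
  proof (rule Max_ge)
    show "finite {sdepth_decomp D |D. stanley_decomposition n ?M (ideal_grading I) D}"
      by (rule finite_subset[of _ "{..n}"]) (use bound in auto)
  qed (use dec in blast)
  finally show ?thesis .
qed

section \<open>The recursive invariant\<close>

lemma pieces_reset:
  assumes "interval_seq xs" "\<forall>(a, b)\<in>set xs. l < a \<and> h < a"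
  shows "pieces l h xs = pieces 0 0 xs"
proof (cases xs)
  case (Cons x ys)
  obtain a b where x: "x = (a, b)" by (cases x)
  have "max a (Suc h) = a" "max a (Suc 0) = a" "l < a" "0 < a" using assms by (auto simp: Cons x)
  then show ?thesis by (simp add: Cons x)
qed simp

lemma pieces_skip: "\<forall>(a, b)\<in>set us. a \<le> l \<Longrightarrow> pieces l h (us @ xs) = pieces l h xs"
  by (induction us) auto

lemma jidx_bounds:
  assumes "\<alpha> \<noteq> []" "\<alpha> ! 0 \<le> \<beta> ! 0" "sorted_wrt (<) \<alpha>"
  shows "1 \<le> jidx \<alpha> \<beta>" "jidx \<alpha> \<beta> \<le> length \<alpha>"
    and "i < jidx \<alpha> \<beta> \<Longrightarrow> \<alpha> ! i \<le> \<beta> ! 0"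
    and "jidx \<alpha> \<beta> \<le> i \<Longrightarrow> i < length \<alpha> \<Longrightarrow> \<beta> ! 0 < \<alpha> ! i"
proof -
  let ?X = "{i \<in> {1..length \<alpha>}. \<alpha> ! (i - 1) \<le> \<beta> ! 0}"
  have fin: "finite ?X" by simp
  have "0 < length \<alpha>" using assms(1) by simp
  then have "1 \<in> ?X" using assms(2) by (simp add: Suc_leI)
  then have J: "jidx \<alpha> \<beta> \<in> ?X" unfolding jidx_def by (intro Max_in[OF fin]) blast
  then show 1: "1 \<le> jidx \<alpha> \<beta>" "jidx \<alpha> \<beta> \<le> length \<alpha>" by simp_all
  have last: "\<alpha> ! (jidx \<alpha> \<beta> - 1) \<le> \<beta> ! 0" using J by simp
  show "\<alpha> ! i \<le> \<beta> ! 0" if "i < jidx \<alpha> \<beta>"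
  proof (cases "i = jidx \<alpha> \<beta> - 1")
    case True
    then show ?thesis using last by simp
  next
    case False
    then have "i < jidx \<alpha> \<beta> - 1" "jidx \<alpha> \<beta> - 1 < length \<alpha>" using that 1 by simp_all
    then have "\<alpha> ! i < \<alpha> ! (jidx \<alpha> \<beta> - 1)" using assms(3) sorted_wrt_nth_less by blast
    then show ?thesis using last by simp
  qed
  show "\<beta> ! 0 < \<alpha> ! i" if "jidx \<alpha> \<beta> \<le> i" "i < length \<alpha>"
  proof (rule ccontr)
    assume "\<not> \<beta> ! 0 < \<alpha> ! i"
    then have "Suc i \<in> ?X" using that(2) by simp
    then have "Suc i \<le> jidx \<alpha> \<beta>" unfolding jidx_def by (intro Max_ge[OF fin])
    then show False using that(1) by simp
  qed
qed

lemma interval_seq_drop: "interval_seq xs \<Longrightarrow> interval_seq (drop k xs)"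
  unfolding interval_seq_def using in_set_dropD[of _ k xs] sorted_wrt_drop by blast

lemma interval_seq_zip:
  assumes "length \<alpha> = length \<beta>" "sorted_wrt (<) \<alpha>" "sorted_wrt (<) \<beta>" "\<forall>i<length \<alpha>. 0 < \<alpha> ! i \<and> \<alpha> ! i \<le> \<beta> ! i"
  shows "interval_seq (zip \<alpha> \<beta>)"
  using assms by (auto simp: interval_seq_def sorted_wrt_iff_nth_less set_zip)

text \<open>
  Each step of the recursion removes the first piece. If \<open>j = 1\<close>, the remaining intervals start beyond
  \<open>b\<^sub>1\<close> and nothing is cut. If \<open>j > 1\<close>, the second interval loses its elements up to \<open>b\<^sub>1\<close> and becomes
  \<open>[b\<^sub>1 + 1, b\<^sub>2]\<close>, the next piece; the further intervals with left end at most \<open>b\<^sub>1 + 1\<close> are skipped from there, and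
  they are the ones that the sequences \<open>\<alpha>''\<close>, \<open>\<beta>''\<close> omit.
\<close>

lemma phi_eq_pieces:
  assumes "length \<alpha> = length \<beta>" "sorted_wrt (<) \<alpha>" "sorted_wrt (<) \<beta>" "\<forall>i<length \<alpha>. 0 < \<alpha> ! i \<and> \<alpha> ! i \<le> \<beta> ! i"
  shows "phi n \<alpha> \<beta> = int n - int (length (pieces 0 0 (zip \<alpha> \<beta>)))"
  using assms
proof (induction "length \<alpha>" arbitrary: \<alpha> \<beta> rule: less_induct)
  case less
  note len = less.prems(1) and sorted = less.prems(2,3) and le = less.prems(4)
  show ?case
  proof (cases "\<alpha> = []")
    case True
    then show ?thesis by (simp add: phi.simps)
  next
    case False
    then obtain a \<alpha>' where \<alpha>: "\<alpha> = a # \<alpha>'" by (meson list.exhaust)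
    with len obtain b \<beta>' where \<beta>: "\<beta> = b # \<beta>'" by (metis Suc_length_conv length_Cons)
    let ?j = "jidx \<alpha> \<beta>"
    have ab: "0 < a" "a \<le> b" using le by (force simp: \<alpha> \<beta>)+
    have a0: "\<alpha> ! 0 \<le> \<beta> ! 0" using ab by (simp add: \<alpha> \<beta>)
    note j = jidx_bounds[OF False a0 sorted(1)]
    have seq: "interval_seq (zip \<alpha> \<beta>)" by (rule interval_seq_zip[OF len sorted le])
    have dropI: "interval_seq (zip (drop k \<alpha>) (drop k \<beta>))" for k
      using interval_seq_drop[OF seq, of k] by (simp add: drop_zip)
    have sdrop: "sorted_wrt (<) (drop k \<alpha>)" "sorted_wrt (<) (drop k \<beta>)" for k
      using sorted by (auto intro: sorted_wrt_drop)
    have ledrop: "\<forall>i<length (drop k \<alpha>). 0 < drop k \<alpha> ! i \<and> drop k \<alpha> ! i \<le> drop k \<beta> ! i" for k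
      using le len by simp
    have "max a (Suc 0) = a" using ab by simp
    then have pcs: "pieces 0 0 (zip \<alpha> \<beta>) = (a, b) # pieces a b (zip \<alpha>' \<beta>')" using ab by (simp add: \<alpha> \<beta>)
    show ?thesis
    proof (cases "?j = 1")
      case True
      have "phi n \<alpha> \<beta> = phi n (drop 1 \<alpha>) (drop 1 \<beta>) - 1"
        using True False by (subst phi.simps) (simp add: alpha1_def beta1_def)
      also have "phi n (drop 1 \<alpha>) (drop 1 \<beta>) = int n - int (length (pieces 0 0 (zip \<alpha>' \<beta>')))"
        using less.hyps[of "drop 1 \<alpha>" "drop 1 \<beta>"] len sdrop[of 1] ledrop[of 1] by (simp add: \<alpha> \<beta>)
      also have "pieces 0 0 (zip \<alpha>' \<beta>') = pieces a b (zip \<alpha>' \<beta>')"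
      proof (rule pieces_reset[symmetric])
        show "interval_seq (zip \<alpha>' \<beta>')" using dropI[of 1] by (simp add: \<alpha> \<beta>)
        show "\<forall>(c, d)\<in>set (zip \<alpha>' \<beta>'). a < c \<and> b < c"
        proof (clarify)
          fix c d assume "(c, d) \<in> set (zip \<alpha>' \<beta>')"
          then obtain i where "i < length \<alpha>'" "c = \<alpha>' ! i" by (auto simp: set_zip)
          then have "b < c" using j(4)[of "Suc i"] True by (simp add: \<alpha> \<beta>)
          then show "a < c \<and> b < c" using ab by simp
        qed
      qed
      finally show ?thesis by (simp add: pcs)
    next
      case False
      then have j2: "2 \<le> ?j" using j(1) by linarith
      then have len2: "2 \<le> length \<alpha>" using j(2) by linarith
      then obtain a2 \<alpha>2 where \<alpha>': "\<alpha>' = a2 # \<alpha>2" unfolding \<alpha> by (cases \<alpha>') auto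
      with len obtain b2 \<beta>2 where \<beta>': "\<beta>' = b2 # \<beta>2" unfolding \<alpha> \<beta> by (cases \<beta>') auto
      have a2: "a < a2" "a2 \<le> b" "b < b2" using sorted j(3)[of 1] j2 by (auto simp: \<alpha> \<beta> \<alpha>' \<beta>')
      \<comment> \<open>the number of intervals dropped: an interval starting at \<open>b + 1\<close> contains \<open>[b + 1, b2]\<close> and goes as well\<close>
      define k where "k = (if ?j < length \<alpha> \<and> \<not> \<alpha> ! ?j > \<beta> ! 0 + 1 then ?j + 1 else ?j)"
      have al: "alpha2 \<alpha> \<beta> = (b + 1) # drop k \<alpha>" and be: "beta2 \<alpha> \<beta> = b2 # drop k \<beta>"
        using j(2) len by (auto simp: alpha2_def beta2_def Let_def k_def \<beta> \<beta>')
      have k2: "2 \<le> k" using j2 by (simp add: k_def)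
      have above: "b + 1 < \<alpha> ! i" if i: "k \<le> i" "i < length \<alpha>" for i
      proof (cases "?j < length \<alpha> \<and> \<not> \<alpha> ! ?j > \<beta> ! 0 + 1")
        case True
        then have "?j < i" using i(1) by (simp add: k_def)
        then have "\<alpha> ! ?j < \<alpha> ! i" using sorted(1) i(2) sorted_wrt_nth_less by blast
        moreover have "\<beta> ! 0 < \<alpha> ! ?j" using j(4)[of ?j] True by simp
        ultimately show ?thesis by (simp add: \<beta>)
      next
        case False
        then have k: "k = ?j" by (simp add: k_def)
        then have "\<alpha> ! ?j > \<beta> ! 0 + 1" using False i by simp
        moreover have "\<alpha> ! ?j \<le> \<alpha> ! i"
          using sorted(1) i k sorted_wrt_nth_less[of "(<)" \<alpha> ?j i] by (cases "i = ?j") auto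
        ultimately show ?thesis by (simp add: \<beta>)
      qed
      have below: "\<alpha> ! i \<le> b + 1" if i: "i < k" "i < length \<alpha>" for i
      proof (cases "i < ?j")
        case True
        then show ?thesis using j(3)[OF True] by (simp add: \<beta>)
      next
        case False
        then have "i = ?j" "?j < length \<alpha> \<and> \<not> \<alpha> ! ?j > \<beta> ! 0 + 1" using i unfolding k_def by (auto split: if_splits)
        then show ?thesis by (simp add: \<beta>)
      qed
      have bpos: "0 < b" using ab by simp
      have skip: "pieces (b + 1) b2 (zip \<alpha>2 \<beta>2) = pieces (b + 1) b2 (zip (drop k \<alpha>) (drop k \<beta>))"
      proof -
        have "zip (drop k \<alpha>) (drop k \<beta>) = drop (k - 2) (zip \<alpha>2 \<beta>2)"
          using k2 by (simp add: drop_zip \<alpha> \<beta> \<alpha>' \<beta>' drop_Cons' numeral_2_eq_2)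
        moreover have "\<forall>(c, d)\<in>set (take (k - 2) (zip \<alpha>2 \<beta>2)). c \<le> b + 1"
        proof (clarify)
          fix c d assume "(c, d) \<in> set (take (k - 2) (zip \<alpha>2 \<beta>2))"
          then obtain i where i: "i < k - 2" "i < length \<alpha>2" "c = \<alpha>2 ! i" by (auto simp: take_zip set_zip)
          then show "c \<le> b + 1" using below[of "i + 2"] by (simp add: \<alpha> \<alpha>')
        qed
        ultimately show ?thesis
          using pieces_skip[of "take (k - 2) (zip \<alpha>2 \<beta>2)" "b + 1" b2 "drop (k - 2) (zip \<alpha>2 \<beta>2)"]
          by (simp only: append_take_drop_id)
      qed
      have "max a2 (Suc b) = b + 1" using a2 by simp
      then have "pieces a b (zip \<alpha>' \<beta>') = (b + 1, b2) # pieces (b + 1) b2 (zip \<alpha>2 \<beta>2)" using a2 by (simp add: \<alpha>' \<beta>')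
      also have "\<dots> = pieces 0 0 (zip (alpha2 \<alpha> \<beta>) (beta2 \<alpha> \<beta>))" using skip by (simp add: al be)
      finally have eq: "pieces a b (zip \<alpha>' \<beta>') = pieces 0 0 (zip (alpha2 \<alpha> \<beta>) (beta2 \<alpha> \<beta>))" .
      have "phi n \<alpha> \<beta> = phi n (alpha2 \<alpha> \<beta>) (beta2 \<alpha> \<beta>) - 1"
        using False j2 len2 \<open>\<alpha> \<noteq> []\<close> by (subst phi.simps) auto
      also have "phi n (alpha2 \<alpha> \<beta>) (beta2 \<alpha> \<beta>) = int n - int (length (pieces 0 0 (zip (alpha2 \<alpha> \<beta>) (beta2 \<alpha> \<beta>))))"
      proof (rule less.hyps)
        show "length (alpha2 \<alpha> \<beta>) < length \<alpha>" unfolding al using k2 len2 by simp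
        show "length (alpha2 \<alpha> \<beta>) = length (beta2 \<alpha> \<beta>)" unfolding al be using len by simp
        show "sorted_wrt (<) (alpha2 \<alpha> \<beta>)" unfolding al sorted_wrt.simps
        proof (intro conjI sdrop ballI)
          fix y assume "y \<in> set (drop k \<alpha>)"
          then obtain i where "i < length \<alpha> - k" "y = \<alpha> ! (k + i)" by (auto simp: in_set_conv_nth)
          then show "b + 1 < y" using above[of "k + i"] by simp
        qed
        show "sorted_wrt (<) (beta2 \<alpha> \<beta>)" unfolding be sorted_wrt.simps
        proof (intro conjI sdrop ballI)
          fix y assume "y \<in> set (drop k \<beta>)"
          then obtain i where "i < length \<beta> - k" "y = \<beta> ! (k + i)" by (auto simp: in_set_conv_nth)
          then have i: "k + i < length \<beta>" "y = \<beta> ! (k + i)" by linarith+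
          have "\<beta> ! 1 < \<beta> ! (k + i)" using sorted_wrt_nth_less[OF sorted(2), of 1 "k + i"] k2 i(1) by simp
          then show "b2 < y" using i by (simp add: \<beta> \<beta>')
        qed
        show "\<forall>i<length (alpha2 \<alpha> \<beta>). 0 < alpha2 \<alpha> \<beta> ! i \<and> alpha2 \<alpha> \<beta> ! i \<le> beta2 \<alpha> \<beta> ! i"
        proof (intro allI impI)
          fix i assume i: "i < length (alpha2 \<alpha> \<beta>)"
          show "0 < alpha2 \<alpha> \<beta> ! i \<and> alpha2 \<alpha> \<beta> ! i \<le> beta2 \<alpha> \<beta> ! i"
          proof (cases i)
            case 0
            then show ?thesis using a2 by (simp add: al be)
          next
            case (Suc i')
            then have "i' < length (drop k \<alpha>)" using i by (simp add: al)
            then show ?thesis using ledrop[of k] unfolding al be Suc nth_Cons_Suc by blast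
          qed
        qed
      qed
      finally show ?thesis by (simp add: pcs eq)
    qed
  qed
qed

theorem proposition1p7:
  fixes n s :: nat and \<alpha> \<beta> :: "nat list" and I :: "'k::field mpoly set"
  assumes "1 \<le> n" and "1 \<le> s" and "s \<le> n"
    and "length \<alpha> = s" and "length \<beta> = s"
    and "sorted_wrt (<) \<alpha>" and "sorted_wrt (<) \<beta>"
    and "1 \<le> \<alpha> ! 0" and "\<beta> ! (s - 1) \<le> n"
    and "\<forall>i<s. \<alpha> ! i \<le> \<beta> ! i"
    and "I = interval_ideal n \<alpha> \<beta>"
  shows "sdepth n (ideal_module (poly_ring n) I) (ideal_grading I)
           \<ge> depth (max_ideal n) (ideal_module (poly_ring n) I)
       \<and> int (depth (max_ideal n) (ideal_module (poly_ring n) I)) = phi n \<alpha> \<beta> + 1"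
proof -
  let ?xs = "zip \<alpha> \<beta>" and ?r = "length (pieces 0 0 (zip \<alpha> \<beta>))"
  let ?U = "interval_upset n {{a..b} |a b. (a, b) \<in> set ?xs}"
  have len: "length \<alpha> = length \<beta>" using assms(4,5) by simp
  have pos: "0 < \<alpha> ! i \<and> \<alpha> ! i \<le> \<beta> ! i" if "i < length \<alpha>" for i
    using assms(4,8,10) that sorted_wrt_nth_less[OF assms(6), of 0 i] by (cases "i = 0") auto
  have bn: "\<beta> ! i \<le> n" if "i < s" for i
  proof (cases "i = s - 1")
    case True
    then show ?thesis using assms(9) by simp
  next
    case False
    then have "\<beta> ! i < \<beta> ! (s - 1)" using that assms(5) by (intro sorted_wrt_nth_less[OF assms(7)]) linarith+
    then show ?thesis using assms(9) by simp
  qed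
  have seq: "interval_seq ?xs" using interval_seq_zip[OF len assms(6,7)] pos by blast
  have bn': "\<forall>(a, b)\<in>set ?xs. b \<le> n" using bn assms(4,5) by (auto simp: set_zip)
  have ne: "?xs \<noteq> []" using assms(2,4,5) by auto
  have I: "I = {p. keys p \<subseteq> ?U}" unfolding assms(11) by (rule interval_ideal_eq[OF len seq bn'])
  have depth: "depth (max_ideal n) (ideal_module (poly_ring n) I) = n - (?r - 1)"
    by (rule depth_interval_upset[OF seq bn' ne I])
  have filt: "prime_filt n (?r - 1) {} ?U" by (rule prime_filt_intervals[OF seq bn']) simp
  have U: "?U \<noteq> {}" by (rule interval_upset_nonempty[OF seq bn' ne])
  have sdepth: "n - (?r - 1) \<le> sdepth n (ideal_module (poly_ring n) I) (ideal_grading I)"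
    by (rule sdepth_ge_if_prime_filt[OF filt U I])
  have phi: "phi n \<alpha> \<beta> = int n - int ?r" using phi_eq_pieces[OF len assms(6,7)] pos by blast
  have "?r \<le> s" using length_pieces_le[of 0 0 ?xs] assms(4,5) by simp
  moreover have "1 \<le> ?r" using pieces_nonempty[OF seq ne] by (cases "pieces 0 0 ?xs") simp_all
  ultimately show ?thesis using depth sdepth phi assms(3) by (simp add: of_nat_diff)
qed

end
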